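(* Let the $n\times p$ matrix $X$ have independent rows $X^{(k)}\sim\mathcal N_p(0,\Sigma_0)$, $k=1,\dots,n$, with precision matrix $\Theta_0:=\Sigma_0^{-1}$. Let $i,j\in\{1,\dots,p\}$ and suppose $\Theta_0\in\mathcal G(d_1,\dots,d_p)$ where $\max(d_i,d_j)=o(\sqrt n/\log p)$. Suppose that $\Theta_0+H/\sqrt n\in B(\Theta_0,c/\sqrt n)$ for $H:=(\Theta_i^0(\Theta_j^0)^T+\Theta_j^0(\Theta_i^0)^T)/\sigma$, where $\sigma^2:=\Theta^0_{ii}\Theta^0_{jj}+(\Theta^0_{ij})^2$. Let $$\hat T_{ij}:=\hat\Theta_{ij}+\hat\Theta_{ji}-\hat\Theta_i^T\hat\Sigma\hat\Theta_j$$ be the de-sparsified nodewise Lasso, where $\hat\Sigma:=X^TX/n$ and $\hat\Theta_i,\hat\Theta_j$ are the $i$-th and $j$-th columns of the nodewise Lasso estimator with tuning parameters $\lambda_i\asymp\lambda_j\asymp\sqrt{\log p/n}$. Then $\hat T_{ij}$ is a strongly asymptotically unbiased estimator of $\Theta_{ij}$ at $\Theta_0$, and for any strongly asymptotically unbiased estimator $T$ of $\Theta_{ij}$ at $\Theta_0$ it holds that $$\mathrm{var}_{\Theta_0}(T)\ \ge\ \frac{\Theta^0_{ii}\Theta^0_{jj}+(\Theta^0_{ij})^2+o(1)}{n},\qquad \mathrm{var}_{\Theta_0}(\hat T_{ij})=\frac{\Theta^0_{ii}\Theta^0_{jj}+(\Theta^0_{ij})^2+o(1)}{n}.$$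
   Context: Asymptotic regime: $n\to\infty$, $p=p_n$ may depend on $n$ (possibly $p\gg n$), and all parameters ($\Theta_0,i,j,d_k,\lambda_i,\lambda_j,\dots$) are sequences that may depend on $n$, the index being suppressed; $\mathcal O(\cdot)$, $o(\cdot)$, $\asymp$ refer to $n\to\infty$. $\|x\|_0$ is the number of non-zero entries of $x$; $\|x\|_n^2:=\|x\|_2^2/n$ for $x\in\mathbb R^n$; $\|\cdot\|_F$ is the Frobenius norm; $\Lambda_{\min},\Lambda_{\max}$ are extreme eigenvalues; $\Theta_k$ and $\Theta_k^0$ denote the $k$-th columns of $\Theta$ and $\Theta_0$, and $\Theta^0_{kl}$ the entries of $\Theta_0$. Parameter set: $\mathcal T\subset\mathbb R^{p\times p}$ is a parameter space, $C_1,C_2,C_3,c>0$ are universal constants (independent of $n,p$), and $$\mathcal G(d_1,\dots,d_p):=\{\Theta\in\mathcal T:\Theta=\Theta^T,\ \|\Theta_k\|_0\le C_1d_k\ (k=1,\dots,p),\ 1/\Lambda_{\min}(\Theta)\le C_2,\ \Lambda_{\max}(\Theta)\le C_3\},$$ $$B(\Theta,\varepsilon):=\{\tilde\Theta\in\mathcal G(d_1,\dots,d_p):\|\tilde\Theta-\Theta\|_F\le\varepsilon\}.$$ $\mathbb E_\Theta,\mathrm{var}_\Theta$ denote expectation and variance when the rows of $X$ are i.i.d. $\mathcal N_p(0,\Theta^{-1})$; an estimator is a measurable function of $X$. Strong asymptotic unbiasedness: $T_n$ is a strongly asymptotically unbiased estimator of $g(\Theta)$ at $\Theta_0$ (in a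 neighbourhood of size $c$) if for some sequence $m_n$ with $n=o(m_n)$, $\mathrm{var}_{\Theta_0}(T_n)=\mathcal O(1/n)$ and for every (sequence) $\Theta\in B(\Theta_0,c/\sqrt{m_n})$, $\lim_{n\to\infty}\sqrt{m_n}(\mathbb E_\Theta T_n-g(\Theta))=0$. Here $g(\Theta)=\Theta_{ij}$. Nodewise Lasso: let $X_k$ be the $k$-th column of $X$ and $X_{-k}$ the matrix $X$ without this column. $\hat\gamma_k:=\arg\min_{\gamma\in\mathbb R^{p-1}}\|X_k-X_{-k}\gamma\|_n^2+2\lambda_k\|\gamma\|_1$, $\hat\tau_k^2:=\|X_k-X_{-k}\hat\gamma_k\|_n^2+\lambda_k\|\hat\gamma_k\|_1$, and $\hat\Theta_k:=(-\hat\gamma_{k,1},\dots,-\hat\gamma_{k,k-1},1,-\hat\gamma_{k,k+1},\dots,-\hat\gamma_{k,p})^T/\hat\tau_k^2$ (entries of $\hat\gamma_k$ indexed by $\{1,\dots,p\}\setminus\{k\}$); $\hat\Theta$ is the matrix with columns $\hat\Theta_1,\dots,\hat\Theta_p$ and entries $\hat\Theta_{kl}$.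
   Formalization: The formal theorem assumes the tuning parameters are at least A·sqrt(log p/n) for some constant A depending only on C1, C2, C3, c, and that Θ0+H/√m lies in B(Θ0,c/√m) for all real m≥n (n large), not only m=n; the claim fails otherwise. *)

theory Defs
  imports
    "HOL-Probability.Probability"
    "HOL-Library.Landau_Symbols"
    "Jordan_Normal_Form.Spectral_Radius"
    "Jordan_Normal_Form.Gauss_Jordan_Elimination"
begin

text \<open>
  The dimension \<open>p\<close> depends on the sample size \<open>n\<close>, so matrices and vectors are those of
  Jordan_Normal_Form, with indices \<open>0, \<dots>, p - 1\<close>.  A data matrix is a function \<open>X\<close> with
  entries \<open>X r k\<close> for \<open>r < n\<close> and \<open>k < p\<close>.
\<close>

no_notation vec_nth (infixl "$" 90)
no_notation inner (infixl "\<bullet>" 70)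

section \<open>Gaussian samples\<close>

definition minv :: "real mat \<Rightarrow> real mat" where
  "minv A = the (mat_inverse A)"

text \<open>
  \<open>normal_vec p \<Sigma>\<close> is the law \<open>N\<^sub>p(0, \<Sigma>)\<close>; it is meaningful for symmetric positive definite
  \<open>\<Sigma>\<close>, the only case in which it is used.
\<close>

definition normal_vec_density :: "nat \<Rightarrow> real mat \<Rightarrow> (nat \<Rightarrow> real) \<Rightarrow> real" where
  "normal_vec_density p \<Sigma> x =
     exp (- (vec p x \<bullet> (minv \<Sigma> *\<^sub>v vec p x)) / 2) / sqrt ((2 * pi) ^ p * det \<Sigma>)"

definition normal_vec :: "nat \<Rightarrow> real mat \<Rightarrow> (nat \<Rightarrow> real) measure" where
  "normal_vec p \<Sigma> =
     density (Pi\<^sub>M {..<p} (\<lambda>_. lborel)) (\<lambda>x. ennreal (normal_vec_density p \<Sigma> x))"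

definition data_space :: "nat \<Rightarrow> nat \<Rightarrow> (nat \<Rightarrow> nat \<Rightarrow> real) measure" where
  "data_space n p = Pi\<^sub>M {..<n} (\<lambda>_. Pi\<^sub>M {..<p} (\<lambda>_. borel))"

text \<open>The law of \<open>X\<close> when its \<open>n\<close> rows are i.i.d.\ \<open>N\<^sub>p(0, \<Theta>\<^sup>-\<^sup>1)\<close>.\<close>

definition sample_law :: "nat \<Rightarrow> nat \<Rightarrow> real mat \<Rightarrow> (nat \<Rightarrow> nat \<Rightarrow> real) measure" where
  "sample_law n p \<Theta> = Pi\<^sub>M {..<n} (\<lambda>_. normal_vec p (minv \<Theta>))"

section \<open>The parameter set\<close>

definition nnz :: "real vec \<Rightarrow> nat" where
  "nnz v = card {l. l < dim_vec v \<and> v $ l \<noteq> 0}"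

definition frob_norm :: "real mat \<Rightarrow> real" where
  "frob_norm A = sqrt (\<Sum>k<dim_row A. \<Sum>l<dim_col A. (A $$ (k, l))\<^sup>2)"

text \<open>
  Used for symmetric matrices of positive dimension only, whose real spectrum is finite,
  nonempty and contains all eigenvalues.
\<close>

definition eig_min :: "real mat \<Rightarrow> real" where
  "eig_min A = Min (spectrum A)"

definition eig_max :: "real mat \<Rightarrow> real" where
  "eig_max A = Max (spectrum A)"

text \<open>
  The elements of the parameter space \<open>\<T>\<close> are precision matrices, hence positive definite.
  This is made explicit by \<open>0 < eig_min \<Theta>\<close>: the bound \<open>1 / eig_min \<Theta> \<le> C2\<close> alone would also hold
  for every nonpositive \<open>eig_min \<Theta>\<close> (recall \<open>1 / 0 = 0\<close>).
\<close>

definition prec_class ::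
  "real \<Rightarrow> real \<Rightarrow> real \<Rightarrow> nat \<Rightarrow> real mat set \<Rightarrow> (nat \<Rightarrow> real) \<Rightarrow> real mat set" where
  "prec_class C1 C2 C3 p \<T> d =
     {\<Theta> \<in> \<T>. \<Theta> \<in> carrier_mat p p \<and> transpose_mat \<Theta> = \<Theta> \<and>
        (\<forall>k<p. real (nnz (col \<Theta> k)) \<le> C1 * d k) \<and>
        0 < eig_min \<Theta> \<and> 1 / eig_min \<Theta> \<le> C2 \<and> eig_max \<Theta> \<le> C3}"

definition prec_ball :: "real mat set \<Rightarrow> real mat \<Rightarrow> real \<Rightarrow> real mat set" where
  "prec_ball G \<Theta> \<epsilon> = {\<Theta>' \<in> G. frob_norm (\<Theta>' - \<Theta>) \<le> \<epsilon>}"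

definition sigma_sq :: "real mat \<Rightarrow> nat \<Rightarrow> nat \<Rightarrow> real" where
  "sigma_sq \<Theta> i j = \<Theta> $$ (i, i) * \<Theta> $$ (j, j) + (\<Theta> $$ (i, j))\<^sup>2"

text \<open>
  The matrix \<open>(\<Theta>\<^sub>i \<Theta>\<^sub>j\<^sup>T + \<Theta>\<^sub>j \<Theta>\<^sub>i\<^sup>T) / \<sigma>\<close>, where \<open>\<Theta>\<^sub>k\<close> is the \<open>k\<close>-th column of \<open>\<Theta>\<close>.
\<close>

definition worst_direction :: "nat \<Rightarrow> real mat \<Rightarrow> nat \<Rightarrow> nat \<Rightarrow> real mat" where
  "worst_direction p \<Theta> i j =
     mat p p (\<lambda>(k, l). (col \<Theta> i $ k * col \<Theta> j $ l + col \<Theta> j $ k * col \<Theta> i $ l)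
                        / sqrt (sigma_sq \<Theta> i j))"

section \<open>Strong asymptotic unbiasedness\<close>

text \<open>
  Estimation of \<open>g n \<Theta>\<close> at the sequence \<open>\<Theta>0\<close> over the classes \<open>G n\<close>, in a neighbourhood of
  size \<open>c\<close>.  Existence of the moments is required explicitly because the Bochner integral of a
  non-integrable function is \<open>0\<close>.
\<close>

definition strongly_asymp_unbiased ::
  "(nat \<Rightarrow> nat) \<Rightarrow> (nat \<Rightarrow> real mat set) \<Rightarrow> real \<Rightarrow> (nat \<Rightarrow> real mat \<Rightarrow> real) \<Rightarrow>
   (nat \<Rightarrow> real mat) \<Rightarrow> (nat \<Rightarrow> (nat \<Rightarrow> nat \<Rightarrow> real) \<Rightarrow> real) \<Rightarrow> bool" where
  "strongly_asymp_unbiased p G c g \<Theta>0 T \<longleftrightarrow>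
     (\<forall>n. T n \<in> borel_measurable (data_space n (p n))) \<and>
     (\<exists>m :: nat \<Rightarrow> real. (\<forall>n. 0 < m n) \<and> (\<lambda>n. real n) \<in> o(m) \<and>
        (\<forall>\<^sub>F n in sequentially. integrable (sample_law n (p n) (\<Theta>0 n)) (\<lambda>X. (T n X)\<^sup>2)) \<and>
        (\<lambda>n. prob_space.variance (sample_law n (p n) (\<Theta>0 n)) (T n)) \<in> O(\<lambda>n. 1 / real n) \<and>
        (\<forall>\<Theta>. (\<forall>n. \<Theta> n \<in> prec_ball (G n) (\<Theta>0 n) (c / sqrt (m n))) \<longrightarrow>
           (\<forall>\<^sub>F n in sequentially. integrable (sample_law n (p n) (\<Theta> n)) (T n)) \<and>
           (\<lambda>n. sqrt (m n) *
                (prob_space.expectation (sample_law n (p n) (\<Theta> n)) (T n) - g n (\<Theta> n)))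
             \<longlonglongrightarrow> 0))"

section \<open>The de-sparsified nodewise Lasso\<close>

text \<open>
  Regression coefficients \<open>\<gamma> \<in> \<real>\<^sup>p\<^sup>-\<^sup>1\<close> for the \<open>k\<close>-th column are indexed by \<open>{..<p} - {k}\<close>.
\<close>

definition resid_sq :: "nat \<Rightarrow> nat \<Rightarrow> nat \<Rightarrow> (nat \<Rightarrow> nat \<Rightarrow> real) \<Rightarrow> (nat \<Rightarrow> real) \<Rightarrow> real" where
  "resid_sq n p k X \<gamma> = (\<Sum>r<n. (X r k - (\<Sum>l\<in>{..<p} - {k}. X r l * \<gamma> l))\<^sup>2) / real n"

definition l1_norm :: "nat \<Rightarrow> nat \<Rightarrow> (nat \<Rightarrow> real) \<Rightarrow> real" where
  "l1_norm p k \<gamma> = (\<Sum>l\<in>{..<p} - {k}. \<bar>\<gamma> l\<bar>)"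

definition coeff_space :: "nat \<Rightarrow> nat \<Rightarrow> (nat \<Rightarrow> real) measure" where
  "coeff_space p k = Pi\<^sub>M ({..<p} - {k}) (\<lambda>_. borel)"

text \<open>
  The Lasso minimiser is unique only almost surely.  \<open>nodewise_lasso\<close> says that \<open>\<gamma>hat\<close> is an
  estimator, i.e.\ measurable, and a minimiser for every data matrix.
\<close>

definition nodewise_lasso ::
  "nat \<Rightarrow> nat \<Rightarrow> nat \<Rightarrow> real \<Rightarrow> ((nat \<Rightarrow> nat \<Rightarrow> real) \<Rightarrow> nat \<Rightarrow> real) \<Rightarrow> bool" where
  "nodewise_lasso n p k lam \<gamma>hat \<longleftrightarrow>
     \<gamma>hat \<in> measurable (data_space n p) (coeff_space p k) \<and>
     (\<forall>X \<in> space (data_space n p).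
        is_arg_min (\<lambda>\<gamma>. resid_sq n p k X \<gamma> + 2 * lam * l1_norm p k \<gamma>)
          (\<lambda>\<gamma>. \<gamma> \<in> space (coeff_space p k)) (\<gamma>hat X))"

definition tau_sq ::
  "nat \<Rightarrow> nat \<Rightarrow> nat \<Rightarrow> real \<Rightarrow> (nat \<Rightarrow> nat \<Rightarrow> real) \<Rightarrow> (nat \<Rightarrow> real) \<Rightarrow> real" where
  "tau_sq n p k lam X \<gamma> = resid_sq n p k X \<gamma> + lam * l1_norm p k \<gamma>"

definition theta_hat_col ::
  "nat \<Rightarrow> nat \<Rightarrow> nat \<Rightarrow> real \<Rightarrow> (nat \<Rightarrow> nat \<Rightarrow> real) \<Rightarrow> (nat \<Rightarrow> real) \<Rightarrow> real vec" where
  "theta_hat_col n p k lam X \<gamma> =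
     vec p (\<lambda>l. (if l = k then 1 else - \<gamma> l) / tau_sq n p k lam X \<gamma>)"

definition sample_cov :: "nat \<Rightarrow> nat \<Rightarrow> (nat \<Rightarrow> nat \<Rightarrow> real) \<Rightarrow> real mat" where
  "sample_cov n p X =
     (let XM = mat n p (\<lambda>(r, k). X r k) in (1 / real n) \<cdot>\<^sub>m (transpose_mat XM * XM))"

text \<open>
  \<open>lam k\<close> and \<open>\<gamma>hat k\<close> are the tuning parameter and the Lasso coefficients of the \<open>k\<close>-th nodewise
  regression; only \<open>k = i\<close> and \<open>k = j\<close> enter.
\<close>

definition desparsified ::
  "nat \<Rightarrow> nat \<Rightarrow> nat \<Rightarrow> nat \<Rightarrow> (nat \<Rightarrow> real) \<Rightarrow>
   (nat \<Rightarrow> (nat \<Rightarrow> nat \<Rightarrow> real) \<Rightarrow> nat \<Rightarrow> real) \<Rightarrow> (nat \<Rightarrow> nat \<Rightarrow> real) \<Rightarrow> real" where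
  "desparsified n p i j lam \<gamma>hat X =
     (let \<Theta>hat = (\<lambda>k. theta_hat_col n p k (lam k) X (\<gamma>hat k X))
      in \<Theta>hat j $ i + \<Theta>hat i $ j - \<Theta>hat i \<bullet> (sample_cov n p X *\<^sub>v \<Theta>hat j))"

end

theory Submission imports Defs "HOL-Real_Asymp.Real_Asymp"
begin

text \<open>
  Write \<open>T\<close> for the de-sparsified estimator and \<open>\<theta>\<^sub>k\<close> for the columns of \<open>\<Theta>\<close>.  The KKT conditions of the two
  Lasso problems give \<open>T = 2 \<Theta>\<^sub>i\<^sub>j - \<theta>\<^sub>i\<^sup>T \<Sigma>hat \<theta>\<^sub>j + \<Delta>\<close>, where \<open>\<bar>\<Delta>\<bar>\<close> is of order \<open>s log p / n = o (n\<^sup>-\<^sup>1\<^sup>/\<^sup>2)\<close> on the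
  event that the sample covariances concentrate (\<open>s\<close> is the sparsity), uniformly over the parameter set.
  The leading term has mean \<open>\<Theta>\<^sub>i\<^sub>j\<close> and variance \<open>\<sigma>\<^sup>2 / n\<close>.  Off that event \<open>\<Delta>\<close> is controlled by a polynomial
  bound on its fourth moment, which rests on inverse moments of \<open>\<parallel>X\<^sub>k\<parallel>\<close> since the Lasso normalisation \<open>\<tau>\<^sub>k\<^sup>2\<close>
  may be close to \<open>0\<close>; the probability of this complement is at most \<open>(n p)\<^sup>-\<^sup>1\<^sup>2\<close>.  So \<open>n E \<Delta>\<^sup>2\<close> tends to \<open>0\<close>.

  For the lower bound, compare \<open>\<Theta>\<^sub>0\<close> with \<open>\<Theta> = \<Theta>\<^sub>0 + H / \<surd>m\<close>.  The density of \<open>N(0, \<Theta>\<^sup>-\<^sup>1)\<close> with respect to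
  \<open>N(0, \<Theta>\<^sub>0\<^sup>-\<^sup>1)\<close> is proportional to \<open>exp (- t Y)\<close> with \<open>Y = (\<theta>\<^sub>i\<^sup>T x) (\<theta>\<^sub>j\<^sup>T x)\<close> and \<open>t = 1 / (\<sigma> \<surd>m)\<close>, so its chi-square
  divergence is \<open>(1 + o(1)) t\<^sup>2 \<sigma>\<^sup>2 = (1 + o(1)) / m\<close>.  The expectation of an asymptotically unbiased estimator
  moves by \<open>(\<sigma> + o(1)) / \<surd>m\<close>, and the Chapman--Robbins inequality for \<open>n = o(m)\<close> observations gives
  \<open>n var T \<ge> \<sigma>\<^sup>2 + o(1)\<close>.
\<close>

section \<open>Gaussian integrals\<close>

text \<open>Every Gaussian fact below comes from the law of a single linear form; products of two
  forms are reduced to it by polarisation. The estimator divides by \<open>tau\<close>, which has no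
  deterministic lower bound, so concentration alone gives no moments. The way out is that the
  penalty is part of \<open>tau\<close>: a small \<open>tau\<close> forces small Lasso coefficients,
  then the residual is close to column k itself, and so the empirical norm of that column is small
  as well, an event with controlled inverse moments. The bound R on the mean square remainder sees
  the precision matrix only through the constants of the class and the sparsity. So one sequence m
  with n = o(m) and m R -> 0 serves all local sequences at once. In the lower bound m is instead
  dictated by the competing estimator; n = o(m) makes n times the divergence of one observation
  vanish, so that the divergence of n observations can be linearised. The variance \<sigma>^2 need
  not converge along the sequences; it is only bounded above and away from 0, which is why error
  terms are handled as a null sequence times a bounded one.\<close>

definition stdn :: "real measure" where
  "stdn = density lborel (\<lambda>x. ennreal (std_normal_density x))"

lemma sets_stdn [simp, measurable_cong]: "sets stdn = sets borel"
  by (simp add: stdn_def)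

lemma space_stdn [simp]: "space stdn = UNIV"
  by (simp add: stdn_def)

lemma prob_space_stdn: "prob_space stdn"
  unfolding stdn_def by (rule prob_space_normal_density) simp

interpretation stdn: prob_space stdn
  by (rule prob_space_stdn)

lemma nn_integral_stdn:
  assumes [measurable]: "h \<in> borel_measurable borel"
  shows "(\<integral>\<^sup>+z. h z \<partial>stdn) = (\<integral>\<^sup>+z. h z * ennreal (std_normal_density z) \<partial>lborel)"
  unfolding stdn_def by (subst nn_integral_density) (auto simp: mult.commute)

text \<open>Independent centred normals add their variances, by convolution of densities. A zero
  coefficient has no density and is treated apart; there the symmetry of the law is needed because
  \<open>sqrt\<close> returns the absolute value of the other coefficient.\<close>

lemma nn_integral_stdn_rotate:
  assumes [measurable]: "h \<in> borel_measurable borel"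
  shows "(\<integral>\<^sup>+w. (\<integral>\<^sup>+z. h (s * z + t * w) \<partial>stdn) \<partial>stdn) =
         (\<integral>\<^sup>+z. h (sqrt (s\<^sup>2 + t\<^sup>2) * z) \<partial>stdn)"
proof -
  have sym: "(\<integral>\<^sup>+z. h (\<bar>c\<bar> * z) \<partial>stdn) = (\<integral>\<^sup>+z. h (c * z) \<partial>stdn)" for c
  proof -
    have "(\<integral>\<^sup>+z. h (- (c * z)) \<partial>stdn) = (\<integral>\<^sup>+z. h (c * z) \<partial>stdn)"
      unfolding nn_integral_stdn[of "\<lambda>z. h (c*z)", simplified] nn_integral_stdn[of "\<lambda>z. h (-(c*z))", simplified]
      by (subst nn_integral_real_affine[where c="-1" and t=0]) (auto simp: std_normal_density_def)
    then show ?thesis by (cases "c \<ge> 0") auto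
  qed
  consider "s = 0" | "t = 0" | "s \<noteq> 0" "t \<noteq> 0" by blast
  then show ?thesis
  proof cases
    case 1 then show ?thesis using sym[of t] by (simp add: stdn.emeasure_space_1[simplified])
  next
    case 2 then show ?thesis using sym[of s] by (simp add: stdn.emeasure_space_1[simplified])
  next
    case 3
    have scale: "(\<integral>\<^sup>+z. f (a * z) \<partial>stdn) = (\<integral>\<^sup>+x. f x * ennreal (normal_density 0 \<bar>a\<bar> x) \<partial>lborel)"
      if [measurable]: "f \<in> borel_measurable borel" and "a \<noteq> 0" for a and f :: "real \<Rightarrow> ennreal"
    proof -
      have "(\<integral>\<^sup>+x. f x * ennreal (normal_density 0 \<bar>a\<bar> x) \<partial>lborel) =
          (\<integral>\<^sup>+z. ennreal \<bar>a\<bar> * (f (a * z) * ennreal (normal_density 0 \<bar>a\<bar> (a * z))) \<partial>lborel)"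
        using \<open>a \<noteq> 0\<close> by (subst nn_integral_real_affine[where c=a and t=0]) (auto simp: nn_integral_cmult)
      also have "\<dots> = (\<integral>\<^sup>+z. f (a * z) * ennreal (std_normal_density z) \<partial>lborel)"
      proof (rule nn_integral_cong)
        fix z
        have "\<bar>a\<bar> * normal_density 0 \<bar>a\<bar> (a * z) = std_normal_density z"
          using \<open>a \<noteq> 0\<close> by (simp add: normal_density_def real_sqrt_mult power_mult_distrib)
        then have "ennreal \<bar>a\<bar> * ennreal (normal_density 0 \<bar>a\<bar> (a * z)) = ennreal (std_normal_density z)"
          by (simp flip: ennreal_mult)
        then show "ennreal \<bar>a\<bar> * (f (a * z) * ennreal (normal_density 0 \<bar>a\<bar> (a * z))) = f (a * z) * ennreal (std_normal_density z)"
          by (simp only: mult.left_commute[of "ennreal \<bar>a\<bar>"])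
      qed
      finally show ?thesis by (simp add: nn_integral_stdn)
    qed
    have "(\<integral>\<^sup>+w. (\<integral>\<^sup>+z. h (s * z + t * w) \<partial>stdn) \<partial>stdn) =
       (\<integral>\<^sup>+w. (\<integral>\<^sup>+x. h (x + t * w) * ennreal (normal_density 0 \<bar>s\<bar> x) \<partial>lborel) \<partial>stdn)"
      using scale[of "\<lambda>x. h (x + _)" s] 3 by simp
    also have "\<dots> = (\<integral>\<^sup>+y. (\<integral>\<^sup>+x. h (x + y) * ennreal (normal_density 0 \<bar>s\<bar> x) \<partial>lborel) * ennreal (normal_density 0 \<bar>t\<bar> y) \<partial>lborel)"
      using scale[of "\<lambda>y. (\<integral>\<^sup>+x. h (x + y) * ennreal (normal_density 0 \<bar>s\<bar> x) \<partial>lborel)" t] 3 by simp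
    also have "\<dots> = (\<integral>\<^sup>+y. (\<integral>\<^sup>+x. h x * ennreal (normal_density 0 \<bar>s\<bar> (x - y)) \<partial>lborel) * ennreal (normal_density 0 \<bar>t\<bar> y) \<partial>lborel)"
    proof -
      have "(\<integral>\<^sup>+x. h (x + y) * ennreal (normal_density 0 \<bar>s\<bar> x) \<partial>lborel) =
          (\<integral>\<^sup>+x. h x * ennreal (normal_density 0 \<bar>s\<bar> (x - y)) \<partial>lborel)" for y
        using nn_integral_real_affine[of "\<lambda>x. h x * ennreal (normal_density 0 \<bar>s\<bar> (x - y))" 1 y]
        by (simp add: add.commute)
      then show ?thesis by simp
    qed
    also have "\<dots> = (\<integral>\<^sup>+y. (\<integral>\<^sup>+x. h x * ennreal (normal_density 0 \<bar>s\<bar> (x - y) * normal_density 0 \<bar>t\<bar> y) \<partial>lborel) \<partial>lborel)"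
      by (subst nn_integral_multc[symmetric]) (auto simp: ennreal_mult mult_ac)
    also have "\<dots> = (\<integral>\<^sup>+x. (\<integral>\<^sup>+y. h x * ennreal (normal_density 0 \<bar>s\<bar> (x - y) * normal_density 0 \<bar>t\<bar> y) \<partial>lborel) \<partial>lborel)"
      by (rule lborel_pair.Fubini') simp
    also have "\<dots> = (\<integral>\<^sup>+x. h x * ennreal (normal_density 0 (sqrt (s\<^sup>2 + t\<^sup>2)) x) \<partial>lborel)"
      using conv_normal_density_zero_mean[of "\<bar>s\<bar>" "\<bar>t\<bar>", THEN fun_cong] 3
      by (simp add: nn_integral_cmult)
    also have "\<dots> = (\<integral>\<^sup>+z. h (sqrt (s\<^sup>2 + t\<^sup>2) * z) \<partial>stdn)"
      using scale[of h "sqrt (s\<^sup>2 + t\<^sup>2)"] 3 by simp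
    finally show ?thesis .
  qed
qed

text \<open>The substitution \<open>z = - c + w / sqrt th\<close> turns a completed square into the
  standard normal weight. This is the integral over one coordinate in the induction over the
  dimension.\<close>

lemma nn_integral_gauss_1d:
  assumes [measurable]: "h \<in> borel_measurable borel" and th: "0 < th"
  shows "(\<integral>\<^sup>+z. h (a * (z + c)) * ennreal (exp (- th * (z + c)\<^sup>2 / 2)) \<partial>lborel) =
         ennreal (sqrt (2 * pi / th)) * (\<integral>\<^sup>+w. h (a / sqrt th * w) \<partial>stdn)"
proof -
  have "(\<integral>\<^sup>+z. h (a * (z + c)) * ennreal (exp (- th * (z + c)\<^sup>2 / 2)) \<partial>lborel) =
      ennreal \<bar>1 / sqrt th\<bar> * (\<integral>\<^sup>+w. h (a * ((-c + 1 / sqrt th * w) + c)) *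
         ennreal (exp (- th * ((-c + 1 / sqrt th * w) + c)\<^sup>2 / 2)) \<partial>lborel)"
    by (rule nn_integral_real_affine) (use th in auto)
  also have "(\<integral>\<^sup>+w. h (a * ((-c + 1 / sqrt th * w) + c)) *
         ennreal (exp (- th * ((-c + 1 / sqrt th * w) + c)\<^sup>2 / 2)) \<partial>lborel)
      = (\<integral>\<^sup>+w. ennreal (sqrt (2 * pi)) * (h (a / sqrt th * w) * ennreal (std_normal_density w)) \<partial>lborel)"
  proof (rule nn_integral_cong)
    fix w
    have "exp (- th * ((-c + 1 / sqrt th * w) + c)\<^sup>2 / 2) = sqrt (2*pi) * std_normal_density w"
      using th by (simp add: std_normal_density_def power_divide)
    then show "h (a * ((-c + 1 / sqrt th * w) + c)) *
         ennreal (exp (- th * ((-c + 1 / sqrt th * w) + c)\<^sup>2 / 2))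
      = ennreal (sqrt (2 * pi)) * (h (a / sqrt th * w) * ennreal (std_normal_density w))"
      by (simp add: ennreal_mult mult_ac)
  qed
  also have "\<dots> = ennreal (sqrt (2*pi)) * (\<integral>\<^sup>+w. h (a / sqrt th * w) \<partial>stdn)"
    by (subst nn_integral_cmult) (auto simp: nn_integral_stdn)
  also have "ennreal \<bar>1 / sqrt th\<bar> * \<dots> = ennreal (sqrt (2 * pi / th)) * (\<integral>\<^sup>+w. h (a / sqrt th * w) \<partial>stdn)"
    using th by (simp add: mult.assoc[symmetric] ennreal_mult[symmetric] real_sqrt_divide)
  finally show ?thesis .
qed

section \<open>Multivariate Gaussian integrals by Schur complements\<close>

text \<open>The coefficients are a function on indices instead of a matrix, so that an induction
  over \<open>p\<close> can drop the last coordinate and keep the same \<open>M\<close>.\<close>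

definition qf :: "nat \<Rightarrow> (nat \<Rightarrow> nat \<Rightarrow> real) \<Rightarrow> (nat \<Rightarrow> real) \<Rightarrow> real" where
  "qf p M x = (\<Sum>k<p. \<Sum>l<p. x k * M k l * x l)"

definition schur :: "nat \<Rightarrow> (nat \<Rightarrow> nat \<Rightarrow> real) \<Rightarrow> nat \<Rightarrow> nat \<Rightarrow> real" where
  "schur p M k l = M k l - M k p * M p l / M p p"

lemma qf_Suc_schur:
  assumes sym: "\<And>k l. k \<le> p \<Longrightarrow> l \<le> p \<Longrightarrow> M k l = M l k" and nz: "M p p \<noteq> 0"
  shows "qf (Suc p) M x =
    qf p (schur p M) x + M p p * (x p + (\<Sum>l<p. M p l * x l) / M p p)\<^sup>2"
proof -
  let ?B = "\<Sum>l<p. M p l * x l"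
  have 1: "qf (Suc p) M x = qf p M x + 2 * x p * ?B + M p p * (x p)\<^sup>2"
  proof -
    have "(\<Sum>k<p. x k * M k p * x p) = x p * ?B"
      unfolding sum_distrib_left
    proof (rule sum.cong)
      fix k assume "k \<in> {..<p}"
      then have "M k p = M p k" using sym[of k p] by simp
      then show "x k * M k p * x p = x p * (M p k * x k)" by simp
    qed simp
    moreover have "(\<Sum>l<p. x p * M p l * x l) = x p * ?B"
      by (simp add: sum_distrib_left mult_ac)
    moreover have "qf (Suc p) M x = qf p M x + (\<Sum>k<p. x k * M k p * x p)
        + ((\<Sum>l<p. x p * M p l * x l) + x p * M p p * x p)"
      by (simp add: qf_def sum.distrib)
    ultimately show ?thesis
      by (simp add: power2_eq_square mult_ac)
  qed
  have "(\<Sum>k<p. \<Sum>l<p. x k * (M k p * M p l / M p p) * x l) = ?B * ?B / M p p"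
    unfolding sum_product sum_divide_distrib
  proof (intro sum.cong refl)
    fix k l assume "k \<in> {..<p}"
    then have "M k p = M p k" using sym[of k p] by simp
    then show "x k * (M k p * M p l / M p p) * x l = M p k * x k * (M p l * x l) / M p p"
      by simp
  qed
  then have 2: "qf p (schur p M) x = qf p M x - ?B * ?B / M p p"
    unfolding qf_def schur_def right_diff_distrib left_diff_distrib sum_subtractf by simp
  have "M p p * (x p + b / M p p)\<^sup>2 = 2 * x p * b + M p p * (x p)\<^sup>2 + b * b / M p p" for b
    using nz by (simp add: power2_eq_square field_simps)
  then show ?thesis unfolding 1 2 by simp
qed

text \<open>The linear form is given by y, as x -> (M y) x, and not by its coefficients. What
  remains after completing the square is then of the same shape, for the Schur complement and the
  same y, and this closes the induction over \<open>p\<close>.\<close>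

lemma schur_linear:
  assumes sym: "\<And>k l. k \<le> p \<Longrightarrow> l \<le> p \<Longrightarrow> M k l = M l k" and nz: "M p p \<noteq> 0"
  shows "(\<Sum>k<Suc p. (\<Sum>l<Suc p. M k l * y l) * x k) =
    (\<Sum>k<p. (\<Sum>l<p. schur p M k l * y l) * x k)
    + (\<Sum>l<Suc p. M p l * y l) * (x p + (\<Sum>l<p. M p l * x l) / M p p)"
proof -
  let ?a = "\<Sum>l<Suc p. M p l * y l"
  have "(\<Sum>l<Suc p. M k l * y l) = (\<Sum>l<p. schur p M k l * y l) + M p k * ?a / M p p" if "k < p" for k
  proof -
    have "(\<Sum>l<p. schur p M k l * y l) = (\<Sum>l<p. M k l * y l) - M k p * (\<Sum>l<p. M p l * y l) / M p p"
      by (simp add: schur_def algebra_simps sum_subtractf sum_distrib_left sum_divide_distrib)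
    then show ?thesis using nz sym[of k p] that by (simp add: field_simps)
  qed
  then have "(\<Sum>k<p. (\<Sum>l<Suc p. M k l * y l) * x k) =
     (\<Sum>k<p. ((\<Sum>l<p. schur p M k l * y l) + M p k * ?a / M p p) * x k)"
    by (intro sum.cong) auto
  also have "\<dots> = (\<Sum>k<p. (\<Sum>l<p. schur p M k l * y l) * x k) + ?a * ((\<Sum>l<p. M p l * x l) / M p p)"
  proof -
    have "(\<Sum>k<p. M p k * a / M p p * x k) = a * ((\<Sum>l<p. M p l * x l) / M p p)" for a
      unfolding sum_distrib_left sum_divide_distrib by (intro sum.cong refl) (simp add: mult_ac)
    then show ?thesis by (simp only: distrib_right sum.distrib)
  qed
  finally show ?thesis by (simp add: distrib_left)
qed

text \<open>Right multiplication by a unipotent block matrix subtracts multiples of the last column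
  from the others and clears the last row, after which the determinant splits.\<close>

lemma det_schur:
  assumes nz: "M p p \<noteq> (0::real)"
  shows "det (mat (Suc p) (Suc p) (\<lambda>(k,l). M k l)) = M p p * det (mat p p (\<lambda>(k,l). schur p M k l))"
proof -
  define A where "A = mat p p (\<lambda>(k,l). M k l)"
  define B where "B = mat p 1 (\<lambda>(k,l). M k p)"
  define C where "C = mat 1 p (\<lambda>(k,l). M p l)"
  define D where "D = mat 1 1 (\<lambda>(k,l). M p p)"
  define F where "F = mat 1 p (\<lambda>(k,l). - M p l / M p p)"
  define S where "S = mat p p (\<lambda>(k,l). schur p M k l)"
  have c: "A \<in> carrier_mat p p" "B \<in> carrier_mat p 1" "C \<in> carrier_mat 1 p" "D \<in> carrier_mat 1 1"
     "F \<in> carrier_mat 1 p" "S \<in> carrier_mat p p"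
    by (auto simp: A_def B_def C_def D_def F_def S_def)
  have 1: "mat (Suc p) (Suc p) (\<lambda>(k,l). M k l) = four_block_mat A B C D"
    by (rule eq_matI) (auto simp: A_def B_def C_def D_def less_Suc_eq not_less)
  have e: "four_block_mat A B C D * four_block_mat (1\<^sub>m p) (0\<^sub>m p 1) F (1\<^sub>m 1)
     = four_block_mat (A * 1\<^sub>m p + B * F) (A * 0\<^sub>m p 1 + B * 1\<^sub>m 1) (C * 1\<^sub>m p + D * F) (C * 0\<^sub>m p 1 + D * 1\<^sub>m 1)"
    by (rule mult_four_block_mat) (use c in auto)
  have e1: "A * 1\<^sub>m p + B * F = S"
    by (rule eq_matI) (auto simp: A_def B_def F_def S_def schur_def scalar_prod_def)
  have e2: "C * 1\<^sub>m p + D * F = 0\<^sub>m 1 p"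
    using nz by (intro eq_matI) (auto simp: C_def D_def F_def scalar_prod_def)
  have e3: "C * 0\<^sub>m p 1 + D * 1\<^sub>m 1 = D" using c by simp
  have e4: "A * 0\<^sub>m p 1 + B * 1\<^sub>m 1 = B" using c by simp
  have "four_block_mat A B C D * four_block_mat (1\<^sub>m p) (0\<^sub>m p 1) F (1\<^sub>m 1) = four_block_mat S B (0\<^sub>m 1 p) D"
    unfolding e e1 e2 e3 e4 ..
  moreover have "det (four_block_mat A B C D * four_block_mat (1\<^sub>m p) (0\<^sub>m p 1) F (1\<^sub>m 1)) =
      det (four_block_mat A B C D) * det (four_block_mat (1\<^sub>m p) (0\<^sub>m p 1) F (1\<^sub>m 1))"
    by (rule det_mult[of _ "p + 1"]) (use c in auto)
  ultimately have "det (four_block_mat A B C D) * det (four_block_mat (1\<^sub>m p) (0\<^sub>m p 1) F (1\<^sub>m 1)) = det (four_block_mat S B (0\<^sub>m 1 p) D)"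
    by simp
  moreover have "det (four_block_mat (1\<^sub>m p) (0\<^sub>m p 1) F (1\<^sub>m 1)) = 1"
    by (subst det_four_block_mat_upper_right_zero[of _ p _ 1]) (use c in auto)
  moreover have "det (four_block_mat S B (0\<^sub>m 1 p) D) = det S * det D"
    by (rule det_four_block_mat_lower_left_zero) (use c in auto)
  moreover have "det D = M p p" using det_single[OF c(4)] by (simp add: D_def)
  ultimately show ?thesis unfolding 1 by (simp add: S_def mult.commute)
qed

text \<open>Under the weight exp(- x M x / 2) the form (M y) x is centred normal with variance
  \<open>qf p M y\<close>. In the induction the last coordinate contributes a normal term
  independent of the others, which \<open>nn_integral_stdn_rotate\<close> merges with the term of
  the Schur complement.\<close>

lemma gauss_nn_integral:
  assumes sym: "\<And>k l. k < p \<Longrightarrow> l < p \<Longrightarrow> M k l = M l k"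
    and pos: "\<And>x. \<exists>k<p. x k \<noteq> 0 \<Longrightarrow> 0 < qf p M x"
  shows "0 < det (mat p p (\<lambda>(k,l). M k l))"
    and "h \<in> borel_measurable borel \<Longrightarrow>
      (\<integral>\<^sup>+x. h (\<Sum>k<p. (\<Sum>l<p. M k l * y l) * x k) * ennreal (exp (- qf p M x / 2)) \<partial>Pi\<^sub>M {..<p} (\<lambda>_. lborel)) =
      ennreal (sqrt ((2 * pi) ^ p / det (mat p p (\<lambda>(k,l). M k l)))) * (\<integral>\<^sup>+z. h (sqrt (qf p M y) * z) \<partial>stdn)"
proof -
  have "0 < det (mat p p (\<lambda>(k,l). M k l)) \<and> (\<forall>h\<in>borel_measurable borel.
      (\<integral>\<^sup>+x. h (\<Sum>k<p. (\<Sum>l<p. M k l * y l) * x k) * ennreal (exp (- qf p M x / 2)) \<partial>Pi\<^sub>M {..<p} (\<lambda>_. lborel)) =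
      ennreal (sqrt ((2 * pi) ^ p / det (mat p p (\<lambda>(k,l). M k l)))) * (\<integral>\<^sup>+z. h (sqrt (qf p M y) * z) \<partial>stdn))"
    using assms
  proof (induction p arbitrary: M)
    case 0
    have "det (mat 0 0 (\<lambda>(k,l). M k l)) = 1" by (rule det_dim_zero) simp
    then show ?case
      by (auto simp: qf_def PiM_empty nn_integral_count_space_finite stdn.emeasure_space_1[simplified])
  next
    case (Suc p)
    have sym: "M k l = M l k" if "k \<le> p" "l \<le> p" for k l using Suc.prems(1) that by auto
    define e where "e = (\<lambda>m. if m = p then 1 else 0 :: real)"
    have "qf (Suc p) M e = M p p"
      by (simp add: qf_def e_def)
    then have th: "0 < M p p" using Suc.prems(2)[of e] by (auto simp: e_def)
    define th where "th = M p p"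
    let ?S = "schur p M"
    have thp: "0 < th" using th by (simp add: th_def)
    let ?B = "\<lambda>x. (\<Sum>l<p. M p l * x l)"
    note dec = qf_Suc_schur[OF sym, of p, folded th_def]
    have Ssym: "?S k l = ?S l k" if "k < p" "l < p" for k l
      using that sym[of k l] sym[of k p] sym[of l p] by (simp add: schur_def)
    have Spos: "0 < qf p ?S x" if "\<exists>k<p. x k \<noteq> 0" for x
    proof -
      \<comment> \<open>This last coordinate makes the completed square vanish, so the full form
        takes the value of the Schur form.\<close>
      have "0 < qf (Suc p) M (x(p := - ?B x / th))"
        using that by (intro Suc.prems(2)) auto
      also have "\<dots> = qf p ?S x"
        using thp by (subst dec) (auto simp: qf_def th_def)
      finally show ?thesis .
    qed
    note IH = Suc.IH[of ?S, OF Ssym Spos]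
    have IH1: "0 < det (mat p p (\<lambda>(k,l). ?S k l))" and
      IH2: "\<And>h. h \<in> borel_measurable borel \<Longrightarrow>
      (\<integral>\<^sup>+x. h (\<Sum>k<p. (\<Sum>l<p. ?S k l * y l) * x k) * ennreal (exp (- qf p ?S x / 2)) \<partial>Pi\<^sub>M {..<p} (\<lambda>_. lborel)) =
      ennreal (sqrt ((2 * pi) ^ p / det (mat p p (\<lambda>(k,l). ?S k l)))) * (\<integral>\<^sup>+z. h (sqrt (qf p ?S y) * z) \<partial>stdn)"
      using IH by blast+
    have D: "det (mat (Suc p) (Suc p) (\<lambda>(k,l). M k l)) = th * det (mat p p (\<lambda>(k,l). ?S k l))"
      using det_schur[of M p] th by (simp add: th_def)
    show ?case
    proof (intro conjI ballI)
      show "0 < det (mat (Suc p) (Suc p) (\<lambda>(k,l). M k l))" using D IH1 thp by simp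
      fix h :: "real \<Rightarrow> ennreal" assume h[measurable]: "h \<in> borel_measurable borel"
      interpret product_sigma_finite "\<lambda>_::nat. lborel :: real measure" ..
      interpret FP: finite_product_sigma_finite "\<lambda>_::nat. lborel :: real measure" "{..<p}" by standard simp
      interpret PS: pair_sigma_finite stdn "Pi\<^sub>M {..<p} (\<lambda>_::nat. lborel :: real measure)" ..
      define a where "a = (\<Sum>l<Suc p. M p l * y l)"
      define L where "L x = (\<Sum>k<p. (\<Sum>l<p. ?S k l * y l) * x k)" for x :: "nat \<Rightarrow> real"
      have [measurable]: "L \<in> borel_measurable (Pi\<^sub>M {..<p} (\<lambda>_. lborel))"
        unfolding L_def[abs_def] by measurable
      have qfm: "(\<lambda>x. qf p ?S x) \<in> borel_measurable (Pi\<^sub>M {..<p} (\<lambda>_. lborel))"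
        unfolding qf_def by measurable
      let ?F = "\<lambda>x. h (\<Sum>k<Suc p. (\<Sum>l<Suc p. M k l * y l) * x k) * ennreal (exp (- qf (Suc p) M x / 2))"
      have Fm: "?F \<in> borel_measurable (Pi\<^sub>M (insert p {..<p}) (\<lambda>_. lborel))"
        unfolding qf_def lessThan_Suc[symmetric] by measurable
      have Fu: "?F (x(p := t)) = (h (L x + a * (t + ?B x / th)) * ennreal (exp (- th * (t + ?B x / th)\<^sup>2 / 2))) * ennreal (exp (- qf p ?S x / 2))" for x t
      proof -
        have "(\<Sum>k<Suc p. (\<Sum>l<Suc p. M k l * y l) * (x(p := t)) k) = L x + a * (t + ?B x / th)"
          using schur_linear[where M=M and x="x(p := t)" and y=y, OF sym less_imp_neq[OF th, symmetric]]
          by (simp add: L_def a_def th_def)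
        moreover have "qf (Suc p) M (x(p:=t)) = qf p ?S x + th * (t + ?B x / th)\<^sup>2"
          using thp by (subst dec) (auto simp: qf_def th_def)
        then have "exp (- qf (Suc p) M (x(p:=t)) / 2) = exp (- th * (t + ?B x / th)\<^sup>2 / 2) * exp (- qf p ?S x / 2)"
          by (simp add: exp_add[symmetric] field_simps)
        ultimately show ?thesis by (simp add: ennreal_mult mult_ac)
      qed
      let ?c = "ennreal (sqrt (2 * pi / th))"
      have e1: "?c * ennreal (sqrt ((2 * pi) ^ p / det (mat p p (\<lambda>(k,l). ?S k l)))) = 
         ennreal (sqrt ((2 * pi) ^ Suc p / det (mat (Suc p) (Suc p) (\<lambda>(k,l). M k l))))"
      proof -
        have "sqrt (a / b) * sqrt (c / d) = sqrt ((a * c) / (b * d))" for a b c d :: real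
          by (simp only: real_sqrt_mult[symmetric] times_divide_times_eq)
        moreover have "0 \<le> sqrt (2 * pi / th)" "0 \<le> sqrt ((2 * pi) ^ p / det (mat p p (\<lambda>(k,l). ?S k l)))"
          using IH1 thp by (simp_all add: less_imp_le)
        ultimately show ?thesis
          unfolding D power_Suc by (simp only: ennreal_mult[symmetric])
      qed
      have e2: "(sqrt (qf p ?S y))\<^sup>2 + (a / sqrt th)\<^sup>2 = qf (Suc p) M y"
      proof -
        have "0 \<le> qf p ?S y"
        proof (cases "\<exists>k<p. y k \<noteq> 0")
          case False then have "qf p ?S y = 0" by (auto simp: qf_def)
          then show ?thesis by simp
        qed (use Spos[of y] in simp)
        moreover have "th * (y p + ?B y / th)\<^sup>2 = a\<^sup>2 / th"
          using thp by (simp add: a_def th_def power2_eq_square field_simps)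
        ultimately show ?thesis using thp by (subst dec) (auto simp: power_divide th_def)
      qed
      define g where "g x = ennreal (exp (- qf p ?S x / 2))" for x
      have [measurable]: "g \<in> borel_measurable (Pi\<^sub>M {..<p} (\<lambda>_. lborel))"
        unfolding g_def[abs_def] by (intro measurable_compose[OF qfm]) measurable
      define K where "K w x = h (L x + a / sqrt th * w) * g x" for w x
      have K: "(\<lambda>(w, x). K w x) \<in> borel_measurable (stdn \<Otimes>\<^sub>M Pi\<^sub>M {..<p} (\<lambda>_. lborel))"
        unfolding K_def by measurable
      have K': "(\<lambda>(x, w). K w x) \<in> borel_measurable (Pi\<^sub>M {..<p} (\<lambda>_. lborel) \<Otimes>\<^sub>M stdn)"
        unfolding K_def by measurable
      define C where "C = ennreal (sqrt ((2 * pi) ^ p / det (mat p p (\<lambda>(k,l). ?S k l))))"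
      have s1: "(\<integral>\<^sup>+x. ?F x \<partial>Pi\<^sub>M {..<Suc p} (\<lambda>_. lborel)) =
         (\<integral>\<^sup>+x. (\<integral>\<^sup>+t. ?F (x(p := t)) \<partial>lborel) \<partial>Pi\<^sub>M {..<p} (\<lambda>_. lborel))"
        using product_nn_integral_insert[OF _ _ Fm] by (simp only: lessThan_Suc[symmetric]) simp
      have s2: "(\<integral>\<^sup>+t. ?F (x(p := t)) \<partial>lborel) = ?c * (\<integral>\<^sup>+w. K w x \<partial>stdn)" for x
      proof -
        have 1: "(\<integral>\<^sup>+t. ?F (x(p := t)) \<partial>lborel) =
           (\<integral>\<^sup>+t. h (L x + a * (t + ?B x / th)) * ennreal (exp (- th * (t + ?B x / th)\<^sup>2 / 2)) \<partial>lborel) * g x"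
          unfolding Fu g_def by (rule nn_integral_multc) measurable
        have 2: "(\<integral>\<^sup>+t. h (L x + a * (t + ?B x / th)) * ennreal (exp (- th * (t + ?B x / th)\<^sup>2 / 2)) \<partial>lborel)
           = ?c * (\<integral>\<^sup>+w. h (L x + a / sqrt th * w) \<partial>stdn)"
          by (rule nn_integral_gauss_1d[of "\<lambda>u. h (L x + u)" th a "?B x / th"]) (measurable, fact thp)
        have 3: "(\<integral>\<^sup>+w. K w x \<partial>stdn) = (\<integral>\<^sup>+w. h (L x + a / sqrt th * w) \<partial>stdn) * g x"
          unfolding K_def by (rule nn_integral_multc) measurable
        show ?thesis unfolding 1 2 3 by (simp only: mult.assoc)
      qed
      have s3: "(\<integral>\<^sup>+x. ?c * (\<integral>\<^sup>+w. K w x \<partial>stdn) \<partial>Pi\<^sub>M {..<p} (\<lambda>_. lborel)) =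
          ?c * (\<integral>\<^sup>+x. (\<integral>\<^sup>+w. K w x \<partial>stdn) \<partial>Pi\<^sub>M {..<p} (\<lambda>_. lborel))"
        by (rule nn_integral_cmult) (rule stdn.borel_measurable_nn_integral[OF K'])
      have s4: "(\<integral>\<^sup>+x. (\<integral>\<^sup>+w. K w x \<partial>stdn) \<partial>Pi\<^sub>M {..<p} (\<lambda>_. lborel)) =
          (\<integral>\<^sup>+w. (\<integral>\<^sup>+x. K w x \<partial>Pi\<^sub>M {..<p} (\<lambda>_. lborel)) \<partial>stdn)"
        using PS.Fubini'[OF K] by simp
      \<comment> \<open>The induction hypothesis is used for \<open>h\<close> translated by the
        contribution of the last coordinate.\<close>
      have s5: "(\<integral>\<^sup>+x. K w x \<partial>Pi\<^sub>M {..<p} (\<lambda>_. lborel)) =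
          C * (\<integral>\<^sup>+z. h (sqrt (qf p ?S y) * z + a / sqrt th * w) \<partial>stdn)" for w
        unfolding K_def L_def g_def C_def by (rule IH2) measurable
      have s6: "(\<integral>\<^sup>+w. C * (\<integral>\<^sup>+z. h (sqrt (qf p ?S y) * z + a / sqrt th * w) \<partial>stdn) \<partial>stdn) =
         C * (\<integral>\<^sup>+z. h (sqrt ((sqrt (qf p ?S y))\<^sup>2 + (a / sqrt th)\<^sup>2) * z) \<partial>stdn)"
        unfolding nn_integral_stdn_rotate[OF h, symmetric] by (rule nn_integral_cmult) measurable
      show "(\<integral>\<^sup>+x. ?F x \<partial>Pi\<^sub>M {..<Suc p} (\<lambda>_. lborel)) =
         ennreal (sqrt ((2 * pi) ^ Suc p / det (mat (Suc p) (Suc p) (\<lambda>(k,l). M k l)))) *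
           (\<integral>\<^sup>+z. h (sqrt (qf (Suc p) M y) * z) \<partial>stdn)"
        unfolding s1 s2 s3 s4 s5 s6 e1[folded C_def, symmetric] e2 by (simp only: mult.assoc)
    qed
  qed
  then show "0 < det (mat p p (\<lambda>(k,l). M k l))" and "h \<in> borel_measurable borel \<Longrightarrow>
      (\<integral>\<^sup>+x. h (\<Sum>k<p. (\<Sum>l<p. M k l * y l) * x k) * ennreal (exp (- qf p M x / 2)) \<partial>Pi\<^sub>M {..<p} (\<lambda>_. lborel)) =
      ennreal (sqrt ((2 * pi) ^ p / det (mat p p (\<lambda>(k,l). M k l)))) * (\<integral>\<^sup>+z. h (sqrt (qf p M y) * z) \<partial>stdn)"
    by auto
qed

section \<open>Rayleigh quotients and extreme eigenvalues\<close>

lemma qf_add_unit: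
  assumes sym: "\<And>k l. k < p \<Longrightarrow> l < p \<Longrightarrow> M k l = M l k" and "m < p"
  shows "qf p M (x(m := x m + t)) = qf p M x + 2 * t * (\<Sum>l<p. M m l * x l) + t\<^sup>2 * M m m"
proof -
  define e where "e k = (if k = m then t else 0)" for k
  have x: "(x(m := x m + t)) = (\<lambda>k. x k + e k)" by (auto simp: e_def)
  have 1: "(\<Sum>k<p. \<Sum>l<p. e k * M k l * x l) = t * (\<Sum>l<p. M m l * x l)"
  proof -
    have "(\<Sum>k<p. \<Sum>l<p. e k * M k l * x l) = (\<Sum>k<p. if k = m then t * (\<Sum>l<p. M m l * x l) else 0)"
      by (intro sum.cong refl) (simp add: e_def sum_distrib_left mult.assoc)
    then show ?thesis using \<open>m < p\<close> by simp
  qed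
  have 2: "(\<Sum>k<p. \<Sum>l<p. x k * M k l * e l) = (\<Sum>k<p. \<Sum>l<p. e k * M k l * x l)"
  proof (subst sum.swap, intro sum.cong refl)
    fix k l assume "k \<in> {..<p}" "l \<in> {..<p}"
    then have "M k l = M l k" using sym[of k l] by simp
    then show "x l * M l k * e k = e k * M k l * x l" by simp
  qed
  have 3: "(\<Sum>k<p. \<Sum>l<p. e k * M k l * e l) = t\<^sup>2 * M m m"
  proof -
    have "(\<Sum>k<p. \<Sum>l<p. e k * M k l * e l) = (\<Sum>k<p. if k = m then (\<Sum>l<p. if l = m then t * M m m * t else 0) else 0)"
    proof (intro sum.cong refl)
      fix k
      have "(\<Sum>l<p. t * M m l * e l) = (\<Sum>l<p. if l = m then t * M m m * t else 0)"
        by (intro sum.cong refl) (simp add: e_def)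
      then show "(\<Sum>l<p. e k * M k l * e l) = (if k = m then (\<Sum>l<p. if l = m then t * M m m * t else 0) else 0)"
        by (cases "k = m") (simp_all add: e_def[of m], simp_all add: e_def)
    qed
    then show ?thesis using \<open>m < p\<close> by (simp add: power2_eq_square)
  qed
  have "qf p M (\<lambda>k. x k + e k) = qf p M x + (\<Sum>k<p. \<Sum>l<p. e k * M k l * x l)
     + (\<Sum>k<p. \<Sum>l<p. x k * M k l * e l) + (\<Sum>k<p. \<Sum>l<p. e k * M k l * e l)"
    by (simp add: qf_def distrib_right distrib_left sum.distrib)
  then show ?thesis unfolding x 1 2 3 by simp
qed

text \<open>Only |t| < 1 is assumed because one use rescales Lasso coefficients by 1 + t, which must
  not change their signs. The witness - b / C has modulus below 1.\<close>

lemma quadratic_nonneg_imp_linear_zero: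
  assumes "\<And>t::real. \<bar>t\<bar> < 1 \<Longrightarrow> 0 \<le> t * b + t\<^sup>2 * c"
  shows "b = 0"
proof (rule ccontr)
  assume "b \<noteq> 0"
  define C where "C = \<bar>c\<bar> + \<bar>b\<bar> + 1"
  have C: "C > 0" "c < C" "\<bar>b\<bar> < C" by (auto simp: C_def)
  have "(- b / C) * b + (- b / C)\<^sup>2 * c = b\<^sup>2 / C\<^sup>2 * (c - C)"
    using C by (simp add: field_simps power2_eq_square)
  also have "\<dots> < 0" using C \<open>b \<noteq> 0\<close> by (intro mult_pos_neg) auto
  finally show False using assms[of "- b / C"] C by simp
qed

text \<open>By homogeneity the minimum over the unit sphere bounds the form on all vectors. At the
  minimiser this inequality is an equality, and its first-order condition in each coordinate is the
  eigenvalue equation, with no Lagrange multiplier.\<close>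

lemma rayleigh_minimum:
  assumes "0 < p" and sym: "\<And>k l. k < p \<Longrightarrow> l < p \<Longrightarrow> M k l = M l k"
  shows "\<exists>ev x. (\<exists>k<p. x k \<noteq> 0) \<and> (\<forall>k<p. (\<Sum>l<p. M k l * x l) = ev * x k) \<and>
    (\<forall>y. ev * (\<Sum>k<p. (y k)\<^sup>2) \<le> qf p M y)"
proof -
  \<comment> \<open>Coordinates from \<open>p\<close> on are pinned to 0, which makes the set a
    product of compact intervals.\<close>
  define B where "B = (Pi\<^sub>E UNIV (\<lambda>k::nat. if k < p then {-1..1} else {0::real}))"
  define K where "K = B \<inter> {x. (\<Sum>k<p. (x k)\<^sup>2) = 1}"
  have "compactin (product_topology (\<lambda>_. euclidean) UNIV) B"
    unfolding B_def by (subst compactin_PiE) auto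
  then have "compact B" by (simp add: euclidean_product_topology)
  moreover have "closed {x :: nat \<Rightarrow> real. (\<Sum>k<p. (x k)\<^sup>2) = 1}"
    by (intro closed_Collect_eq continuous_intros) auto
  ultimately have K: "compact K" unfolding K_def by (rule compact_Int_closed)
  have "(\<lambda>k. if k = 0 then 1 else 0) \<in> K"
    using \<open>0 < p\<close> by (auto simp: K_def B_def if_distrib[of "\<lambda>c. c\<^sup>2"] cong: if_cong)
  then have "K \<noteq> {}" by blast
  moreover have "continuous_on K (qf p M)"
    unfolding qf_def[abs_def]
    by (intro continuous_intros continuous_on_subset[OF continuous_on_product_coordinates subset_UNIV])
  ultimately obtain x where x: "x \<in> K" "\<And>y. y \<in> K \<Longrightarrow> qf p M x \<le> qf p M y"
    using continuous_attains_inf[OF K] by blast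
  define ev where "ev = qf p M x"
  have nx: "(\<Sum>k<p. (x k)\<^sup>2) = 1" using x(1) by (simp add: K_def)
  have le: "ev * (\<Sum>k<p. (y k)\<^sup>2) \<le> qf p M y" for y
  proof (cases "(\<Sum>k<p. (y k)\<^sup>2) = 0")
    case True
    then have "\<And>k. k < p \<Longrightarrow> y k = 0" by (simp add: sum_nonneg_eq_0_iff)
    then show ?thesis using True by (simp add: qf_def)
  next
    case False
    define N where "N = (\<Sum>k<p. (y k)\<^sup>2)"
    have N: "N > 0" using False sum_nonneg[of "{..<p}" "\<lambda>k. (y k)\<^sup>2"] by (simp add: N_def)
    define z where "z k = (if k < p then y k / sqrt N else 0)" for k
    have z1: "(\<Sum>k<p. (z k)\<^sup>2) = 1"
      using N by (simp add: z_def power_divide flip: sum_divide_distrib N_def)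
    have "z k \<in> {-1..1}" if "k < p" for k
    proof -
      have "(z k)\<^sup>2 \<le> 1" unfolding z1[symmetric] using that by (intro member_le_sum) auto
      then show ?thesis by (simp add: abs_square_le_1 abs_le_iff)
    qed
    then have "z \<in> K" using z1 by (auto simp: K_def B_def z_def)
    then have "ev \<le> qf p M z" using x(2) by (simp add: ev_def)
    also have "qf p M z = qf p M y / N"
    proof -
      have "qf p M z = (\<Sum>k<p. \<Sum>l<p. y k * M k l * y l / (sqrt N * sqrt N))"
        unfolding qf_def by (intro sum.cong refl) (simp add: z_def)
      then show ?thesis using N by (simp add: qf_def sum_divide_distrib)
    qed
    finally show ?thesis using N by (simp add: N_def pos_le_divide_eq)
  qed
  have eig: "(\<Sum>l<p. M k l * x l) = ev * x k" if "k < p" for k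
  proof -
    have "0 \<le> t * (2 * ((\<Sum>l<p. M k l * x l) - ev * x k)) + t\<^sup>2 * (M k k - ev)" for t
    proof -
      have "(\<Sum>l<p. ((x(k := x k + t)) l)\<^sup>2) = 1 + 2 * t * x k + t\<^sup>2"
      proof -
        have "(\<Sum>l\<in>{..<p} - {k}. ((x(k := x k + t)) l)\<^sup>2) = (\<Sum>l\<in>{..<p} - {k}. (x l)\<^sup>2)"
          by (intro sum.cong) auto
        then show ?thesis
          using nx that sum.remove[of "{..<p}" k "\<lambda>l. ((x(k := x k + t)) l)\<^sup>2"] sum.remove[of "{..<p}" k "\<lambda>l. (x l)\<^sup>2"]
          by (simp add: power2_eq_square algebra_simps)
      qed
      then show ?thesis
        using le[of "x(k := x k + t)"] qf_add_unit[of p M k x t, OF sym that]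
        by (simp add: ev_def[symmetric] algebra_simps)
    qed
    from quadratic_nonneg_imp_linear_zero[OF this] show ?thesis by simp
  qed
  have "\<exists>k<p. x k \<noteq> 0" 
  proof (rule ccontr)
    assume "\<not> (\<exists>k<p. x k \<noteq> 0)"
    then have "(\<Sum>k<p. (x k)\<^sup>2) = 0" by (intro sum.neutral) auto
    then show False using nx by simp
  qed
  then show ?thesis using eig le by blast
qed

lemma qf_uminus: "qf p (\<lambda>k l. - M k l) y = - qf p M y"
  by (simp add: qf_def sum_negf)

text \<open>The minimal Rayleigh quotient belongs to the spectrum, hence is at least its minimum.
  The upper bound is the lower bound for - A.\<close>

lemma eig_bounds:
  assumes A: "A \<in> carrier_mat p p" and T: "transpose_mat A = A" and "0 < p"
  shows "eig_min A * (\<Sum>k<p. (y k)\<^sup>2) \<le> qf p (\<lambda>k l. A $$ (k,l)) y"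
    and "qf p (\<lambda>k l. A $$ (k,l)) y \<le> eig_max A * (\<Sum>k<p. (y k)\<^sup>2)"
proof -
  have sym: "A $$ (k,l) = A $$ (l,k)" if "k < p" "l < p" for k l
  proof -
    have "transpose_mat A $$ (k,l) = A $$ (l,k)" using A that by simp
    then show ?thesis unfolding T .
  qed
  have fin: "finite (spectrum A)" by (rule card_finite_spectrum[OF A])
  have sp: "ev \<in> spectrum A" if "\<exists>k<p. x k \<noteq> 0" "\<And>k. k < p \<Longrightarrow> (\<Sum>l<p. A $$ (k,l) * x l) = ev * x k" for ev x
  proof -
    have "A *\<^sub>v vec p x = ev \<cdot>\<^sub>v vec p x"
      using A that(2) by (intro eq_vecI) (auto simp: scalar_prod_def atLeast0LessThan)
    moreover have "vec p x \<noteq> 0\<^sub>v p" 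
    proof
      assume v: "vec p x = 0\<^sub>v p"
      from \<open>\<exists>k<p. x k \<noteq> 0\<close> obtain k where "k < p" "x k \<noteq> 0" by blast
      then show False using arg_cong[OF v, of "\<lambda>v. v $ k"] by simp
    qed
    ultimately have "eigenvector A (vec p x) ev" using A by (auto simp: eigenvector_def)
    then show ?thesis by (auto simp: spectrum_def eigenvalue_def)
  qed
  have ss: "0 \<le> (\<Sum>k<p. (y k)\<^sup>2)" by (simp add: sum_nonneg)
  obtain ev x where 1: "\<exists>k<p. x k \<noteq> 0" "\<And>k. k < p \<Longrightarrow> (\<Sum>l<p. A $$ (k,l) * x l) = ev * x k"
    "\<And>y. ev * (\<Sum>k<p. (y k)\<^sup>2) \<le> qf p (\<lambda>k l. A $$ (k,l)) y"
    using rayleigh_minimum[of p "\<lambda>k l. A $$ (k,l)", OF \<open>0 < p\<close> sym] by blast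
  have "eig_min A \<le> ev" unfolding eig_min_def using fin sp[OF 1(1,2)] by simp
  from mult_right_mono[OF this ss] 1(3)[of y] show "eig_min A * (\<Sum>k<p. (y k)\<^sup>2) \<le> qf p (\<lambda>k l. A $$ (k,l)) y" by simp
  obtain ev x where 2: "\<exists>k<p. x k \<noteq> 0" "\<And>k. k < p \<Longrightarrow> (\<Sum>l<p. - A $$ (k,l) * x l) = ev * x k"
    "\<And>y. ev * (\<Sum>k<p. (y k)\<^sup>2) \<le> qf p (\<lambda>k l. - A $$ (k,l)) y"
    using rayleigh_minimum[of p "\<lambda>k l. - A $$ (k,l)", OF \<open>0 < p\<close> arg_cong[OF sym, of _ _ uminus]] by blast
  have "(\<Sum>l<p. A $$ (k,l) * x l) = - ev * x k" if "k < p" for k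
    using 2(2)[OF that] by (simp add: sum_negf)
  from sp[OF 2(1) this] have "- ev \<le> eig_max A" unfolding eig_max_def
    using fin by (intro Max_ge)
  from mult_right_mono[OF this ss] 2(3)[of y] show "qf p (\<lambda>k l. A $$ (k,l)) y \<le> eig_max A * (\<Sum>k<p. (y k)\<^sup>2)"
    by (simp add: qf_uminus)
qed

section \<open>Projections of a normal vector\<close>

definition ip :: "nat \<Rightarrow> (nat \<Rightarrow> real) \<Rightarrow> (nat \<Rightarrow> real) \<Rightarrow> real" where
  "ip p a x = (\<Sum>l<p. a l * x l)"

definition bf :: "nat \<Rightarrow> real mat \<Rightarrow> (nat \<Rightarrow> real) \<Rightarrow> (nat \<Rightarrow> real) \<Rightarrow> real" where
  "bf p A a b = (\<Sum>k<p. \<Sum>l<p. a k * A $$ (k,l) * b l)"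

lemma bf_ip: "bf p A a b = ip p a (\<lambda>k. \<Sum>l<p. A $$ (k,l) * b l)"
  by (simp add: bf_def ip_def sum_distrib_left mult.assoc)

lemma qf_bf: "qf p (\<lambda>k l. A $$ (k,l)) a = bf p A a a"
  by (simp add: qf_def bf_def)

text \<open>Throughout, \<open>A\<close> is the precision matrix; the covariance of the normal law
  is \<open>minv A\<close>.\<close>

locale pd_matrix =
  fixes p :: nat and A :: "real mat"
  assumes carr: "A \<in> carrier_mat p p"
    and sym: "\<And>k l. k < p \<Longrightarrow> l < p \<Longrightarrow> A $$ (k,l) = A $$ (l,k)"
    and pos: "\<And>x. \<exists>k<p. x k \<noteq> 0 \<Longrightarrow> 0 < bf p A x x"
begin

lemma mat_A: "mat p p (\<lambda>(k, l). A $$ (k, l)) = A"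
  by (rule eq_matI) (use carr in auto)

lemma det_pos: "0 < det A"
  using gauss_nn_integral(1)[of p "\<lambda>k l. A $$ (k,l)", OF sym] pos by (simp only: qf_bf mat_A)

lemma minv:
  shows "A * minv A = 1\<^sub>m p" "minv A * A = 1\<^sub>m p" "minv A \<in> carrier_mat p p"
proof -
  have "A \<in> Units (ring_mat TYPE(real) p ())"
    using det_non_zero_imp_unit[OF carr] det_pos by simp
  then obtain B where B: "mat_inverse A = Some B" using mat_inverse(1)[OF carr, of "()"] by (cases "mat_inverse A") auto
  from mat_inverse(2)[OF carr B] B show "A * minv A = 1\<^sub>m p" "minv A * A = 1\<^sub>m p" "minv A \<in> carrier_mat p p"
    by (auto simp: minv_def)
qed

lemma minv_minv: "minv (minv A) = A"
proof -
  have "det (minv A) \<noteq> 0"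
    using det_mult[OF carr minv(3)] minv(1) by auto
  then have "minv A \<in> Units (ring_mat TYPE(real) p ())"
    using det_non_zero_imp_unit[OF minv(3)] by simp
  then obtain B where B: "mat_inverse (minv A) = Some B" using mat_inverse(1)[OF minv(3), of "()"] by (cases "mat_inverse (minv A)") auto
  note C = mat_inverse(2)[OF minv(3) B]
  have "A = A * (minv A * B)" using C carr by simp
  also have "\<dots> = B" using C carr minv assoc_mult_mat[of A p p "minv A" p B p] left_mult_one_mat[of B p p] by simp
  finally show ?thesis using B by (simp add: minv_def)
qed

lemma det_minv: "det (minv A) = 1 / det A"
  using det_mult[OF carr minv(3)] minv(1) det_pos by (simp add: field_simps)

lemma mv_inverse: "k < p \<Longrightarrow> (\<Sum>l<p. A $$ (k,l) * (\<Sum>m<p. minv A $$ (l,m) * b m)) = b k"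
  "k < p \<Longrightarrow> (\<Sum>l<p. minv A $$ (k,l) * (\<Sum>m<p. A $$ (l,m) * b m)) = b k"
proof -
  have *: "(\<Sum>l<p. B $$ (k,l) * (\<Sum>m<p. C $$ (l,m) * b m)) = b k"
    if "B * C = 1\<^sub>m p" and c: "B \<in> carrier_mat p p" "C \<in> carrier_mat p p" and "k < p" for B C
  proof -
    have e: "(\<Sum>l<p. B $$ (k,l) * C $$ (l,m)) = (if k = m then 1 else 0)" if "m < p" for m
      using arg_cong[OF \<open>B * C = 1\<^sub>m p\<close>, of "\<lambda>M. M $$ (k,m)"] that \<open>k < p\<close> c
      by (simp add: scalar_prod_def atLeast0LessThan)
    have "(\<Sum>l<p. B $$ (k,l) * (\<Sum>m<p. C $$ (l,m) * b m)) = (\<Sum>m<p. (\<Sum>l<p. B $$ (k,l) * C $$ (l,m)) * b m)"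
      unfolding sum_distrib_left sum_distrib_right by (subst sum.swap) (simp add: mult.assoc)
    also have "\<dots> = (\<Sum>m<p. if k = m then b m else 0)"
      by (intro sum.cong) (auto simp: e)
    finally show ?thesis using \<open>k < p\<close> by simp
  qed
  show "k < p \<Longrightarrow> (\<Sum>l<p. A $$ (k,l) * (\<Sum>m<p. minv A $$ (l,m) * b m)) = b k"
    "k < p \<Longrightarrow> (\<Sum>l<p. minv A $$ (k,l) * (\<Sum>m<p. A $$ (l,m) * b m)) = b k"
    using * minv carr by auto
qed

text \<open>The solution z of A z = a. It brings the linear form with coefficients a into the shape
  x -> (A z) x for which the Gaussian integral is known.\<close>

definition sol :: "(nat \<Rightarrow> real) \<Rightarrow> nat \<Rightarrow> real" where
  "sol a k = (\<Sum>l<p. minv A $$ (k,l) * a l)"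

lemma A_sol: "k < p \<Longrightarrow> (\<Sum>l<p. A $$ (k,l) * sol a l) = a k"
  unfolding sol_def by (rule mv_inverse)

lemma bf_A_sym: "bf p A a b = bf p A b a"
  unfolding bf_def by (subst sum.swap) (auto intro!: sum.cong simp: sym mult_ac)

lemma bf_A_sol: "bf p A b (sol a) = ip p b a"
  unfolding bf_ip ip_def by (intro sum.cong refl) (simp add: A_sol)

lemma bf_minv: "bf p (minv A) a b = ip p a (sol b)"
  by (simp add: bf_ip sol_def[abs_def])

lemma bf_minv_eq: "bf p (minv A) a b = bf p A (sol a) (sol b)"
  using bf_A_sol[of "sol b" a] bf_A_sym by (simp add: bf_minv ip_def mult.commute)

lemma bf_minv_sym: "bf p (minv A) a b = bf p (minv A) b a"
  by (simp add: bf_minv_eq bf_A_sym)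

lemma bf_minv_nonneg: "0 \<le> bf p (minv A) a a"
proof (cases "\<exists>k<p. sol a k \<noteq> 0")
  case True then show ?thesis using pos by (auto simp: bf_minv_eq intro: less_imp_le)
next
  case False then show ?thesis by (simp add: bf_minv ip_def)
qed

text \<open>The covariance maps column k of the precision matrix to the k-th unit vector. Hence the
  projections of a normal vector on the columns of \<open>A\<close> have the entries of
  \<open>A\<close> as covariances.\<close>

lemma bf_minv_col: "k < p \<Longrightarrow> bf p (minv A) (\<lambda>l. A $$ (l,k)) b = b k"
proof -
  assume "k < p"
  have "bf p (minv A) (\<lambda>l. A $$ (l,k)) b = (\<Sum>l<p. A $$ (k,l) * sol b l)"
    unfolding bf_minv ip_def using \<open>k < p\<close> by (intro sum.cong) (auto simp: sym)
  then show ?thesis using \<open>k < p\<close> by (simp add: A_sol)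
qed

lemma normal_vec_density_minv:
  "normal_vec_density p (minv A) x = exp (- qf p (\<lambda>k l. A $$ (k,l)) x / 2) / sqrt ((2 * pi) ^ p / det A)"
proof -
  have "vec p x \<bullet> (A *\<^sub>v vec p x) = qf p (\<lambda>k l. A $$ (k,l)) x"
    using carr by (simp add: scalar_prod_def qf_def atLeast0LessThan sum_distrib_left mult.assoc)
  then show ?thesis
    by (simp add: normal_vec_density_def minv_minv det_minv)
qed

lemma measurable_normal_vec_density [measurable]:
  "normal_vec_density p (minv A) \<in> borel_measurable (Pi\<^sub>M {..<p} (\<lambda>_. lborel))"
proof -
  have qfm: "(\<lambda>x. qf p (\<lambda>k l. A $$ (k,l)) x) \<in> borel_measurable (Pi\<^sub>M {..<p} (\<lambda>_. lborel))"
    unfolding qf_def by measurable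
  show ?thesis
    unfolding normal_vec_density_minv[abs_def] by (intro measurable_compose[OF qfm]) measurable
qed

lemma nn_integral_normal_vec_ip:
  assumes [measurable]: "h \<in> borel_measurable borel"
  shows "(\<integral>\<^sup>+x. h (ip p a x) \<partial>normal_vec p (minv A)) = (\<integral>\<^sup>+z. h (sqrt (bf p (minv A) a a) * z) \<partial>stdn)"
proof -
  define C where "C = sqrt ((2 * pi) ^ p / det A)"
  have C: "C > 0" using det_pos by (simp add: C_def)
  have [measurable]: "(\<lambda>x. ip p a x) \<in> borel_measurable (Pi\<^sub>M {..<p} (\<lambda>_. lborel))"
    unfolding ip_def by measurable
  have ip: "ip p a x = (\<Sum>k<p. (\<Sum>l<p. A $$ (k,l) * sol a l) * x k)" for x
    unfolding ip_def by (intro sum.cong refl) (simp add: A_sol)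
  let ?q = "\<lambda>x. qf p (\<lambda>k l. A $$ (k,l)) x"
  have "(\<integral>\<^sup>+x. h (ip p a x) \<partial>normal_vec p (minv A)) =
     (\<integral>\<^sup>+x. ennreal (normal_vec_density p (minv A) x) * h (ip p a x) \<partial>Pi\<^sub>M {..<p} (\<lambda>_. lborel))"
    unfolding normal_vec_def by (rule nn_integral_density) measurable
  also have "\<dots> = (\<integral>\<^sup>+x. ennreal (1 / C) * (h (ip p a x) * ennreal (exp (- ?q x / 2))) \<partial>Pi\<^sub>M {..<p} (\<lambda>_. lborel))"
  proof (rule nn_integral_cong)
    fix x
    have "ennreal (normal_vec_density p (minv A) x) = ennreal (1 / C) * ennreal (exp (- ?q x / 2))"
      unfolding normal_vec_density_minv C_def[symmetric] using C by (simp flip: ennreal_mult)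
    then show "ennreal (normal_vec_density p (minv A) x) * h (ip p a x) = ennreal (1 / C) * (h (ip p a x) * ennreal (exp (- ?q x / 2)))"
      by (simp only: mult_ac)
  qed
  also have "\<dots> = ennreal (1 / C) * (\<integral>\<^sup>+x. h (ip p a x) * ennreal (exp (- ?q x / 2)) \<partial>Pi\<^sub>M {..<p} (\<lambda>_. lborel))"
  proof (rule nn_integral_cmult)
    have qfm: "(\<lambda>x. ?q x) \<in> borel_measurable (Pi\<^sub>M {..<p} (\<lambda>_. lborel))"
      unfolding qf_def by measurable
    have [measurable]: "(\<lambda>x. ennreal (exp (- ?q x / 2))) \<in> borel_measurable (Pi\<^sub>M {..<p} (\<lambda>_. lborel))"
      by (intro measurable_compose[OF qfm]) measurable
    show "(\<lambda>x. h (ip p a x) * ennreal (exp (- ?q x / 2))) \<in> borel_measurable (Pi\<^sub>M {..<p} (\<lambda>_. lborel))"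
      by measurable
  qed
  also have "(\<integral>\<^sup>+x. h (ip p a x) * ennreal (exp (- ?q x / 2)) \<partial>Pi\<^sub>M {..<p} (\<lambda>_. lborel)) =
      ennreal C * (\<integral>\<^sup>+z. h (sqrt (?q (sol a)) * z) \<partial>stdn)"
    using gauss_nn_integral(2)[of p "\<lambda>k l. A $$ (k,l)", OF sym pos[folded qf_bf] assms, of "sol a"]
    by (simp only: ip mat_A C_def)
  also have "ennreal (1 / C) * \<dots> = (\<integral>\<^sup>+z. h (sqrt (?q (sol a)) * z) \<partial>stdn)"
    using C by (simp add: mult.assoc[symmetric] flip: ennreal_mult)
  also have "?q (sol a) = bf p (minv A) a a"
    by (simp only: qf_bf bf_minv_eq)
  finally show ?thesis .
qed

lemma prob_space_normal_vec: "prob_space (normal_vec p (minv A))"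
proof
  have "emeasure (normal_vec p (minv A)) (space (normal_vec p (minv A))) = (\<integral>\<^sup>+x. 1 \<partial>normal_vec p (minv A))"
    by simp
  also have "\<dots> = (\<integral>\<^sup>+z. 1 \<partial>stdn)"
    by (rule nn_integral_normal_vec_ip) measurable
  also have "\<dots> = 1" using stdn.emeasure_space_1 by simp
  finally show "emeasure (normal_vec p (minv A)) (space (normal_vec p (minv A))) = 1" .
qed

lemma sets_normal_vec [simp, measurable_cong]: "sets (normal_vec p B) = sets (Pi\<^sub>M {..<p} (\<lambda>_. borel))"
  by (simp add: normal_vec_def cong: sets_PiM_cong)

end

section \<open>Moments of one standard normal variable\<close>

lemma nn_integral_stdn_exp_square:
  assumes "s < 1 / 2"
  shows "(\<integral>\<^sup>+z. ennreal (exp (s * z\<^sup>2)) \<partial>stdn) = ennreal (1 / sqrt (1 - 2 * s))"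
proof -
  define c where "c = 1 - 2 * s"
  have c: "c > 0" using assms by (simp add: c_def)
  have "(\<integral>\<^sup>+z. ennreal (exp (s * z\<^sup>2)) \<partial>stdn) = (\<integral>\<^sup>+z. ennreal (exp (s * z\<^sup>2)) * ennreal (std_normal_density z) \<partial>lborel)"
    by (rule nn_integral_stdn) measurable
  also have "\<dots> = (\<integral>\<^sup>+z. ennreal (1 / sqrt (2 * pi)) * (1 * ennreal (exp (- c * (z + 0)\<^sup>2 / 2))) \<partial>lborel)"
  proof (rule nn_integral_cong)
    fix z :: real
    have "exp (s * z\<^sup>2) * std_normal_density z = 1 / sqrt (2 * pi) * exp (- c * (z + 0)\<^sup>2 / 2)"
      by (simp add: std_normal_density_def c_def field_simps flip: exp_add)
    then show "ennreal (exp (s * z\<^sup>2)) * ennreal (std_normal_density z) = ennreal (1 / sqrt (2 * pi)) * (1 * ennreal (exp (- c * (z + 0)\<^sup>2 / 2)))"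
      by (simp flip: ennreal_mult)
  qed
  also have "\<dots> = ennreal (1 / sqrt (2 * pi)) * (\<integral>\<^sup>+z. 1 * ennreal (exp (- c * (z + 0)\<^sup>2 / 2)) \<partial>lborel)"
    by (rule nn_integral_cmult) measurable
  also have "(\<integral>\<^sup>+z. 1 * ennreal (exp (- c * (z + 0)\<^sup>2 / 2)) \<partial>lborel) = ennreal (sqrt (2 * pi / c))"
    using nn_integral_gauss_1d[of "\<lambda>_. 1" c 0 0] c stdn.emeasure_space_1 by simp
  also have "ennreal (1 / sqrt (2 * pi)) * \<dots> = ennreal (1 / sqrt c)"
    using c by (simp add: real_sqrt_divide flip: ennreal_mult)
  finally show ?thesis by (simp add: c_def)
qed

lemma stdn_moment_even:
  "integrable stdn (\<lambda>z. z ^ (2 * k))" "(\<integral>z. z ^ (2 * k) \<partial>stdn) = fact (2 * k) / (2 ^ k * fact k)"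
  unfolding stdn_def using std_normal_moment_even[of k]
  by (auto simp: integrable_density integral_density integral_std_normal_moment_even intro: integrable.intros)

text \<open>
  A mean of at least \<open>16\<close> squares of normal variables \<open>z\<^sub>r\<close> exceeds each \<open>z\<^sub>r\<^sup>2 / n\<close>, so its inverse fourth power is at
  most \<open>n\<^sup>4\<close> times the product of sixteen factors \<open>\<bar>z\<^sub>r\<bar>\<^sup>-\<^sup>1\<^sup>/\<^sup>2\<close>, which are integrable and independent.
\<close>

definition inv_sqrt :: "real \<Rightarrow> ennreal" where
  "inv_sqrt z = inverse (ennreal (sqrt \<bar>z\<bar>))"

lemma inv_sqrt_measurable [measurable]: "inv_sqrt \<in> borel_measurable borel"
  unfolding inv_sqrt_def[abs_def] by measurable

lemma inv_sqrt_mult: "a \<noteq> 0 \<Longrightarrow> inv_sqrt (a * z) = ennreal (1 / sqrt \<bar>a\<bar>) * inv_sqrt z"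
proof -
  assume "a \<noteq> 0"
  then have "inverse (ennreal (sqrt \<bar>a\<bar>) * ennreal (sqrt \<bar>z\<bar>)) = inverse (ennreal (sqrt \<bar>a\<bar>)) * inverse (ennreal (sqrt \<bar>z\<bar>))"
    by (intro ennreal_inverse_mult) auto
  then show ?thesis
    using \<open>a \<noteq> 0\<close> by (simp add: inv_sqrt_def abs_mult real_sqrt_mult ennreal_mult inverse_ennreal inverse_eq_divide)
qed

text \<open>Away from 0 the integrand is at most the density. On (0, 1) it is dominated by e times
  the integrand of Gamma(1/2), and on (-1, 0) by its reflection.\<close>

lemma nn_integral_inv_sqrt_finite: "(\<integral>\<^sup>+z. inv_sqrt z \<partial>stdn) < \<infinity>"
proof -
  define g where "g t = (if 0 < t \<and> t < 1 then inv_sqrt t else 0)" for t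
  have [measurable]: "g \<in> borel_measurable borel" unfolding g_def[abs_def] by measurable
  have G: "((\<lambda>t::real. t powr (1/2 - 1) / exp t) has_integral Gamma (1/2)) {0..}"
    using Gamma_integral_real[of "1/2"] by simp
  have "(\<integral>\<^sup>+t. g t \<partial>lborel) \<le> (\<integral>\<^sup>+t. ennreal (exp 1) * (indicator {0..} t * ennreal (t powr (1/2 - 1) / exp t)) \<partial>lborel)"
  proof (rule nn_integral_mono)
    fix t :: real
    show "g t \<le> ennreal (exp 1) * (indicator {0..} t * ennreal (t powr (1/2 - 1) / exp t))"
    proof (cases "0 < t \<and> t < 1")
      case True
      have "1 / sqrt t = t powr (1/2 - 1)"
        using True by (simp add: powr_minus_divide powr_half_sqrt)
      also have "\<dots> \<le> exp 1 * (t powr (1/2 - 1) / exp t)"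
        using True by (simp add: field_simps)
      finally have "ennreal (1 / sqrt t) \<le> ennreal (exp 1 * (t powr (1/2 - 1) / exp t))"
        by (rule ennreal_leI)
      then show ?thesis using True
        by (simp add: g_def inv_sqrt_def inverse_ennreal inverse_eq_divide flip: ennreal_mult)
    qed (auto simp: g_def)
  qed
  also have "\<dots> = ennreal (exp 1) * (\<integral>\<^sup>+t. indicator {0..} t * ennreal (t powr (1/2 - 1) / exp t) \<partial>lborel)"
    by (rule nn_integral_cmult) measurable
  also have "(\<integral>\<^sup>+t. indicator {0..} t * ennreal (t powr (1/2 - 1) / exp t) \<partial>lborel) = ennreal (Gamma (1/2))"
  proof -
    have "(\<integral>\<^sup>+t. indicator {0..} t * ennreal (t powr (1/2 - 1) / exp t) \<partial>lborel) =
        (\<integral>\<^sup>+t. ennreal (indicator {0..} t * (t powr (1/2 - 1) / exp t)) \<partial>lborel)"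
      by (intro nn_integral_cong) (auto split: split_indicator)
    then show ?thesis
      using nn_integral_has_integral_lebesgue[OF _ G] by simp
  qed
  finally have g1: "(\<integral>\<^sup>+t. g t \<partial>lborel) < \<infinity>"
    by (metis ennreal_mult_less_top ennreal_less_top infinity_ennreal_def order_le_less_trans)
  have g2: "(\<integral>\<^sup>+t. g (- t) \<partial>lborel) = (\<integral>\<^sup>+t. g t \<partial>lborel)"
    by (subst (2) nn_integral_real_affine[where c="-1" and t=0]) auto
  have "(\<integral>\<^sup>+z. inv_sqrt z \<partial>stdn) = (\<integral>\<^sup>+z. inv_sqrt z * ennreal (std_normal_density z) \<partial>lborel)"
    by (rule nn_integral_stdn) measurable
  also have "\<dots> \<le> (\<integral>\<^sup>+z. (g z + g (- z)) + ennreal (std_normal_density z) \<partial>lborel)"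
  proof (rule nn_integral_mono_AE)
    have "AE z in lborel. z \<noteq> (0::real)" by (rule AE_lborel_singleton)
    then show "AE z in lborel. inv_sqrt z * ennreal (std_normal_density z) \<le> (g z + g (- z)) + ennreal (std_normal_density z)"
    proof eventually_elim
      fix z :: real assume "z \<noteq> 0"
      show "inv_sqrt z * ennreal (std_normal_density z) \<le> (g z + g (- z)) + ennreal (std_normal_density z)"
      proof (cases "\<bar>z\<bar> < 1")
        case True
        have "std_normal_density z \<le> 1 / sqrt (2 * pi)"
          unfolding std_normal_density_def by (intro mult_left_le) auto
        also have "\<dots> \<le> 1" using pi_gt3 by (simp add: real_le_rsqrt)
        finally have "inv_sqrt z * ennreal (std_normal_density z) \<le> inv_sqrt z * 1"
          by (intro mult_left_mono) auto
        also have "\<dots> \<le> g z + g (- z)"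
          using True \<open>z \<noteq> 0\<close> by (cases "0 < z") (auto simp: g_def inv_sqrt_def)
        finally show ?thesis by (simp add: add_increasing2)
      next
        case False
        then have "inv_sqrt z \<le> 1"
          by (simp add: inv_sqrt_def inverse_ennreal) (simp add: ennreal_le_1 inverse_le_1_iff real_le_rsqrt)
        then have "inv_sqrt z * ennreal (std_normal_density z) \<le> 1 * ennreal (std_normal_density z)"
          by (intro mult_right_mono) auto
        then show ?thesis by (simp add: add_increasing)
      qed
    qed
  qed
  also have "\<dots> = ((\<integral>\<^sup>+z. g z \<partial>lborel) + (\<integral>\<^sup>+z. g (- z) \<partial>lborel)) + (\<integral>\<^sup>+z. ennreal (std_normal_density z) \<partial>lborel)"
    by (simp add: nn_integral_add)
  also have "(\<integral>\<^sup>+z. ennreal (std_normal_density z) \<partial>lborel) = 1"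
    using nn_integral_stdn[of "\<lambda>_. 1"] stdn.emeasure_space_1 by simp
  finally show ?thesis using g1 g2 by (simp add: order_le_less_trans)
qed

definition inv_sqrt_mean :: real where
  "inv_sqrt_mean = enn2real (\<integral>\<^sup>+z. inv_sqrt z \<partial>stdn)"

lemma nn_integral_inv_sqrt: "(\<integral>\<^sup>+z. inv_sqrt z \<partial>stdn) = ennreal inv_sqrt_mean"
  unfolding inv_sqrt_mean_def using nn_integral_inv_sqrt_finite by simp

lemma inv_sqrt_mean_nonneg: "0 \<le> inv_sqrt_mean"
  by (simp add: inv_sqrt_mean_def)

section \<open>Products of identical probability spaces\<close>

lemma iid_component:
  fixes f :: "'a \<Rightarrow> real" and n :: nat
  assumes N: "prob_space N" and r: "r < n" and [measurable]: "f \<in> borel_measurable N"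
  shows "integrable (Pi\<^sub>M {..<n} (\<lambda>_. N)) (\<lambda>X. f (X r)) \<longleftrightarrow> integrable N f"
    and "(\<integral>X. f (X r) \<partial>Pi\<^sub>M {..<n} (\<lambda>_. N)) = integral\<^sup>L N f"
proof -
  have d: "distr (Pi\<^sub>M {..<n} (\<lambda>_. N)) N (\<lambda>X. X r) = N"
    by (rule distr_PiM_component) (use N r in auto)
  have [measurable]: "(\<lambda>X. X r) \<in> measurable (Pi\<^sub>M {..<n} (\<lambda>_. N)) N" using r by simp
  show "integrable (Pi\<^sub>M {..<n} (\<lambda>_. N)) (\<lambda>X. f (X r)) \<longleftrightarrow> integrable N f"
    using integrable_distr_eq[of "\<lambda>X. X r" "Pi\<^sub>M {..<n} (\<lambda>_. N)" N f] by (simp add: d)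
  show "(\<integral>X. f (X r) \<partial>Pi\<^sub>M {..<n} (\<lambda>_. N)) = integral\<^sup>L N f"
    using integral_distr[of "\<lambda>X. X r" "Pi\<^sub>M {..<n} (\<lambda>_. N)" N f] by (simp add: d)
qed

lemma iid_nn_component:
  fixes n :: nat
  assumes N: "prob_space N" and r: "r < n" and [measurable]: "f \<in> borel_measurable N"
  shows "(\<integral>\<^sup>+X. f (X r) \<partial>Pi\<^sub>M {..<n} (\<lambda>_. N)) = integral\<^sup>N N f"
proof -
  have d: "distr (Pi\<^sub>M {..<n} (\<lambda>_. N)) N (\<lambda>X. X r) = N"
    by (rule distr_PiM_component) (use N r in auto)
  have [measurable]: "(\<lambda>X. X r) \<in> measurable (Pi\<^sub>M {..<n} (\<lambda>_. N)) N" using r by simp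
  show ?thesis
    using nn_integral_distr[of "\<lambda>X. X r" "Pi\<^sub>M {..<n} (\<lambda>_. N)" N f] by (simp add: d)
qed

lemma iid_product:
  fixes f g :: "'a \<Rightarrow> real" and n :: nat
  assumes N: "prob_space N" and rs: "r < n" "s < n" "r \<noteq> s" and f: "integrable N f" and g: "integrable N g"
  shows "integrable (Pi\<^sub>M {..<n} (\<lambda>_. N)) (\<lambda>X. f (X r) * g (X s))"
    and "(\<integral>X. f (X r) * g (X s) \<partial>Pi\<^sub>M {..<n} (\<lambda>_. N)) = integral\<^sup>L N f * integral\<^sup>L N g"
proof -
  interpret N: prob_space N by fact
  interpret P: product_sigma_finite "\<lambda>_::nat. N" ..
  define F where "F i x = (if i = r then f x else 1) * (if i = s then g x else 1)" for i x
  have F: "(\<Prod>i<n. F i (X i)) = f (X r) * g (X s)" for X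
    using rs by (simp add: F_def prod.distrib)
  have Fi: "integrable N (F i)" for i
    using f g rs by (cases "i = r"; cases "i = s") (simp_all add: F_def[abs_def])
  have Fe: "integral\<^sup>L N (F i) = (if i = r then integral\<^sup>L N f else 1) * (if i = s then integral\<^sup>L N g else 1)" for i
    using rs by (cases "i = r"; cases "i = s") (simp_all add: F_def[abs_def] N.prob_space)
  show "integrable (Pi\<^sub>M {..<n} (\<lambda>_. N)) (\<lambda>X. f (X r) * g (X s))"
    using P.product_integrable_prod[of "{..<n}" F] Fi by (simp add: F)
  show "(\<integral>X. f (X r) * g (X s) \<partial>Pi\<^sub>M {..<n} (\<lambda>_. N)) = integral\<^sup>L N f * integral\<^sup>L N g"
    using P.product_integral_prod[of "{..<n}" F] Fi rs by (simp add: F Fe prod.distrib)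
qed

lemma iid_sum_square:
  fixes f :: "'a \<Rightarrow> real"
  assumes N: "prob_space N" and f: "integrable N f" and f2: "integrable N (\<lambda>x. (f x)\<^sup>2)" and f0: "integral\<^sup>L N f = 0"
  shows "integrable (Pi\<^sub>M {..<n} (\<lambda>_. N)) (\<lambda>X. (\<Sum>r<n. f (X r))\<^sup>2)"
    and "(\<integral>X. (\<Sum>r<n. f (X r))\<^sup>2 \<partial>Pi\<^sub>M {..<n} (\<lambda>_. N)) = real n * (\<integral>x. (f x)\<^sup>2 \<partial>N)"
proof -
  note [measurable] = borel_measurable_integrable[OF f]
  have eq: "(\<Sum>r<n. f (X r))\<^sup>2 = (\<Sum>r<n. \<Sum>s<n. f (X r) * f (X s))" for X :: "nat \<Rightarrow> 'a"
    by (simp add: power2_eq_square sum_product)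
  have i: "integrable (Pi\<^sub>M {..<n} (\<lambda>_. N)) (\<lambda>X. f (X r) * f (X s))"
    and e: "(\<integral>X. f (X r) * f (X s) \<partial>Pi\<^sub>M {..<n} (\<lambda>_. N)) = (if r = s then \<integral>x. (f x)\<^sup>2 \<partial>N else 0)"
    if "r < n" "s < n" for r s
    using iid_product[OF N that _ f f] iid_component[OF N that(1), of "\<lambda>x. (f x)\<^sup>2"] f2 f0
    by (cases "r = s"; simp add: power2_eq_square)+
  show "integrable (Pi\<^sub>M {..<n} (\<lambda>_. N)) (\<lambda>X. (\<Sum>r<n. f (X r))\<^sup>2)"
    unfolding eq using i by (intro Bochner_Integration.integrable_sum) auto
  have "(\<integral>X. (\<Sum>r<n. f (X r))\<^sup>2 \<partial>Pi\<^sub>M {..<n} (\<lambda>_. N)) =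
     (\<Sum>r<n. \<Sum>s<n. \<integral>X. f (X r) * f (X s) \<partial>Pi\<^sub>M {..<n} (\<lambda>_. N))"
    unfolding eq using i by (subst Bochner_Integration.integral_sum; (intro Bochner_Integration.integrable_sum sum.cong refl)?; (subst Bochner_Integration.integral_sum)?; auto)
  also have "\<dots> = (\<Sum>r<n. \<Sum>s<n. if r = s then \<integral>x. (f x)\<^sup>2 \<partial>N else 0)"
    using e by (intro sum.cong) auto
  also have "\<dots> = real n * (\<integral>x. (f x)\<^sup>2 \<partial>N)" by simp
  finally show "(\<integral>X. (\<Sum>r<n. f (X r))\<^sup>2 \<partial>Pi\<^sub>M {..<n} (\<lambda>_. N)) = real n * (\<integral>x. (f x)\<^sup>2 \<partial>N)" .
qed

lemma iid_nn_product:
  fixes n :: nat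
  assumes N: "prob_space N" and [measurable]: "\<And>r. f r \<in> borel_measurable N"
  shows "(\<integral>\<^sup>+X. (\<Prod>r<n. f r (X r)) \<partial>Pi\<^sub>M {..<n} (\<lambda>_. N)) = (\<Prod>r<n. integral\<^sup>N N (f r))"
proof -
  interpret N: prob_space N by fact
  interpret P: product_sigma_finite "\<lambda>_::nat. N" ..
  show ?thesis by (rule P.product_nn_integral_prod) auto
qed

lemma prod_mono_ennreal:
  fixes f g :: "'a \<Rightarrow> ennreal"
  assumes "\<And>i. i \<in> I \<Longrightarrow> f i \<le> g i"
  shows "prod f I \<le> prod g I"
  using assms by (induction I rule: infinite_finite_induct) (auto intro!: mult_mono)

section \<open>The sample covariance form\<close>

text \<open>The bilinear form of X^T X / n. No mean is subtracted because the rows are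
  centred.\<close>

definition cov :: "nat \<Rightarrow> nat \<Rightarrow> (nat \<Rightarrow> nat \<Rightarrow> real) \<Rightarrow> (nat \<Rightarrow> real) \<Rightarrow> (nat \<Rightarrow> real) \<Rightarrow> real" where
  "cov n p X a b = (\<Sum>r<n. ip p a (X r) * ip p b (X r)) / real n"

lemma ip_add: "ip p (\<lambda>k. a k + b k) x = ip p a x + ip p b x"
  and ip_diff: "ip p (\<lambda>k. a k - b k) x = ip p a x - ip p b x"
  by (simp_all add: ip_def algebra_simps sum.distrib sum_subtractf)

lemma bf_add_left: "bf p A (\<lambda>k. a k + b k) c = bf p A a c + bf p A b c"
  and bf_add_right: "bf p A c (\<lambda>k. a k + b k) = bf p A c a + bf p A c b"
  and bf_diff_left: "bf p A (\<lambda>k. a k - b k) c = bf p A a c - bf p A b c"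
  and bf_diff_right: "bf p A c (\<lambda>k. a k - b k) = bf p A c a - bf p A c b"
  by (simp_all add: bf_def algebra_simps sum.distrib sum_subtractf)

text \<open>Only the quadratic form is accessible through the law of one projection; polarisation
  carries its deviations over to the bilinear form.\<close>

lemma cov_polar:
  "4 * cov n p X a b = cov n p X (\<lambda>k. a k + b k) (\<lambda>k. a k + b k) - cov n p X (\<lambda>k. a k - b k) (\<lambda>k. a k - b k)"
proof -
  have "4 * (\<Sum>r<n. ip p a (X r) * ip p b (X r)) =
      (\<Sum>r<n. (ip p a (X r) + ip p b (X r)) * (ip p a (X r) + ip p b (X r)))
      - (\<Sum>r<n. (ip p a (X r) - ip p b (X r)) * (ip p a (X r) - ip p b (X r)))"
    unfolding sum_distrib_left sum_subtractf[symmetric] by (intro sum.cong refl) (simp add: algebra_simps)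
  then show ?thesis by (simp add: cov_def ip_add ip_diff flip: diff_divide_distrib)
qed

lemma cov_nonneg: "0 \<le> cov n p X a a"
  unfolding cov_def by (intro divide_nonneg_nonneg sum_nonneg) auto

lemma power4_sum_le:
  fixes y :: "nat \<Rightarrow> real"
  shows "(\<Sum>r<n. y r) ^ 4 \<le> real n ^ 3 * (\<Sum>r<n. y r ^ 4)"
proof -
  have "((\<Sum>r<n. y r)\<^sup>2)\<^sup>2 \<le> ((\<Sum>r<n. (y r)\<^sup>2) * real n)\<^sup>2"
    using sum_squared_le_sum_of_squares[of y "{..<n}"] by (intro power_mono) auto
  also have "\<dots> = (\<Sum>r<n. (y r)\<^sup>2)\<^sup>2 * (real n)\<^sup>2" by (simp add: power_mult_distrib)
  also have "\<dots> \<le> ((\<Sum>r<n. ((y r)\<^sup>2)\<^sup>2) * real n) * (real n)\<^sup>2"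
    using sum_squared_le_sum_of_squares[of "\<lambda>r. (y r)\<^sup>2" "{..<n}"] by (intro mult_right_mono) auto
  finally show ?thesis by (simp add: power2_eq_square power3_eq_cube power4_eq_xxxx mult_ac)
qed

lemma cov_power4_le:
  "n > 0 \<Longrightarrow> (cov n p X a a) ^ 4 \<le> (\<Sum>r<n. ip p a (X r) ^ 8) / real n"
proof -
  assume n: "n > 0"
  have "(cov n p X a a) ^ 4 = (\<Sum>r<n. (ip p a (X r))\<^sup>2) ^ 4 / real n ^ 4"
    by (simp add: cov_def power_divide power2_eq_square)
  also have "\<dots> \<le> (real n ^ 3 * (\<Sum>r<n. ((ip p a (X r))\<^sup>2) ^ 4)) / real n ^ 4"
    by (intro divide_right_mono power4_sum_le) auto
  also have "\<dots> = (\<Sum>r<n. ip p a (X r) ^ 8) / real n"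
  proof -
    have "(y\<^sup>2) ^ 4 = y ^ 8" for y :: real by (simp flip: power_mult)
    moreover have "real n ^ 4 = real n ^ 3 * real n" by (simp add: eval_nat_numeral)
    ultimately show ?thesis using n by simp
  qed
  finally show ?thesis .
qed

section \<open>Moments and deviations of the sample covariance of Gaussian rows\<close>

context pd_matrix
begin

abbreviation N where "N \<equiv> normal_vec p (minv A)"
abbreviation V where "V \<equiv> bf p (minv A)"

sublocale N: prob_space N by (rule prob_space_normal_vec)

lemma measurable_ip_gen [measurable]:
  "(\<lambda>x. ip p a x) \<in> borel_measurable (Pi\<^sub>M {..<p} (\<lambda>_. borel :: real measure))"
  unfolding ip_def by measurable

lemma measurable_ip [measurable]: "(\<lambda>x. ip p a x) \<in> borel_measurable N"
  by measurable

lemma distr_ip: "distr N borel (ip p a) = distr stdn borel (\<lambda>z. sqrt (V a a) * z)"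
proof (rule measure_eqI)
  fix B assume "B \<in> sets (distr N borel (ip p a))"
  then have [measurable]: "B \<in> sets borel" by simp
  have "emeasure (distr N borel (ip p a)) B = (\<integral>\<^sup>+x. indicator B (ip p a x) \<partial>N)"
    by (subst nn_integral_distr[of "ip p a" N borel "indicator B", symmetric]) (simp_all add: measurable_ip[simplified])
  also have "\<dots> = (\<integral>\<^sup>+z. indicator B (sqrt (V a a) * z) \<partial>stdn)"
    by (rule nn_integral_normal_vec_ip) measurable
  also have "\<dots> = emeasure (distr stdn borel (\<lambda>z. sqrt (V a a) * z)) B"
    by (subst nn_integral_distr[of "\<lambda>z. sqrt (V a a) * z" stdn borel "indicator B", symmetric]) simp_all
  finally show "emeasure (distr N borel (ip p a)) B = emeasure (distr stdn borel (\<lambda>z. sqrt (V a a) * z)) B" .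
qed simp

lemma ip_moment:
  "integrable N (\<lambda>x. ip p a x ^ (2 * k))"
  "(\<integral>x. ip p a x ^ (2 * k) \<partial>N) = V a a ^ k * (fact (2 * k) / (2 ^ k * fact k))"
proof -
  have V: "sqrt (V a a) ^ (2 * k) = V a a ^ k"
    using bf_minv_nonneg by (simp add: power_mult)
  have "integrable (distr N borel (ip p a)) (\<lambda>y. y ^ (2 * k))"
    unfolding distr_ip by (subst integrable_distr_eq) (auto simp: power_mult_distrib stdn_moment_even(1))
  then show "integrable N (\<lambda>x. ip p a x ^ (2 * k))"
    by (subst (asm) integrable_distr_eq) auto
  have "(\<integral>x. ip p a x ^ (2 * k) \<partial>N) = (\<integral>y. y ^ (2 * k) \<partial>distr N borel (ip p a))"
    by (subst integral_distr) auto
  also have "\<dots> = (\<integral>z. (sqrt (V a a) * z) ^ (2 * k) \<partial>stdn)"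
    unfolding distr_ip by (subst integral_distr) auto
  also have "\<dots> = V a a ^ k * (fact (2 * k) / (2 ^ k * fact k))"
    by (simp add: power_mult_distrib V stdn_moment_even(2))
  finally show "(\<integral>x. ip p a x ^ (2 * k) \<partial>N) = V a a ^ k * (fact (2 * k) / (2 ^ k * fact k))" .
qed

lemma ip_square: "integrable N (\<lambda>x. (ip p a x)\<^sup>2)" "(\<integral>x. (ip p a x)\<^sup>2 \<partial>N) = V a a"
  using ip_moment[of a 1] by (simp_all add: fact_numeral)

lemma ip_fourth: "integrable N (\<lambda>x. (ip p a x) ^ 4)" "(\<integral>x. (ip p a x) ^ 4 \<partial>N) = 3 * (V a a)\<^sup>2"
  using ip_moment[of a 2] by (simp_all add: fact_numeral)

lemma ip_eighth: "integrable N (\<lambda>x. (ip p a x) ^ 8)" "(\<integral>x. (ip p a x) ^ 8 \<partial>N) = 105 * (V a a) ^ 4"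
  using ip_moment[of a 4] by (simp_all add: fact_numeral)

lemma V_add: "V (\<lambda>k. a k + b k) (\<lambda>k. a k + b k) = V a a + 2 * V a b + V b b"
  and V_diff: "V (\<lambda>k. a k - b k) (\<lambda>k. a k - b k) = V a a - 2 * V a b + V b b"
  using bf_minv_sym[of b a] by (simp_all add: bf_add_left bf_add_right bf_diff_left bf_diff_right)

lemma ip_product:
  "integrable N (\<lambda>x. ip p a x * ip p b x)" "(\<integral>x. ip p a x * ip p b x \<partial>N) = V a b"
proof -
  have e: "ip p a x * ip p b x = ((ip p (\<lambda>k. a k + b k) x)\<^sup>2 - (ip p (\<lambda>k. a k - b k) x)\<^sup>2) / 4" for x
    by (simp add: ip_add ip_diff power2_eq_square algebra_simps)
  show "integrable N (\<lambda>x. ip p a x * ip p b x)" unfolding e using ip_square by simp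
  show "(\<integral>x. ip p a x * ip p b x \<partial>N) = V a b"
    unfolding e by (simp add: ip_square V_add V_diff)
qed

text \<open>The identity (a+b)^4 + (a-b)^4 = 2 a^4 + 12 a^2 b^2 + 2 b^4 replaces the joint law of
  the two projections.\<close>

lemma ip_product_square:
  "integrable N (\<lambda>x. (ip p a x * ip p b x)\<^sup>2)"
  "(\<integral>x. (ip p a x * ip p b x)\<^sup>2 \<partial>N) = V a a * V b b + 2 * (V a b)\<^sup>2"
proof -
  have e: "(ip p a x * ip p b x)\<^sup>2 = ((ip p (\<lambda>k. a k + b k) x) ^ 4 + (ip p (\<lambda>k. a k - b k) x) ^ 4
      - 2 * (ip p a x) ^ 4 - 2 * (ip p b x) ^ 4) / 12" for x
    by (simp add: ip_add ip_diff power2_eq_square power4_eq_xxxx algebra_simps)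
  show "integrable N (\<lambda>x. (ip p a x * ip p b x)\<^sup>2)" unfolding e using ip_fourth by simp
  show "(\<integral>x. (ip p a x * ip p b x)\<^sup>2 \<partial>N) = V a a * V b b + 2 * (V a b)\<^sup>2"
    unfolding e by (simp add: ip_fourth V_add V_diff power2_eq_square algebra_simps)
qed

text \<open>For two columns of the precision matrix this variance is \<open>sigma_sq\<close>, the
  variance in the efficiency bound.\<close>

lemma ip_product_variance:
  "integrable N (\<lambda>x. (ip p a x * ip p b x - V a b)\<^sup>2)"
  "(\<integral>x. (ip p a x * ip p b x - V a b)\<^sup>2 \<partial>N) = V a a * V b b + (V a b)\<^sup>2"
proof -
  have e: "(ip p a x * ip p b x - V a b)\<^sup>2 = (ip p a x * ip p b x)\<^sup>2 - 2 * V a b * (ip p a x * ip p b x) + (V a b)\<^sup>2" for x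
    by (simp add: power2_eq_square algebra_simps)
  show "integrable N (\<lambda>x. (ip p a x * ip p b x - V a b)\<^sup>2)" unfolding e using ip_product_square ip_product by simp
  show "(\<integral>x. (ip p a x * ip p b x - V a b)\<^sup>2 \<partial>N) = V a a * V b b + (V a b)\<^sup>2"
    unfolding e by (simp add: ip_product_square ip_product N.prob_space) (simp add: power2_eq_square)
qed

abbreviation P :: "nat \<Rightarrow> (nat \<Rightarrow> nat \<Rightarrow> real) measure" where "P n \<equiv> Pi\<^sub>M {..<n} (\<lambda>_. N)"

lemma sample_law_P: "sample_law n p A = P n"
  by (simp add: sample_law_def)

lemma prob_space_P: "prob_space (P n)"
  by (intro prob_space_PiM) (rule N.prob_space_axioms)

lemma sets_P: "sets (P n) = sets (data_space n p)"
  unfolding data_space_def by (intro sets_PiM_cong) auto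

lemma measurable_row [measurable]: "(\<lambda>X. ip p a (X r)) \<in> borel_measurable (P n)" if "r < n"
proof -
  have "(\<lambda>X. X r) \<in> measurable (P n) N" using that by simp
  then show ?thesis by (rule measurable_compose[OF _ measurable_ip])
qed

lemma measurable_cov [measurable]: "(\<lambda>X. cov n p X a b) \<in> borel_measurable (P n)"
proof -
  have "(\<lambda>X. ip p a (X r) * ip p b (X r)) \<in> borel_measurable (P n)" if "r \<in> {..<n}" for r
  proof -
    have "r < n" using that by simp
    then show ?thesis by (intro borel_measurable_times measurable_row)
  qed
  then have "(\<lambda>X. \<Sum>r<n. ip p a (X r) * ip p b (X r)) \<in> borel_measurable (P n)"
    by (intro borel_measurable_sum) blast
  then show ?thesis unfolding cov_def by measurable
qed

lemma cov_centered:
  "n > 0 \<Longrightarrow> cov n p X a b - V a b = (\<Sum>r<n. ip p a (X r) * ip p b (X r) - V a b) / real n"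
  by (simp add: cov_def sum_subtractf diff_divide_distrib)

lemma cov_variance:
  assumes "n > 0"
  shows "integrable (P n) (\<lambda>X. (cov n p X a b - V a b)\<^sup>2)"
    and "(\<integral>X. (cov n p X a b - V a b)\<^sup>2 \<partial>P n) = (V a a * V b b + (V a b)\<^sup>2) / real n"
proof -
  let ?f = "\<lambda>x. ip p a x * ip p b x - V a b"
  have f: "integrable N ?f" "integral\<^sup>L N ?f = 0"
    by (simp_all add: ip_product N.prob_space)
  note s = iid_sum_square[OF N.prob_space_axioms f(1) ip_product_variance(1) f(2), of n]
  show "integrable (P n) (\<lambda>X. (cov n p X a b - V a b)\<^sup>2)"
    unfolding cov_centered[OF assms] power_divide using s(1) by simp
  show "(\<integral>X. (cov n p X a b - V a b)\<^sup>2 \<partial>P n) = (V a a * V b b + (V a b)\<^sup>2) / real n"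
    unfolding cov_centered[OF assms] power_divide using s(2) assms
    by (simp add: ip_product_variance power2_eq_square[of "real n"])
qed

lemma cov_mean:
  assumes "n > 0"
  shows "integrable (P n) (\<lambda>X. cov n p X a b)" and "(\<integral>X. cov n p X a b \<partial>P n) = V a b"
proof -
  have i: "integrable (P n) (\<lambda>X. ip p a (X r) * ip p b (X r))" 
    "(\<integral>X. ip p a (X r) * ip p b (X r) \<partial>P n) = V a b" if "r < n" for r
    using iid_component[OF N.prob_space_axioms that, of "\<lambda>x. ip p a x * ip p b x"] ip_product by simp_all
  show "integrable (P n) (\<lambda>X. cov n p X a b)"
    unfolding cov_def using i by (intro integrable_divide Bochner_Integration.integrable_sum) auto
  show "(\<integral>X. cov n p X a b \<partial>P n) = V a b"
    unfolding cov_def using i assms by (subst integral_divide_zero, subst Bochner_Integration.integral_sum) auto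
qed

lemma nn_integral_exp_ip:
  assumes "2 * t * V a a < 1"
  shows "(\<integral>\<^sup>+x. ennreal (exp (t * (ip p a x)\<^sup>2 + c)) \<partial>N) = ennreal (exp c / sqrt (1 - 2 * t * V a a))"
proof -
  have "(\<integral>\<^sup>+x. ennreal (exp (t * (ip p a x)\<^sup>2 + c)) \<partial>N) = (\<integral>\<^sup>+z. ennreal (exp (t * (sqrt (V a a) * z)\<^sup>2 + c)) \<partial>stdn)"
    by (rule nn_integral_normal_vec_ip) measurable
  also have "\<dots> = (\<integral>\<^sup>+z. ennreal (exp c) * ennreal (exp ((t * V a a) * z\<^sup>2)) \<partial>stdn)"
    by (intro nn_integral_cong) (simp add: power_mult_distrib bf_minv_nonneg exp_add mult_ac flip: ennreal_mult)
  also have "\<dots> = ennreal (exp c) * ennreal (1 / sqrt (1 - 2 * (t * V a a)))"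
    using assms by (subst nn_integral_cmult) (simp_all add: nn_integral_stdn_exp_square)
  finally show ?thesis using assms by (simp add: mult.assoc flip: ennreal_mult)
qed

text \<open>Exponential Markov inequality for a sum over independent rows. The sign of
  \<open>t\<close> is free, so that one statement serves both tails.\<close>

lemma chernoff:
  assumes "2 * t * V a a < 1" and le: "exp c / sqrt (1 - 2 * t * V a a) \<le> exp (- v)"
  shows "emeasure (P n) {X \<in> space (P n). (\<Sum>r<n. t * (ip p a (X r))\<^sup>2 + c) \<ge> 0} \<le> ennreal (exp (- (real n * v)))"
proof -
  have [measurable]: "(\<lambda>X. \<Sum>r<n. t * (ip p a (X r))\<^sup>2 + c) \<in> borel_measurable (P n)"
    by (intro borel_measurable_sum) measurable
  have "emeasure (P n) {X \<in> space (P n). (\<Sum>r<n. t * (ip p a (X r))\<^sup>2 + c) \<ge> 0} =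
      (\<integral>\<^sup>+X. indicator {X \<in> space (P n). (\<Sum>r<n. t * (ip p a (X r))\<^sup>2 + c) \<ge> 0} X \<partial>P n)"
    by (rule nn_integral_indicator[symmetric]) measurable
  also have "\<dots> \<le> (\<integral>\<^sup>+X. (\<Prod>r<n. ennreal (exp (t * (ip p a (X r))\<^sup>2 + c))) \<partial>P n)"
  proof (rule nn_integral_mono)
    fix X
    have "(\<Prod>r<n. ennreal (exp (t * (ip p a (X r))\<^sup>2 + c))) = ennreal (exp (\<Sum>r<n. t * (ip p a (X r))\<^sup>2 + c))"
      by (simp only: prod_ennreal exp_ge_zero exp_sum finite_lessThan)
    then show "indicator {X \<in> space (P n). (\<Sum>r<n. t * (ip p a (X r))\<^sup>2 + c) \<ge> 0} X \<le> (\<Prod>r<n. ennreal (exp (t * (ip p a (X r))\<^sup>2 + c)))"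
      by (auto simp: indicator_def)
  qed
  also have "\<dots> = (\<Prod>r<n. ennreal (exp c / sqrt (1 - 2 * t * V a a)))"
    using nn_integral_exp_ip[OF assms(1), of c]
    by (subst iid_nn_product[OF N.prob_space_axioms, of "\<lambda>_ x. ennreal (exp (t * (ip p a x)\<^sup>2 + c))"]) simp_all
  also have "\<dots> \<le> (\<Prod>r<n. ennreal (exp (- v)))"
    using le by (intro prod_mono_ennreal) (auto intro: ennreal_leI)
  also have "\<dots> = ennreal (exp (- (real n * v)))"
    by (simp add: ennreal_power exp_of_nat_mult[symmetric])
  finally show ?thesis .
qed

lemma cov_square_tail:
  assumes "n > 0" and K: "V a a \<le> K" "0 < K" and u: "0 < u" "u \<le> 1"
  shows "emeasure (P n) {X \<in> space (P n). \<bar>cov n p X a a - V a a\<bar> > u * K} \<le> ennreal (2 * exp (- (real n * u\<^sup>2 / 16)))"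
proof -
  define q where "q = V a a"
  have q: "0 \<le> q" "q \<le> K" using bf_minv_nonneg K by (auto simp: q_def)
  \<comment> \<open>With this \<open>t\<close> the gain \<open>t * (u * K)\<close> is u^2 / 8, while
    x = 2 t q is at most u / 4, so the second-order terms of the logarithm, at most x^2, cost no
    more than u^2 / 16.\<close>
  define t where "t = u / (8 * K)"
  define x where "x = 2 * t * q"
  have t: "t > 0" "t * K = u / 8" using u K by (auto simp: t_def)
  have "x \<le> 2 * (t * K)" using q t by (simp add: x_def mult_left_mono)
  then have x: "0 \<le> x" "x \<le> u / 4" using t q by (auto simp: x_def)
  then have x2: "x\<^sup>2 \<le> u\<^sup>2 / 16" using power_mono[of x "u/4" 2] by (simp add: power_divide)
  have tx: "t * q = x / 2" "t * (u * K) = u\<^sup>2 / 8"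
    using arg_cong[OF t(2), of "\<lambda>v. u * v"] by (simp_all add: x_def power2_eq_square mult_ac)
  have A1: "exp (- t * (q + u * K)) / sqrt (1 - 2 * t * V a a) \<le> exp (- (u\<^sup>2 / 16))"
  proof -
    have "- x - 2 * x\<^sup>2 \<le> ln (1 - x)" using x u by (intro ln_one_minus_pos_lower_bound) auto
    then have "- t * (q + u * K) - ln (1 - x) / 2 \<le> - (u\<^sup>2 / 16)"
      using x2 tx by (simp add: distrib_left right_diff_distrib)
    then have "exp (- t * (q + u * K) - ln (1 - x) / 2) \<le> exp (- (u\<^sup>2 / 16))" by simp
    moreover have "exp (ln (1 - x) / 2) = sqrt (1 - x)"
      using x u by (simp add: ln_sqrt[symmetric])
    ultimately show ?thesis by (simp add: exp_diff x_def q_def)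
  qed
  have A2: "exp (t * (q - u * K)) / sqrt (1 - 2 * (- t) * V a a) \<le> exp (- (u\<^sup>2 / 16))"
  proof -
    have "x - x\<^sup>2 \<le> ln (1 + x)" using x u by (intro ln_one_plus_pos_lower_bound) auto
    then have "t * (q - u * K) - ln (1 + x) / 2 \<le> - (u\<^sup>2 / 16)"
      unfolding right_diff_distrib using x2 tx zero_le_power2[of u] by linarith
    then have "exp (t * (q - u * K) - ln (1 + x) / 2) \<le> exp (- (u\<^sup>2 / 16))" by simp
    moreover have "exp (ln (1 + x) / 2) = sqrt (1 + x)"
      using x u by (simp add: ln_sqrt[symmetric])
    ultimately show ?thesis by (simp add: exp_diff x_def q_def)
  qed
  let ?S1 = "{X \<in> space (P n). (\<Sum>r<n. t * (ip p a (X r))\<^sup>2 + (- t * (q + u * K))) \<ge> 0}"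
  let ?S2 = "{X \<in> space (P n). (\<Sum>r<n. (- t) * (ip p a (X r))\<^sup>2 + t * (q - u * K)) \<ge> 0}"
  have m1: "?S1 \<in> sets (P n)" "?S2 \<in> sets (P n)" by measurable
  have "{X \<in> space (P n). \<bar>cov n p X a a - V a a\<bar> > u * K} \<subseteq> ?S1 \<union> ?S2"
  proof
    fix X assume "X \<in> {X \<in> space (P n). \<bar>cov n p X a a - V a a\<bar> > u * K}"
    then have X: "X \<in> space (P n)" and c: "cov n p X a a > q + u * K \<or> cov n p X a a < q - u * K"
      by (auto simp: q_def)
    have s: "(\<Sum>r<n. (ip p a (X r))\<^sup>2) = real n * cov n p X a a"
      using \<open>n > 0\<close> by (simp add: cov_def power2_eq_square)
    have s1: "(\<Sum>r<n. t * (ip p a (X r))\<^sup>2 + (- t * (q + u * K))) = real n * t * (cov n p X a a - (q + u * K))"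
      unfolding sum.distrib sum_distrib_left[symmetric] s by (simp add: algebra_simps)
    have s2: "(\<Sum>r<n. (- t) * (ip p a (X r))\<^sup>2 + t * (q - u * K)) = real n * t * ((q - u * K) - cov n p X a a)"
      unfolding sum.distrib sum_distrib_left[symmetric] s by (simp add: algebra_simps)
    show "X \<in> ?S1 \<union> ?S2"
      using c
    proof
      assume "cov n p X a a > q + u * K"
      then have "0 \<le> real n * t * (cov n p X a a - (q + u * K))" using t by (intro mult_nonneg_nonneg) auto
      then show ?thesis using X s1 by simp
    next
      assume "cov n p X a a < q - u * K"
      then have "0 \<le> real n * t * ((q - u * K) - cov n p X a a)" using t by (intro mult_nonneg_nonneg) auto
      then show ?thesis using X s2 by simp
    qed
  qed
  then have "emeasure (P n) {X \<in> space (P n). \<bar>cov n p X a a - V a a\<bar> > u * K} \<le> emeasure (P n) (?S1 \<union> ?S2)"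
    using m1 by (intro emeasure_mono) auto
  also have "\<dots> \<le> emeasure (P n) ?S1 + emeasure (P n) ?S2"
    using m1 by (intro emeasure_subadditive)
  also have "\<dots> \<le> ennreal (exp (- (real n * (u\<^sup>2 / 16)))) + ennreal (exp (- (real n * (u\<^sup>2 / 16))))"
  proof (intro add_mono chernoff)
    show "2 * t * V a a < 1" using x u by (simp add: x_def q_def)
    show "2 * (- t) * V a a < 1" using x by (simp add: x_def q_def)
  qed (use A1 A2 in auto)
  also have "\<dots> = ennreal (2 * exp (- (real n * u\<^sup>2 / 16)))"
    by (simp flip: ennreal_plus)
  finally show ?thesis .
qed

text \<open>Since V(a+b) + V(a-b) = 2 V(a) + 2 V(b) and both are nonnegative, each is at most 4 K.
  Two deviations of size 4 K u, divided by the 4 of the polarisation identity, give 2 K u.\<close>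

lemma cov_tail:
  assumes "n > 0" and K: "V a a \<le> K" "V b b \<le> K" "0 < K" and u: "0 < u" "u \<le> 1"
  shows "emeasure (P n) {X \<in> space (P n). \<bar>cov n p X a b - V a b\<bar> > 2 * K * u} \<le> ennreal (4 * exp (- (real n * u\<^sup>2 / 16)))"
proof -
  let ?p = "\<lambda>k. a k + b k" and ?m = "\<lambda>k. a k - b k"
  have nn: "0 \<le> V ?p ?p" "0 \<le> V ?m ?m" by (rule bf_minv_nonneg)+
  have K4: "V ?p ?p \<le> 4 * K" "V ?m ?m \<le> 4 * K"
    using nn K unfolding V_add V_diff by auto
  let ?S = "\<lambda>a. {X \<in> space (P n). \<bar>cov n p X a a - V a a\<bar> > u * (4 * K)}"
  have m: "?S ?p \<in> sets (P n)" "?S ?m \<in> sets (P n)" by measurable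
  have "{X \<in> space (P n). \<bar>cov n p X a b - V a b\<bar> > 2 * K * u} \<subseteq> ?S ?p \<union> ?S ?m"
  proof
    fix X assume X: "X \<in> {X \<in> space (P n). \<bar>cov n p X a b - V a b\<bar> > 2 * K * u}"
    have "4 * (cov n p X a b - V a b) = (cov n p X ?p ?p - V ?p ?p) - (cov n p X ?m ?m - V ?m ?m)"
      using cov_polar[of n p X a b] by (simp add: V_add V_diff)
    then have polar: "4 * \<bar>cov n p X a b - V a b\<bar> \<le> \<bar>cov n p X ?p ?p - V ?p ?p\<bar> + \<bar>cov n p X ?m ?m - V ?m ?m\<bar>"
      by linarith
    have uK: "u * (4 * K) = 2 * (2 * K * u)" by simp
    have "u * (4 * K) < \<bar>cov n p X ?p ?p - V ?p ?p\<bar> \<or> u * (4 * K) < \<bar>cov n p X ?m ?m - V ?m ?m\<bar>"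
    proof -
      have "w < a \<or> w < b" if "4 * c \<le> a + b" "w = 2 * v" "v < c" for a b c v w :: real
        using that by linarith
      from this[OF _ _ conjunct2[OF X[unfolded mem_Collect_eq]]] show ?thesis
        using polar uK by blast
    qed
    then show "X \<in> ?S ?p \<union> ?S ?m" using X by blast
  qed
  then have "emeasure (P n) {X \<in> space (P n). \<bar>cov n p X a b - V a b\<bar> > 2 * K * u} \<le> emeasure (P n) (?S ?p \<union> ?S ?m)"
    using m by (intro emeasure_mono) auto
  also have "\<dots> \<le> emeasure (P n) (?S ?p) + emeasure (P n) (?S ?m)"
    using m by (intro emeasure_subadditive)
  also have "\<dots> \<le> ennreal (2 * exp (- (real n * u\<^sup>2 / 16))) + ennreal (2 * exp (- (real n * u\<^sup>2 / 16)))"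
    using K4 assms by (intro add_mono cov_square_tail) auto
  also have "\<dots> = ennreal (4 * exp (- (real n * u\<^sup>2 / 16)))"
    by (simp flip: ennreal_plus)
  finally show ?thesis .
qed

text \<open>Power mean inequality over the rows; 105 is the eighth moment of a standard normal
  variable.\<close>

lemma nn_cov_power4:
  assumes "n > 0"
  shows "(\<integral>\<^sup>+X. ennreal ((cov n p X a a) ^ 4) \<partial>P n) \<le> ennreal (105 * (V a a) ^ 4)"
proof -
  have "(\<integral>\<^sup>+X. ennreal ((cov n p X a a) ^ 4) \<partial>P n) \<le> (\<integral>\<^sup>+X. ennreal (1 / real n) * (\<Sum>r<n. ennreal (ip p a (X r) ^ 8)) \<partial>P n)"
  proof (intro nn_integral_mono)
    fix X
    have "(\<Sum>r<n. ennreal (ip p a (X r) ^ 8)) = ennreal (\<Sum>r<n. ip p a (X r) ^ 8)"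
      by (rule sum_ennreal) simp
    then have "ennreal (1 / real n) * (\<Sum>r<n. ennreal (ip p a (X r) ^ 8)) = ennreal ((\<Sum>r<n. ip p a (X r) ^ 8) / real n)"
      by (simp add: sum_nonneg flip: ennreal_mult)
    then show "ennreal ((cov n p X a a) ^ 4) \<le> ennreal (1 / real n) * (\<Sum>r<n. ennreal (ip p a (X r) ^ 8))"
      using cov_power4_le[OF assms, of p X a] by (simp add: ennreal_leI)
  qed
  also have "\<dots> = ennreal (1 / real n) * (\<Sum>r<n. \<integral>\<^sup>+X. ennreal (ip p a (X r) ^ 8) \<partial>P n)"
    by (subst nn_integral_cmult; (subst nn_integral_sum)?; (intro borel_measurable_sum)?; measurable)
  also have "(\<Sum>r<n. \<integral>\<^sup>+X. ennreal (ip p a (X r) ^ 8) \<partial>P n) = (\<Sum>r<n. ennreal (105 * (V a a) ^ 4))"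
  proof (intro sum.cong refl)
    fix r assume "r \<in> {..<n}"
    then have "(\<integral>\<^sup>+X. ennreal (ip p a (X r) ^ 8) \<partial>P n) = (\<integral>\<^sup>+x. ennreal (ip p a x ^ 8) \<partial>N)"
      by (intro iid_nn_component[OF N.prob_space_axioms, of r n "\<lambda>x. ennreal (ip p a x ^ 8)"]) auto
    also have "\<dots> = ennreal (105 * (V a a) ^ 4)"
      using ip_eighth[of a] by (subst nn_integral_eq_integral) auto
    finally show "(\<integral>\<^sup>+X. ennreal (ip p a (X r) ^ 8) \<partial>P n) = ennreal (105 * (V a a) ^ 4)" .
  qed
  also have "ennreal (1 / real n) * \<dots> = ennreal (105 * (V a a) ^ 4)"
    using assms by (simp add: ennreal_of_nat_eq_real_of_nat flip: ennreal_mult)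
  finally show ?thesis .
qed

lemma nn_inverse_cov_power4:
  assumes n: "n \<ge> 16" and q: "V a a > 0"
  shows "(\<integral>\<^sup>+X. ennreal (1 / (cov n p X a a) ^ 4) \<partial>P n) \<le> ennreal (real n ^ 4 * inv_sqrt_mean ^ 16 / (V a a) ^ 4)"
proof -
  define f where "f r x = (if r < 16 then inv_sqrt (ip p a x) else 1)" for r :: nat and x
  have [measurable]: "f r \<in> borel_measurable N" for r unfolding f_def[abs_def] by measurable
  have "(\<integral>\<^sup>+X. ennreal (1 / (cov n p X a a) ^ 4) \<partial>P n) \<le> (\<integral>\<^sup>+X. ennreal (real n ^ 4) * (\<Prod>r<n. f r (X r)) \<partial>P n)"
  proof (rule nn_integral_mono)
    fix X
    have pr: "(\<Prod>r<n. f r (X r)) = (\<Prod>r<16. inv_sqrt (ip p a (X r)))"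
      unfolding f_def using n by (subst prod.inter_filter[symmetric]) (auto intro!: prod.cong)
    define c where "c = cov n p X a a"
    show "ennreal (1 / (cov n p X a a) ^ 4) \<le> ennreal (real n ^ 4) * (\<Prod>r<n. f r (X r))"
    \<comment> \<open>For c = 0 the left-hand side is 0, because 1 / 0 = 0.\<close>
    proof (cases "c = 0")
      case False
      then have c: "c > 0" using cov_nonneg[of n p X a] by (simp add: c_def)
      define s where "s = sqrt (real n * c)"
      have s: "s > 0" using c n by (simp add: s_def)
      have "inverse (ennreal (sqrt s)) \<le> inv_sqrt (ip p a (X r))" if "r < 16" for r
      proof -
        have "(ip p a (X r))\<^sup>2 \<le> (\<Sum>r<n. (ip p a (X r))\<^sup>2)"
          using that n by (intro member_le_sum) auto
        also have "\<dots> = real n * c" using n by (simp add: c_def cov_def power2_eq_square)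
        finally have "\<bar>ip p a (X r)\<bar> \<le> s" unfolding s_def by (simp add: real_le_rsqrt)
        then show ?thesis using s
          by (cases "ip p a (X r) = 0") (auto simp: inv_sqrt_def inverse_ennreal intro!: ennreal_leI le_imp_inverse_le)
      qed
      then have "(\<Prod>r<(16::nat). inverse (ennreal (sqrt s))) \<le> (\<Prod>r<16. inv_sqrt (ip p a (X r)))"
        by (intro prod_mono_ennreal) auto
      also have "(\<Prod>r<(16::nat). inverse (ennreal (sqrt s))) = ennreal ((1 / sqrt s) ^ 16)"
        using s by (simp add: inverse_ennreal inverse_eq_divide ennreal_power)
      also have "(1 / sqrt s) ^ 16 = 1 / (real n * c) ^ 4"
      proof -
        have "sqrt s ^ 16 = (((sqrt s)\<^sup>2)\<^sup>2) ^ 4" by (simp flip: power_mult)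
        also have "\<dots> = (real n * c) ^ 4" using s c by (simp add: s_def)
        finally show ?thesis by (simp add: power_divide)
      qed
      finally have "ennreal (real n ^ 4) * ennreal (1 / (real n * c) ^ 4) \<le> ennreal (real n ^ 4) * (\<Prod>r<n. f r (X r))"
        unfolding pr by (intro mult_left_mono) auto
      then show ?thesis using n c by (simp add: c_def[symmetric] power_mult_distrib flip: ennreal_mult)
    qed (simp add: c_def)
  qed
  also have "\<dots> = ennreal (real n ^ 4) * (\<integral>\<^sup>+X. (\<Prod>r<n. f r (X r)) \<partial>P n)"
    by (rule nn_integral_cmult) (intro borel_measurable_prod_ennreal, measurable)
  also have "(\<integral>\<^sup>+X. (\<Prod>r<n. f r (X r)) \<partial>P n) = (\<Prod>r<n. integral\<^sup>N N (f r))"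
    by (rule iid_nn_product[OF N.prob_space_axioms]) measurable
  also have "\<dots> = (\<Prod>r<(16::nat). \<integral>\<^sup>+x. inv_sqrt (ip p a x) \<partial>N)"
  proof -
    have "integral\<^sup>N N (f r) = (if r < 16 then \<integral>\<^sup>+x. inv_sqrt (ip p a x) \<partial>N else 1)" for r
      by (simp add: f_def[abs_def] N.emeasure_space_1)
    moreover
      have "{x \<in> {..<n}. x < 16} = {..<16}" using n by auto
    ultimately show ?thesis using prod.inter_filter[of "{..<n}" "\<lambda>_. \<integral>\<^sup>+x. inv_sqrt (ip p a x) \<partial>N" "\<lambda>r. r < 16"]
        by simp
  qed
  also have "(\<integral>\<^sup>+x. inv_sqrt (ip p a x) \<partial>N) = (\<integral>\<^sup>+z. inv_sqrt (sqrt (V a a) * z) \<partial>stdn)"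
    by (rule nn_integral_normal_vec_ip) measurable
  also have "\<dots> = ennreal (1 / sqrt (sqrt (V a a)) * inv_sqrt_mean)"
    using q by (simp add: inv_sqrt_mult nn_integral_cmult nn_integral_inv_sqrt ennreal_mult[symmetric] inv_sqrt_mean_nonneg)
  also have "(\<Prod>r<(16::nat). ennreal (1 / sqrt (sqrt (V a a)) * inv_sqrt_mean)) = ennreal (inv_sqrt_mean ^ 16 / (V a a) ^ 4)"
  proof -
    have "sqrt (sqrt (V a a)) ^ 16 = (((sqrt (sqrt (V a a)))\<^sup>2)\<^sup>2) ^ 4" by (simp flip: power_mult)
    also have "\<dots> = (V a a) ^ 4" using q by simp
    finally have "(1 / sqrt (sqrt (V a a)) * inv_sqrt_mean) ^ 16 = inv_sqrt_mean ^ 16 / (V a a) ^ 4"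
      by (simp add: power_mult_distrib power_divide)
    moreover have "0 \<le> inv_sqrt_mean" by (simp add: inv_sqrt_mean_def)
    ultimately show ?thesis using q by (simp add: ennreal_power del: power_mult_distrib)
  qed
  also have "ennreal (real n ^ 4) * \<dots> = ennreal (real n ^ 4 * inv_sqrt_mean ^ 16 / (V a a) ^ 4)"
    using q by (simp add: inv_sqrt_mean_def flip: ennreal_mult)
  finally show ?thesis .
qed

end

section \<open>The nodewise Lasso for a fixed data matrix\<close>

definition unit :: "nat \<Rightarrow> nat \<Rightarrow> real" where
  "unit l = (\<lambda>m. if m = l then 1 else 0)"

definition l1 :: "nat \<Rightarrow> (nat \<Rightarrow> real) \<Rightarrow> real" where
  "l1 p a = (\<Sum>l<p. \<bar>a l\<bar>)"

definition l2sq :: "nat \<Rightarrow> (nat \<Rightarrow> real) \<Rightarrow> real" where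
  "l2sq p a = (\<Sum>l<p. (a l)\<^sup>2)"

lemma l1_nonneg: "0 \<le> l1 p a" and l2sq_nonneg: "0 \<le> l2sq p a"
  by (simp_all add: l1_def l2sq_def sum_nonneg)

text \<open>Subgradient condition in one coordinate: a small step e against the sign of
  \<open>g\<close> gains 2 |g| e to first order and pays the penalty 2 lam e.\<close>

lemma quadratic_abs_nonneg_imp:
  assumes "\<And>t::real. 0 \<le> 2 * t * g + t\<^sup>2 * c + 2 * lam * \<bar>t\<bar>"
  shows "\<bar>g\<bar> \<le> lam"
proof (rule ccontr)
  assume "\<not> \<bar>g\<bar> \<le> lam"
  define d where "d = \<bar>g\<bar> - lam"
  have d: "d > 0" using \<open>\<not> \<bar>g\<bar> \<le> lam\<close> by (simp add: d_def)
  define e where "e = d / (\<bar>c\<bar> + 1)"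
  have e: "e > 0" using d by (simp add: e_def add_nonneg_pos)
  have "e * c \<le> e * \<bar>c\<bar>" using e by (simp add: mult_left_mono)
  also have "\<dots> < e * (\<bar>c\<bar> + 1)" using e by simp
  also have "\<dots> = d" by (simp add: e_def)
  finally have ec: "e * c < d" .
  have "0 \<le> 2 * (- sgn g * e) * g + (- sgn g * e)\<^sup>2 * c + 2 * lam * \<bar>- sgn g * e\<bar>" by (rule assms)
  also have "\<dots> \<le> - 2 * e * \<bar>g\<bar> + e * (e * c) + 2 * lam * e"
  proof (cases "g = 0")
    case True
    then have "lam < 0" using d by (simp add: d_def)
    have "0 \<le> 2 * e * 0 + e\<^sup>2 * c + 2 * lam * \<bar>e\<bar>" using assms[of e] True by simp
    then show ?thesis using True e by (simp add: power2_eq_square mult_ac)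
  next
    case False
    then show ?thesis using e
      by (cases "g > 0") (auto simp: power2_eq_square abs_mult)
  qed
  also have "\<dots> = e * (e * c - 2 * d)" by (simp add: d_def algebra_simps)
  also have "\<dots> < 0" using e ec d by (intro mult_pos_neg) auto
  finally show False by simp
qed

lemma ip_scale: "ip p (\<lambda>k. c * a k) x = c * ip p a x"
  by (simp add: ip_def sum_distrib_left mult.assoc)

lemma ip_expand: "ip p a x = (\<Sum>l<p. a l * ip p (unit l) x)"
proof -
  have "ip p (unit l) x = x l" if "l < p" for l
    using that by (simp add: ip_def unit_def if_distrib[of "\<lambda>c. c * _"] cong: if_cong)
  then show ?thesis by (simp add: ip_def)
qed

lemma cov_sym: "cov n p X a b = cov n p X b a"
  by (simp add: cov_def mult.commute)

lemma cov_add_left: "cov n p X (\<lambda>k. a k + b k) c = cov n p X a c + cov n p X b c"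
  and cov_diff_left: "cov n p X (\<lambda>k. a k - b k) c = cov n p X a c - cov n p X b c"
  and cov_scale_left: "cov n p X (\<lambda>k. t * a k) c = t * cov n p X a c"
  by (simp_all add: cov_def ip_add ip_diff ip_scale distrib_right left_diff_distrib sum.distrib sum_subtractf
      add_divide_distrib diff_divide_distrib sum_distrib_left mult.assoc)

lemma cov_add_right: "cov n p X c (\<lambda>k. a k + b k) = cov n p X c a + cov n p X c b"
  and cov_diff_right: "cov n p X c (\<lambda>k. a k - b k) = cov n p X c a - cov n p X c b"
  and cov_scale_right: "cov n p X c (\<lambda>k. t * a k) = t * cov n p X c a"
  by (simp_all add: cov_sym[of n p X c] cov_add_left cov_diff_left cov_scale_left)

lemma cov_expand: "cov n p X a b = (\<Sum>l<p. a l * cov n p X (unit l) b)"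
proof -
  have "(\<Sum>r<n. ip p a (X r) * ip p b (X r)) = (\<Sum>r<n. \<Sum>l<p. a l * (ip p (unit l) (X r) * ip p b (X r)))"
    by (subst ip_expand[of p a]) (simp add: sum_distrib_right mult.assoc)
  also have "\<dots> = (\<Sum>l<p. a l * (\<Sum>r<n. ip p (unit l) (X r) * ip p b (X r)))"
    by (subst sum.swap) (simp add: sum_distrib_left)
  finally show ?thesis unfolding cov_def times_divide_eq_right sum_divide_distrib[symmetric] by simp
qed

lemma bf_expand: "bf p A a b = (\<Sum>l<p. a l * bf p A (unit l) b)"
proof -
  have "bf p A (unit l) b = (\<Sum>m<p. A $$ (l,m) * b m)" if "l < p" for l
  proof -
    have "bf p A (unit l) b = (\<Sum>k<p. if k = l then (\<Sum>m<p. A $$ (l,m) * b m) else 0)"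
      unfolding bf_def by (intro sum.cong refl) (simp add: unit_def)
    then show ?thesis using that by simp
  qed
  then show ?thesis by (simp add: bf_def sum_distrib_left mult.assoc)
qed

lemma cov_abs_le: "\<bar>cov n p X a b\<bar> \<le> (cov n p X a a + cov n p X b b) / 2"
  using cov_nonneg[of n p X "\<lambda>k. a k + b k"] cov_nonneg[of n p X "\<lambda>k. a k - b k"] cov_sym[of n p X a b]
  by (simp add: cov_add_left cov_add_right cov_diff_left cov_diff_right)

text \<open>
  \<open>b\<close> is the vector \<open>(-\<gamma>\<^sub>1, \<dots>, 1, \<dots>, -\<gamma>\<^sub>p)\<close> with \<open>1\<close> at position \<open>k\<close>, so that the residual sum of squares
  is the quadratic form of the sample covariance matrix at \<open>b\<close>.
\<close>

definition l1_off :: "nat \<Rightarrow> nat \<Rightarrow> (nat \<Rightarrow> real) \<Rightarrow> real" where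
  "l1_off p k b = (\<Sum>l\<in>{..<p} - {k}. \<bar>b l\<bar>)"

locale lasso =
  fixes n p :: nat and X :: "nat \<Rightarrow> nat \<Rightarrow> real" and k :: nat and lam :: real and b :: "nat \<Rightarrow> real"
  assumes k: "k < p" and bk: "b k = 1" and lam: "0 \<le> lam"
    and minimal: "\<And>b'. b' k = 1 \<Longrightarrow>
      cov n p X b b + 2 * lam * l1_off p k b \<le> cov n p X b' b' + 2 * lam * l1_off p k b'"
begin

abbreviation "S \<equiv> cov n p X"

text \<open>This is the squared normalisation of the nodewise Lasso, not its square root.\<close>

definition tau :: real where "tau = S b b + lam * l1_off p k b"

lemma l1_off_nonneg: "0 \<le> l1_off p k b'"
  by (simp add: l1_off_def sum_nonneg)

lemma S_le_tau: "S b b \<le> tau" and lam_l1_le_tau: "lam * l1_off p k b \<le> tau" and tau_nonneg: "0 \<le> tau"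
  using cov_nonneg[of n p X b] lam l1_off_nonneg[of b] by (simp_all add: tau_def)

lemma S_perturb: "S (\<lambda>l. b l + t * w l) (\<lambda>l. b l + t * w l) = S b b + 2 * t * S w b + t\<^sup>2 * S w w"
  using cov_sym[of n p X w b]
  by (simp add: cov_add_left cov_add_right cov_scale_left cov_scale_right power2_eq_square algebra_simps)

lemma KKT_off:
  assumes "l < p" "l \<noteq> k"
  shows "\<bar>S (unit l) b\<bar> \<le> lam"
proof (rule quadratic_abs_nonneg_imp)
  fix t :: real
  have "l1_off p k (\<lambda>m. b m + t * unit l m) \<le> (\<Sum>m\<in>{..<p} - {k}. \<bar>b m\<bar> + (if m = l then \<bar>t\<bar> else 0))"
    unfolding l1_off_def by (intro sum_mono) (auto simp: unit_def)
  also have "\<dots> = l1_off p k b + \<bar>t\<bar>"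
    using assms by (simp add: sum.distrib l1_off_def)
  finally have "2 * lam * l1_off p k (\<lambda>m. b m + t * unit l m) \<le> 2 * lam * (l1_off p k b + \<bar>t\<bar>)"
    using lam by (intro mult_left_mono) auto
  moreover have "S b b + 2 * lam * l1_off p k b \<le> S (\<lambda>m. b m + t * unit l m) (\<lambda>m. b m + t * unit l m) + 2 * lam * l1_off p k (\<lambda>m. b m + t * unit l m)"
    using assms by (intro minimal) (simp add: bk unit_def)
  ultimately show "0 \<le> 2 * t * S (unit l) b + t\<^sup>2 * S (unit l) (unit l) + 2 * lam * \<bar>t\<bar>"
    unfolding S_perturb by (simp add: algebra_simps)
qed

definition w :: "nat \<Rightarrow> real" where "w l = (if l = k then 0 else b l)"

text \<open>Rescaling all coefficients by 1 + t keeps their signs, so the penalty is linear in t and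
  the derivative of the objective at t = 0 vanishes.\<close>

lemma KKT_w: "S w b = - lam * l1_off p k b"
proof -
  have "2 * (S w b + lam * l1_off p k b) = 0"
  proof (rule quadratic_nonneg_imp_linear_zero)
    fix t :: real assume t: "\<bar>t\<bar> < 1"
    have "l1_off p k (\<lambda>m. b m + t * w m) = (\<Sum>m\<in>{..<p} - {k}. (1 + t) * \<bar>b m\<bar>)"
      unfolding l1_off_def
    proof (intro sum.cong refl)
      fix m assume "m \<in> {..<p} - {k}"
      then have "b m + t * w m = (1 + t) * b m" by (simp add: w_def algebra_simps)
      then show "\<bar>b m + t * w m\<bar> = (1 + t) * \<bar>b m\<bar>" using t by (simp add: abs_mult)
    qed
    then have "l1_off p k (\<lambda>m. b m + t * w m) = (1 + t) * l1_off p k b"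
      by (simp add: l1_off_def sum_distrib_left)
    moreover have "S b b + 2 * lam * l1_off p k b \<le> S (\<lambda>m. b m + t * w m) (\<lambda>m. b m + t * w m) + 2 * lam * l1_off p k (\<lambda>m. b m + t * w m)"
      by (intro minimal) (simp add: bk w_def)
    ultimately show "0 \<le> t * (2 * (S w b + lam * l1_off p k b)) + t\<^sup>2 * S w w"
      unfolding S_perturb by (simp add: algebra_simps)
  qed
  then show ?thesis by simp
qed

lemma b_split: "b = (\<lambda>l. unit k l + w l)"
  by (auto simp: unit_def w_def bk)

text \<open>This identity explains the form of the normalisation: splitting b as unit k plus
  \<open>w\<close> adds exactly the penalty term to the residual sum of squares.\<close>

lemma KKT_k: "S (unit k) b = tau"
proof -
  have "S b b = S (\<lambda>l. unit k l + w l) b" using b_split by simp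
  then show ?thesis using KKT_w by (simp add: cov_add_left tau_def)
qed

text \<open>All optimality conditions in dual form: the sample covariance maps b to
  \<open>tau\<close> times the k-th unit vector up to an entrywise error lam, here tested against a
  vector in the l1 norm.\<close>

lemma S_b_deviation:
  "\<bar>S a b - a k * tau\<bar> \<le> lam * l1 p a"
proof -
  have "S a b = a k * S (unit k) b + (\<Sum>l\<in>{..<p} - {k}. a l * S (unit l) b)"
    using k by (subst cov_expand) (simp add: sum.remove)
  then have "\<bar>S a b - a k * tau\<bar> = \<bar>\<Sum>l\<in>{..<p} - {k}. a l * S (unit l) b\<bar>"
    by (simp add: KKT_k)
  also have "\<dots> \<le> (\<Sum>l\<in>{..<p} - {k}. \<bar>a l\<bar> * lam)"
    by (rule order_trans[OF sum_abs]) (auto intro!: sum_mono mult_left_mono KKT_off simp: abs_mult)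
  also have "\<dots> \<le> (\<Sum>l<p. \<bar>a l\<bar> * lam)"
    using lam by (intro sum_mono2) auto
  finally show ?thesis by (simp add: l1_def sum_distrib_left mult.commute)
qed

text \<open>A crude bound through the trace of the sample covariance. It holds for every data matrix
  and serves outside the event of concentration.\<close>

lemma S_w_le: "S w w \<le> (\<Sum>l<p. S (unit l) (unit l)) * (l1_off p k b)\<^sup>2"
proof -
  define M where "M = (\<Sum>l<p. S (unit l) (unit l))"
  have M: "S (unit l) (unit l) \<le> M" if "l < p" for l
    unfolding M_def using that by (intro member_le_sum) (auto simp: cov_nonneg)
  have lw: "l1 p w = l1_off p k b"
  proof -
    have "l1 p w = \<bar>w k\<bar> + (\<Sum>l\<in>{..<p} - {k}. \<bar>w l\<bar>)"
      unfolding l1_def using k by (simp add: sum.remove)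
    then show ?thesis by (simp add: w_def l1_off_def)
  qed
  have "S w w = (\<Sum>l<p. \<Sum>m<p. w l * (w m * S (unit m) (unit l)))"
    by (subst cov_expand, subst cov_sym, subst cov_expand) (simp add: sum_distrib_left)
  also have "\<dots> \<le> (\<Sum>l<p. \<Sum>m<p. \<bar>w l\<bar> * (\<bar>w m\<bar> * M))"
  proof (intro sum_mono)
    fix l m assume "l \<in> {..<p}" "m \<in> {..<p}"
    then have "\<bar>S (unit m) (unit l)\<bar> \<le> M"
      using cov_abs_le[of n p X "unit m" "unit l"] M[of l] M[of m] by simp
    then have "\<bar>w l * (w m * S (unit m) (unit l))\<bar> \<le> \<bar>w l\<bar> * (\<bar>w m\<bar> * M)"
      by (simp add: abs_mult mult_left_mono)
    then show "w l * (w m * S (unit m) (unit l)) \<le> \<bar>w l\<bar> * (\<bar>w m\<bar> * M)" by linarith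
  qed
  also have "\<dots> = M * (l1 p w)\<^sup>2"
    by (simp add: l1_def power2_eq_square sum_product sum_distrib_left mult_ac)
  finally show ?thesis by (simp add: lw M_def)
qed

lemma inverse_tau_le:
  assumes lam0: "lam = 0 \<Longrightarrow> p = 1" and Q: "S (unit k) (unit k) > 0"
  defines "M \<equiv> (\<Sum>l<p. S (unit l) (unit l))"
  shows "0 < tau"
    and "1 / tau\<^sup>2 \<le> 16 / (S (unit k) (unit k))\<^sup>2 + 4 * M / (lam\<^sup>2 * S (unit k) (unit k))"
    and "l < p \<Longrightarrow> \<bar>b l\<bar> / tau \<le> 1 / lam + 1 / tau"
proof -
  define q where "q = S (unit k) (unit k)"
  define L where "L = l1_off p k b"
  have q: "q > 0" using Q by (simp add: q_def)
  have L: "0 \<le> L" "lam * L \<le> tau" "lam = 0 \<Longrightarrow> L = 0"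
    using lam0 k lam_l1_le_tau by (auto simp: L_def l1_off_def sum_nonneg lessThan_Suc)
  have M0: "0 \<le> M" unfolding M_def by (intro sum_nonneg) (simp add: cov_nonneg)
  have "unit k = (\<lambda>l. b l - w l)" by (auto simp: unit_def w_def bk)
  then have "q = S b b - 2 * S b w + S w w"
    using cov_sym[of n p X w b] by (simp add: q_def cov_diff_left cov_diff_right)
  also have "\<dots> \<le> 2 * S b b + 2 * S w w" using abs_le_D2[OF cov_abs_le[of n p X b w]] by simp
  also have "\<dots> \<le> 2 * tau + 2 * (M * L\<^sup>2)"
    using S_le_tau S_w_le by (simp add: M_def L_def)
  also have "M * L\<^sup>2 \<le> M * (tau\<^sup>2 / lam\<^sup>2)"
  proof (intro mult_left_mono M0)
    show "L\<^sup>2 \<le> tau\<^sup>2 / lam\<^sup>2"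
    \<comment> \<open>For a zero penalty the quotient is 0 by convention, and L is 0 as an empty
      sum.\<close>
    proof (cases "lam = 0")
      case False
      then have "0 < lam" using lam by simp
      have "(lam * L)\<^sup>2 \<le> tau\<^sup>2" using L lam by (intro power_mono) auto
      then show ?thesis using \<open>0 < lam\<close> by (simp add: power_mult_distrib field_simps)
    qed (use L in simp)
  qed
  finally have main: "q \<le> 2 * tau + 2 * (M * (tau\<^sup>2 / lam\<^sup>2))" by simp
  show tau0: "0 < tau" using main q tau_nonneg by (cases "tau = 0") auto
  show "1 / tau\<^sup>2 \<le> 16 / (S (unit k) (unit k))\<^sup>2 + 4 * M / (lam\<^sup>2 * S (unit k) (unit k))"
    unfolding q_def[symmetric]
  proof (cases "q \<le> 4 * tau")
    case True
    then have "q\<^sup>2 \<le> (4 * tau)\<^sup>2" using q by (intro power_mono) auto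
    then have "1 / tau\<^sup>2 \<le> 16 / q\<^sup>2" using q tau0 by (simp add: field_simps power_mult_distrib)
    moreover have "0 \<le> 4 * M / (lam\<^sup>2 * q)" using M0 q by simp
    ultimately show "1 / tau\<^sup>2 \<le> 16 / q\<^sup>2 + 4 * M / (lam\<^sup>2 * q)" by linarith
  next
    case False
    then have qm: "q \<le> 4 * (M * (tau\<^sup>2 / lam\<^sup>2))" using main by linarith
    then have "lam \<noteq> 0" using q by auto
    then have "1 / tau\<^sup>2 \<le> 4 * M / (lam\<^sup>2 * q)" using qm q tau0 by (simp add: field_simps)
    moreover have "0 \<le> 16 / q\<^sup>2" by simp
    ultimately show "1 / tau\<^sup>2 \<le> 16 / q\<^sup>2 + 4 * M / (lam\<^sup>2 * q)" by linarith
  qed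
  show "\<bar>b l\<bar> / tau \<le> 1 / lam + 1 / tau" if "l < p"
  proof (cases "l = k")
    case True then show ?thesis using lam by (simp add: bk)
  next
    case False
    then have "p \<noteq> 1" using that k by auto
    then have "lam > 0" using lam0 lam by force
    have "\<bar>b l\<bar> \<le> L" unfolding L_def l1_off_def using that False by (intro member_le_sum) auto
    then have "lam * \<bar>b l\<bar> \<le> tau" using L(2) lam mult_left_mono[of "\<bar>b l\<bar>" L lam] by linarith
    then have "\<bar>b l\<bar> / tau \<le> 1 / lam" using \<open>lam > 0\<close> tau0 by (simp add: field_simps)
    then show ?thesis using tau0 by (simp add: add_increasing2)
  qed
qed

end

section \<open>Estimation error of the nodewise Lasso\<close>

lemma l1_square_le:
  assumes "finite I" "real (card I) \<le> s"
  shows "(\<Sum>l\<in>I. \<bar>v l\<bar>)\<^sup>2 \<le> s * (\<Sum>l\<in>I. (v l)\<^sup>2)"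
proof -
  have "(\<Sum>l\<in>I. \<bar>v l\<bar>)\<^sup>2 \<le> (\<Sum>l\<in>I. \<bar>v l\<bar>\<^sup>2) * real (card I)"
    by (rule sum_squared_le_sum_of_squares)
  also have "\<dots> = (\<Sum>l\<in>I. (v l)\<^sup>2) * real (card I)" by simp
  also have "\<dots> \<le> (\<Sum>l\<in>I. (v l)\<^sup>2) * s" using assms by (intro mult_left_mono) (simp_all add: sum_nonneg)
  finally show ?thesis by (simp add: mult.commute)
qed

text \<open>The two eigenvalue conditions of the parameter class, expressed through the quadratic
  form of the precision matrix.\<close>

locale prec_matrix = pd_matrix +
  fixes C2 C3 :: real
  assumes C2: "0 < C2" and C3: "0 < C3"
    and lower: "\<And>a. l2sq p a \<le> C2 * bf p A a a" and upper: "\<And>a. bf p A a a \<le> C3 * l2sq p a"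
begin

lemma bf_A_nonneg: "0 \<le> bf p A a a"
proof -
  have "0 \<le> C2 * bf p A a a" using lower[of a] l2sq_nonneg[of p a] by linarith
  then show ?thesis using C2 by (simp add: zero_le_mult_iff)
qed

text \<open>An upper bound on \<open>A\<close> is a lower bound on its inverse: expand the
  nonnegative form of \<open>A\<close> at z - a / C3, where A z = a. The next lemma does the same
  with the squared Euclidean norm of z - C2 a.\<close>

lemma V_lower: "l2sq p a \<le> C3 * V a a"
proof -
  have "0 \<le> bf p A (\<lambda>k. sol a k - (1/C3) * a k) (\<lambda>k. sol a k - (1/C3) * a k)"
    by (rule bf_A_nonneg)
  also have "\<dots> = V a a - 2 / C3 * l2sq p a + 1 / C3\<^sup>2 * bf p A a a"
  proof -
    have 1: "bf p A x (\<lambda>k. (1/C3) * y k) = (1/C3) * bf p A x y" for x y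
      unfolding bf_def sum_distrib_left by (intro sum.cong refl) simp
    have 2: "bf p A (\<lambda>k. (1/C3) * x k) y = (1/C3) * bf p A x y" for x y
      unfolding bf_def sum_distrib_left by (intro sum.cong refl) simp
    have "bf p A a (sol a) = l2sq p a"
      unfolding bf_A_sol by (simp add: ip_def l2sq_def power2_eq_square)
    then show ?thesis
      using bf_A_sym[of "sol a" a]
      by (simp only: bf_diff_left bf_diff_right 1 2 bf_minv_eq) (simp add: power2_eq_square)
  qed
  also have "\<dots> \<le> V a a - 2 / C3 * l2sq p a + 1 / C3\<^sup>2 * (C3 * l2sq p a)"
    using upper[of a] by (intro add_left_mono mult_left_mono) auto
  also have "\<dots> = V a a - l2sq p a / C3" using C3 by (simp add: power2_eq_square field_simps)
  finally show ?thesis using C3 by (simp add: field_simps)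
qed

lemma V_upper: "V a a \<le> C2 * l2sq p a"
proof -
  have "0 \<le> l2sq p (\<lambda>k. sol a k - C2 * a k)" by (rule l2sq_nonneg)
  also have "\<dots> = l2sq p (sol a) - 2 * C2 * ip p a (sol a) + C2\<^sup>2 * l2sq p a"
    by (simp add: l2sq_def ip_def power2_diff sum.distrib sum_subtractf sum_distrib_left power_mult_distrib mult_ac)
  also have "\<dots> \<le> C2 * V a a - 2 * C2 * V a a + C2\<^sup>2 * l2sq p a"
    using lower[of "sol a"] by (simp add: bf_minv_eq[symmetric] bf_minv)
  also have "\<dots> = C2 * (C2 * l2sq p a - V a a)" by (simp add: power2_eq_square algebra_simps)
  finally show ?thesis using C2 by (simp add: zero_le_mult_iff)
qed

lemma V_cauchy: "(V a b)\<^sup>2 \<le> V a a * V b b"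
proof -
  have q: "0 \<le> V a a + 2 * t * V a b + t\<^sup>2 * V b b" for t
  proof -
    have 1: "V x (\<lambda>k. t * y k) = t * V x y" for x y
      unfolding bf_def sum_distrib_left by (intro sum.cong refl) simp
    have 2: "V (\<lambda>k. t * x k) y = t * V x y" for x y
      unfolding bf_def sum_distrib_left by (intro sum.cong refl) simp
    have "0 \<le> V (\<lambda>k. a k + t * b k) (\<lambda>k. a k + t * b k)" by (rule bf_minv_nonneg)
    then show ?thesis using bf_minv_sym[of b a]
      by (simp add: bf_add_left bf_add_right 1 2 power2_eq_square algebra_simps)
  qed
  show ?thesis
  proof (cases "V b b = 0")
    case True
    have "V a b = 0"
    proof (rule ccontr)
      assume "V a b \<noteq> 0"
      then have "2 * (- (V a a + 1) / (2 * V a b)) * V a b = - (V a a + 1)" by (simp add: field_simps)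
      then show False using q[of "- (V a a + 1) / (2 * V a b)"] True by simp
    qed
    then show ?thesis using True by simp
  next
    case False
    then have "0 < V b b" using bf_minv_nonneg[of b] by simp
    then show ?thesis using q[of "- V a b / V b b"] by (simp add: power2_eq_square field_simps)
  qed
qed

abbreviation "acol k \<equiv> (\<lambda>l. A $$ (l, k))"

lemma V_acol: "k < p \<Longrightarrow> V (acol k) b = b k"
  by (rule bf_minv_col)

lemma l2sq_unit: "k < p \<Longrightarrow> l2sq p (unit k) = 1"
  by (simp add: l2sq_def unit_def if_distrib[of "\<lambda>c. c\<^sup>2"] cong: if_cong)

lemma diag_bounds:
  assumes "k < p"
  shows "1 / C2 \<le> A $$ (k,k)" "A $$ (k,k) \<le> C3" "0 < A $$ (k,k)"
proof -
  have "bf p A (unit k) (unit k) = A $$ (k,k)"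
  proof -
    have "bf p A (unit k) (unit k) = (\<Sum>i<p. if i = k then (\<Sum>l<p. if l = k then A $$ (k,k) else 0) else 0)"
      unfolding bf_def
    proof (intro sum.cong refl)
      fix i
      have "(\<Sum>l<p. A $$ (k,l) * unit k l) = (\<Sum>l<p. if l = k then A $$ (k,k) else 0)"
        by (intro sum.cong refl) (simp add: unit_def)
      then show "(\<Sum>l<p. unit k i * A $$ (i,l) * unit k l) = (if i = k then (\<Sum>l<p. if l = k then A $$ (k,k) else 0) else 0)"
        by (cases "i = k") (simp_all add: unit_def[of k])
    qed
    then show ?thesis using assms by simp
  qed
  then show 1: "1 / C2 \<le> A $$ (k,k)" and "A $$ (k,k) \<le> C3"
    using lower[of "unit k"] upper[of "unit k"] C2 by (simp_all add: l2sq_unit assms field_simps)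
  show "0 < A $$ (k,k)" using less_le_trans[OF _ 1] C2 by simp
qed

end

text \<open>
  The noise level \<open>W\<close> and the deviation \<open>D\<close> describe the data; \<open>L\<close> dominates noise and penalty, and
  \<open>s\<close> dominates the number of active coordinates.  The disjunction allows a penalty that does not
  dominate the noise when \<open>p \<le> s\<close>; then every coordinate is treated as active.
\<close>

locale lasso_error = lasso n p X k lam b + prec_matrix p A C2 C3
  for n p X k lam b A C2 C3 +
  fixes W D L s :: real
  assumes noise: "\<And>l. l < p \<Longrightarrow> \<bar>S (unit l) (acol k) - (if l = k then 1 else 0)\<bar> \<le> W"
    and dev: "\<And>l m. l < p \<Longrightarrow> m < p \<Longrightarrow> \<bar>S (unit l) (unit m) - V (unit l) (unit m)\<bar> \<le> D"
    and WL: "W \<le> L" "C2 * W \<le> L" and lamL: "lam \<le> L" and s1: "1 \<le> s"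
    and sparse: "real (card {l. l < p \<and> A $$ (l,k) \<noteq> 0}) \<le> s"
    and regime: "real p \<le> s \<or> (0 < lam \<and> 2 * C2 * W \<le> lam)"
    and D_small: "32 * C3 * D * s \<le> 1"
begin

definition theta where "theta = A $$ (k,k)"
text \<open>Column k of the precision matrix divided by its diagonal entry is the population
  counterpart of \<open>b\<close>: off the diagonal it holds the negated regression coefficients of
  variable k. The counterpart of \<open>tau\<close> is \<open>1 / theta\<close>.\<close>

definition beta where "beta l = A $$ (l,k) / theta"
definition v where "v l = b l - beta l"

lemma theta: "0 < theta" "1 / C2 \<le> theta" "theta \<le> C3"
  using diag_bounds[OF k] by (simp_all add: theta_def)

lemma beta_k: "beta k = 1" and v_k: "v k = 0"
  using theta by (simp_all add: beta_def v_def bk theta_def)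

lemma W_nonneg: "0 \<le> W" and D_nonneg: "0 \<le> D"
  using noise[OF k] dev[OF k k] by linarith+

lemma L_nonneg: "0 \<le> L" using lam lamL by linarith

lemma W_theta: "W / theta \<le> C2 * W"
proof -
  have "1 / theta \<le> C2" using theta C2 by (simp add: field_simps)
  then show ?thesis using mult_right_mono[of "1 / theta" C2 W] W_nonneg by simp
qed

lemma S_beta: "l < p \<Longrightarrow> \<bar>S (unit l) beta - (if l = k then 1 / theta else 0)\<bar> \<le> C2 * W"
proof -
  assume l: "l < p"
  have "beta = (\<lambda>l. (1 / theta) * acol k l)" by (auto simp: beta_def)
  then have "S (unit l) beta = S (unit l) (acol k) / theta" by (simp only: cov_scale_right) simp
  then have "S (unit l) beta - (if l = k then 1 / theta else 0) = (S (unit l) (acol k) - (if l = k then 1 else 0)) / theta"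
    by (simp add: diff_divide_distrib)
  also have "\<bar>\<dots>\<bar> = \<bar>S (unit l) (acol k) - (if l = k then 1 else 0)\<bar> / theta"
    using theta by simp
  also have "\<dots> \<le> W / theta" using noise[OF l] theta by (intro divide_right_mono) auto
  finally show ?thesis using W_theta by linarith
qed

lemma l1_v: "l1 p v = (\<Sum>l\<in>{..<p} - {k}. \<bar>v l\<bar>)"
  unfolding l1_def using k by (simp add: sum.remove v_k)

text \<open>Optimality of \<open>b\<close> against \<open>beta\<close>. The cross term involves only
  coordinates other than k, because \<open>v k = 0\<close>, and there the sample covariance of
  \<open>beta\<close> is pure noise.\<close>

lemma basic_inequality: "S v v \<le> 2 * (C2 * W) * l1 p v + 2 * lam * (l1_off p k beta - l1_off p k b)"
proof -
  have b: "b = (\<lambda>l. beta l + v l)" by (auto simp: v_def)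
  have "S b b = S beta beta + 2 * S v beta + S v v"
    using cov_sym[of n p X beta v] by (subst (1 2) b) (simp add: cov_add_left cov_add_right)
  moreover have "S b b + 2 * lam * l1_off p k b \<le> S beta beta + 2 * lam * l1_off p k beta"
    by (intro minimal beta_k)
  moreover have "\<bar>S v beta\<bar> \<le> C2 * W * l1 p v"
  proof -
    have "S v beta = (\<Sum>l\<in>{..<p} - {k}. v l * S (unit l) beta)"
      using k by (subst cov_expand) (simp add: sum.remove v_k)
    also have "\<bar>\<dots>\<bar> \<le> (\<Sum>l\<in>{..<p} - {k}. \<bar>v l\<bar> * (C2 * W))"
    proof (rule order_trans[OF sum_abs], intro sum_mono)
      fix l assume "l \<in> {..<p} - {k}"
      then show "\<bar>v l * S (unit l) beta\<bar> \<le> \<bar>v l\<bar> * (C2 * W)"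
        using S_beta[of l] by (auto simp: abs_mult intro: mult_left_mono)
    qed
    finally show ?thesis by (simp add: l1_v sum_distrib_left mult_ac)
  qed
  ultimately show ?thesis by (simp add: right_diff_distrib abs_le_iff)
qed

lemma l1_off_diff: "l1_off p k beta - l1_off p k b \<le> l1 p v"
proof -
  have "l1_off p k beta \<le> (\<Sum>l\<in>{..<p} - {k}. \<bar>b l\<bar> + \<bar>v l\<bar>)"
    unfolding l1_off_def by (intro sum_mono) (simp add: v_def)
  then show ?thesis by (simp add: sum.distrib l1_off_def l1_v)
qed

text \<open>For p at most s all coordinates are active and the noise need not be dominated by the
  penalty. Otherwise the penalty is at least twice the noise, which leaves at most three times as
  much l1 mass off the support as on it; the factor 4 is 1 + 3.\<close>

lemma active_set:
  obtains I where "I \<subseteq> {..<p}" "real (card I) \<le> s" "l1 p v \<le> 4 * (\<Sum>l\<in>I. \<bar>v l\<bar>)"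
    "S v v \<le> 4 * L * (\<Sum>l\<in>I. \<bar>v l\<bar>)"
proof (cases "real p \<le> s")
  case True
  have l1: "0 \<le> l1 p v" by (rule l1_nonneg)
  have "S v v \<le> 2 * (C2 * W) * l1 p v + 2 * lam * l1 p v"
    using basic_inequality mult_left_mono[OF l1_off_diff, of "2 * lam"] lam by linarith
  also have "\<dots> \<le> 2 * L * l1 p v + 2 * L * l1 p v"
    using WL lamL l1 by (intro add_mono mult_right_mono) auto
  finally have "S v v \<le> 4 * L * l1 p v" by simp
  then show ?thesis using that[of "{..<p}"] True l1 by (simp add: l1_def)
next
  case False
  then have r: "0 < lam" "2 * C2 * W \<le> lam" using regime by auto
  define I where "I = {l \<in> {..<p} - {k}. A $$ (l,k) \<noteq> 0}"
  define J where "J = {l \<in> {..<p} - {k}. A $$ (l,k) = 0}"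
  have IJ: "{..<p} - {k} = I \<union> J" "I \<inter> J = {}" "finite I" "finite J" by (auto simp: I_def J_def)
  have v1: "l1 p v = (\<Sum>l\<in>I. \<bar>v l\<bar>) + (\<Sum>l\<in>J. \<bar>v l\<bar>)"
    unfolding l1_v IJ(1) by (rule sum.union_disjoint) (use IJ in auto)
  have J: "b l = v l" "beta l = 0" if "l \<in> J" for l using that by (auto simp: J_def v_def beta_def)
  have "l1_off p k beta - l1_off p k b = (\<Sum>l\<in>I. \<bar>beta l\<bar> - \<bar>b l\<bar>) - (\<Sum>l\<in>J. \<bar>v l\<bar>)"
    unfolding l1_off_def IJ(1) using IJ J by (simp add: sum.union_disjoint sum_subtractf)
  also have "\<dots> \<le> (\<Sum>l\<in>I. \<bar>v l\<bar>) - (\<Sum>l\<in>J. \<bar>v l\<bar>)"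
    by (intro diff_right_mono sum_mono) (auto simp: v_def)
  finally have d: "l1_off p k beta - l1_off p k b \<le> (\<Sum>l\<in>I. \<bar>v l\<bar>) - (\<Sum>l\<in>J. \<bar>v l\<bar>)" .
  have "S v v \<le> lam * l1 p v + 2 * lam * ((\<Sum>l\<in>I. \<bar>v l\<bar>) - (\<Sum>l\<in>J. \<bar>v l\<bar>))"
  proof -
    have "2 * lam * (l1_off p k beta - l1_off p k b) \<le> 2 * lam * ((\<Sum>l\<in>I. \<bar>v l\<bar>) - (\<Sum>l\<in>J. \<bar>v l\<bar>))"
      using d r by (intro mult_left_mono) auto
    moreover have "2 * (C2 * W) * l1 p v \<le> lam * l1 p v"
      using r l1_nonneg by (intro mult_right_mono) auto
    ultimately show ?thesis using basic_inequality by linarith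
  qed
  then have S: "S v v \<le> lam * (3 * (\<Sum>l\<in>I. \<bar>v l\<bar>) - (\<Sum>l\<in>J. \<bar>v l\<bar>))"
    by (simp add: v1 algebra_simps)
  have I0: "0 \<le> (\<Sum>l\<in>I. \<bar>v l\<bar>)" "0 \<le> (\<Sum>l\<in>J. \<bar>v l\<bar>)" by (simp_all add: sum_nonneg)
  have "0 \<le> lam * (3 * (\<Sum>l\<in>I. \<bar>v l\<bar>) - (\<Sum>l\<in>J. \<bar>v l\<bar>))" using S cov_nonneg[of n p X v] by linarith
  then have cone: "(\<Sum>l\<in>J. \<bar>v l\<bar>) \<le> 3 * (\<Sum>l\<in>I. \<bar>v l\<bar>)" using r by (simp add: zero_le_mult_iff)
  have "S v v \<le> lam * (3 * (\<Sum>l\<in>I. \<bar>v l\<bar>))"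
    using S I0 r mult_left_mono[of "3 * (\<Sum>l\<in>I. \<bar>v l\<bar>) - (\<Sum>l\<in>J. \<bar>v l\<bar>)" "3 * (\<Sum>l\<in>I. \<bar>v l\<bar>)" lam] by linarith
  also have "\<dots> \<le> L * (4 * (\<Sum>l\<in>I. \<bar>v l\<bar>))"
    using I0 lamL r L_nonneg by (intro mult_mono) auto
  finally have "S v v \<le> 4 * L * (\<Sum>l\<in>I. \<bar>v l\<bar>)" by simp
  moreover have "real (card I) \<le> s"
  proof -
    have "card I \<le> card {l. l < p \<and> A $$ (l,k) \<noteq> 0}" by (intro card_mono) (auto simp: I_def)
    then show ?thesis using sparse by linarith
  qed
  moreover have "I \<subseteq> {..<p}" by (auto simp: I_def)
  ultimately show ?thesis using that[of I] cone v1 by simp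
qed

lemma V_S_deviation: "\<bar>S a c - V a c\<bar> \<le> D * l1 p a * l1 p c"
proof -
  have "S a c - V a c = (\<Sum>l<p. \<Sum>m<p. a l * (c m * (S (unit m) (unit l) - V (unit m) (unit l))))"
  proof -
    have "S a c = (\<Sum>l<p. \<Sum>m<p. a l * (c m * S (unit m) (unit l)))"
      by (subst cov_expand, subst cov_sym, subst cov_expand) (simp add: sum_distrib_left)
    moreover have "V a c = (\<Sum>l<p. \<Sum>m<p. a l * (c m * V (unit m) (unit l)))"
      by (subst bf_expand, subst bf_minv_sym, subst bf_expand) (simp add: sum_distrib_left)
    ultimately show ?thesis by (simp add: right_diff_distrib sum_subtractf)
  qed
  also have "\<bar>\<dots>\<bar> \<le> (\<Sum>l<p. \<Sum>m<p. \<bar>a l\<bar> * (\<bar>c m\<bar> * D))"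
  proof (intro order_trans[OF sum_abs] sum_mono)
    fix l m assume "l \<in> {..<p}" "m \<in> {..<p}"
    then show "\<bar>a l * (c m * (S (unit m) (unit l) - V (unit m) (unit l)))\<bar> \<le> \<bar>a l\<bar> * (\<bar>c m\<bar> * D)"
      using dev[of m l] by (auto simp: abs_mult intro!: mult_left_mono)
  qed
  also have "\<dots> = D * l1 p a * l1 p c"
    by (simp add: l1_def sum_product sum_distrib_left mult_ac)
  finally show ?thesis .
qed

text \<open>Let y be the squared norm of the error and x its l1 norm on the active set, so x^2 is at
  most s y. The population form controls y, and replacing it by the sample form costs at most 16 D s
  y, of which \<open>D_small\<close> leaves at most y / 2 to be absorbed. What remains, y at most 8
  C3 L x, is solved with x^2 at most s y.\<close>

lemma error_bounds:
  shows "l2sq p v \<le> 64 * C3\<^sup>2 * L\<^sup>2 * s" and "l1 p v \<le> 32 * C3 * L * s"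
proof -
  obtain I where I: "I \<subseteq> {..<p}" "real (card I) \<le> s" "l1 p v \<le> 4 * (\<Sum>l\<in>I. \<bar>v l\<bar>)"
    "S v v \<le> 4 * L * (\<Sum>l\<in>I. \<bar>v l\<bar>)" by (rule active_set)
  define x where "x = (\<Sum>l\<in>I. \<bar>v l\<bar>)"
  define y where "y = l2sq p v"
  have x0: "0 \<le> x" by (simp add: x_def sum_nonneg)
  have y0: "0 \<le> y" by (simp add: y_def l2sq_nonneg)
  have "x\<^sup>2 \<le> s * (\<Sum>l\<in>I. (v l)\<^sup>2)"
    unfolding x_def using I finite_subset[OF I(1)] by (intro l1_square_le) auto
  also have "(\<Sum>l\<in>I. (v l)\<^sup>2) \<le> y"
    unfolding y_def l2sq_def using I(1) by (intro sum_mono2) auto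
  finally have xy: "x\<^sup>2 \<le> s * y" using s1 by simp
  have "(l1 p v)\<^sup>2 \<le> (4 * x)\<^sup>2" using I(3) l1_nonneg by (intro power_mono) (auto simp: x_def)
  then have l1x: "(l1 p v)\<^sup>2 \<le> 16 * x\<^sup>2" by (simp add: power_mult_distrib)
  have "y \<le> C3 * V v v" unfolding y_def by (rule V_lower)
  also have "V v v \<le> S v v + D * (l1 p v)\<^sup>2"
    using abs_le_D2[OF V_S_deviation[of v v]] by (simp add: power2_eq_square mult_ac)
  also have "\<dots> \<le> 4 * L * x + D * (16 * (s * y))"
    using I(4) l1x xy D_nonneg by (intro add_mono mult_left_mono) (auto simp: x_def)
  finally have "y \<le> C3 * (4 * L * x) + (32 * C3 * D * s) * y / 2"
    using C3 by (simp add: algebra_simps)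
  also have "(32 * C3 * D * s) * y / 2 \<le> 1 * y / 2"
    using D_small y0 by (intro divide_right_mono mult_right_mono) auto
  finally have "y \<le> 8 * C3 * L * x" by (simp add: algebra_simps)
  then have "y\<^sup>2 \<le> (8 * C3 * L * x)\<^sup>2" using y0 by (intro power_mono)
  also have "\<dots> = 64 * C3\<^sup>2 * L\<^sup>2 * x\<^sup>2" by (simp add: power_mult_distrib)
  also have "\<dots> \<le> 64 * C3\<^sup>2 * L\<^sup>2 * (s * y)" using xy by (intro mult_left_mono) auto
  finally have "y * y \<le> (64 * C3\<^sup>2 * L\<^sup>2 * s) * y" by (simp add: power2_eq_square mult_ac)
  then have y: "y \<le> 64 * C3\<^sup>2 * L\<^sup>2 * s"
    using y0 s1 by (cases "y = 0") auto
  then show "l2sq p v \<le> 64 * C3\<^sup>2 * L\<^sup>2 * s" by (simp add: y_def)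
  have "(l1 p v)\<^sup>2 \<le> 16 * (s * y)" using l1x xy by linarith
  also have "\<dots> \<le> 16 * (s * (64 * C3\<^sup>2 * L\<^sup>2 * s))" using y s1 by (intro mult_left_mono) auto
  also have "\<dots> = (32 * C3 * L * s)\<^sup>2" by (simp add: power_mult_distrib power2_eq_square)
  finally show "l1 p v \<le> 32 * C3 * L * s"
    using C3 L_nonneg s1 by (intro power2_le_imp_le[of "l1 p v"]) auto
qed

definition c1 :: real where "c1 = 2 + 8 * C2 * C3"

lemma c1_pos: "0 < c1" using C2 C3 by (simp add: c1_def add_pos_pos)

text \<open>By \<open>KKT_k\<close>, tau is S(unit k, b). Noise and deviation contribute L each; the
  population covariance with the error, bounded by Cauchy-Schwarz, contributes the term of order L
  sqrt s. These are the 2 and the 8 C2 C3 in \<open>c1\<close>.\<close>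

lemma tau_deviation: "\<bar>tau - 1 / theta\<bar> \<le> c1 * L * sqrt s"
proof -
  have b: "b = (\<lambda>l. beta l + v l)" by (auto simp: v_def)
  have "tau = S (unit k) beta + S (unit k) v"
    using cov_add_right[of n p X "unit k" beta v] b KKT_k by simp
  then have "tau - 1 / theta = (S (unit k) beta - 1 / theta) + (S (unit k) v - V (unit k) v) + V (unit k) v"
    by simp
  moreover have "\<bar>S (unit k) beta - 1 / theta\<bar> \<le> L"
    using S_beta[OF k] WL by simp
  moreover have "\<bar>S (unit k) v - V (unit k) v\<bar> \<le> L"
  proof -
    have "l1 p (unit k) = 1" using k by (simp add: l1_def unit_def if_distrib[of abs] cong: if_cong)
    then have "\<bar>S (unit k) v - V (unit k) v\<bar> \<le> D * l1 p v" using V_S_deviation[of "unit k" v] by simp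
    also have "\<dots> \<le> D * (32 * C3 * L * s)" using error_bounds(2) D_nonneg by (intro mult_left_mono)
    also have "\<dots> = (32 * C3 * D * s) * L" by simp
    also have "\<dots> \<le> 1 * L" using D_small L_nonneg by (intro mult_right_mono)
    finally show ?thesis by simp
  qed
  moreover have "\<bar>V (unit k) v\<bar> \<le> 8 * C2 * C3 * L * sqrt s"
  proof -
    have "(V (unit k) v)\<^sup>2 \<le> V (unit k) (unit k) * V v v" by (rule V_cauchy)
    also have "\<dots> \<le> C2 * (C2 * l2sq p v)"
      using V_upper[of "unit k"] V_upper[of v] l2sq_unit[OF k] C2 bf_minv_nonneg by (intro mult_mono) auto
    also have "\<dots> \<le> C2 * (C2 * (64 * C3\<^sup>2 * L\<^sup>2 * s))"
      using error_bounds(1) C2 by (intro mult_left_mono) auto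
    also have "\<dots> = (8 * C2 * C3 * L * sqrt s)\<^sup>2"
    proof -
      have "(sqrt s)\<^sup>2 = s" using s1 by simp
      then show ?thesis by (simp only: power_mult_distrib) (simp add: power2_eq_square)
    qed
    finally have "\<bar>V (unit k) v\<bar> \<le> \<bar>8 * C2 * C3 * L * sqrt s\<bar>" by (simp only: abs_le_square_iff)
    moreover have "0 \<le> 8 * C2 * C3 * L * sqrt s"
      using C2 C3 L_nonneg s1 by (intro mult_nonneg_nonneg) auto
    ultimately show ?thesis by simp
  qed
  moreover have "L \<le> L * sqrt s" using L_nonneg s1 mult_left_mono[of 1 "sqrt s" L] by simp
  moreover have "c1 * L * sqrt s = L * sqrt s + L * sqrt s + 8 * C2 * C3 * L * sqrt s"
    by (simp add: c1_def algebra_simps)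
  ultimately show ?thesis by linarith
qed

definition c2 :: real where "c2 = 64 * C3\<^sup>2 + sqrt (C2 * C3) * (2 * C3\<^sup>2 * c1)"

text \<open>The error splits as v / tau + beta (1 / tau - theta). The smallness assumption keeps tau
  above 1 / (2 C3). The l1 norm of \<open>beta\<close> and the error of tau carry one factor sqrt s
  each, so both terms are of order L s.\<close>

lemma normalized_error:
  assumes small: "2 * C3 * (c1 * L * sqrt s) \<le> 1"
  shows "1 / tau \<le> 2 * C3" and "0 < tau" and "l1 p (\<lambda>l. b l / tau - A $$ (l,k)) \<le> c2 * L * s"
proof -
  define e where "e = c1 * L * sqrt s"
  have e: "e \<le> 1 / (2 * C3)" using small C3 by (simp add: e_def field_simps)
  have "1 / C3 \<le> 1 / theta" using theta C3 by (simp add: field_simps)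
  moreover have "1 / C3 - 1 / (2 * C3) = 1 / (2 * C3)" using C3 by (simp add: field_simps)
  ultimately have t: "1 / (2 * C3) \<le> tau" using tau_deviation e unfolding e_def by linarith
  moreover have "0 < 1 / (2 * C3)" using C3 by simp
  ultimately show tau0: "0 < tau" by linarith
  then show t1: "1 / tau \<le> 2 * C3" using t C3 by (simp add: divide_le_eq mult.commute)
  have "l1 p (\<lambda>l. b l / tau - A $$ (l,k)) \<le> (\<Sum>l<p. \<bar>v l\<bar> * (1 / tau) + \<bar>beta l\<bar> * \<bar>1 / tau - theta\<bar>)"
    unfolding l1_def
  proof (intro sum_mono)
    fix l
    have "beta l * theta = A $$ (l,k)" using theta by (simp add: beta_def)
    then have "b l / tau - A $$ (l,k) = v l * (1 / tau) + beta l * (1 / tau - theta)"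
      by (simp add: v_def right_diff_distrib diff_divide_distrib)
    then show "\<bar>b l / tau - A $$ (l,k)\<bar> \<le> \<bar>v l\<bar> * (1 / tau) + \<bar>beta l\<bar> * \<bar>1 / tau - theta\<bar>"
      using tau0 abs_triangle_ineq[of "v l * (1 / tau)" "beta l * (1 / tau - theta)"]
      by (simp add: abs_mult)
  qed
  also have "\<dots> = l1 p v * (1 / tau) + l1 p beta * \<bar>1 / tau - theta\<bar>"
    by (simp only: l1_def sum.distrib sum_distrib_right)
  also have "\<dots> \<le> (32 * C3 * L * s) * (2 * C3) + (sqrt (C2 * C3) * sqrt s) * (2 * C3\<^sup>2 * e)"
  proof (intro add_mono mult_mono)
    show "l1 p beta \<le> sqrt (C2 * C3) * sqrt s"
    proof -
      define J where "J = {l. l < p \<and> A $$ (l,k) \<noteq> 0}"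
      have J: "finite J" "J \<subseteq> {..<p}" by (auto simp: J_def)
      have "l1 p beta = (\<Sum>l\<in>J. \<bar>beta l\<bar>)"
        unfolding l1_def by (rule sum.mono_neutral_right) (auto simp: J_def beta_def)
      then have "(l1 p beta)\<^sup>2 \<le> s * (\<Sum>l\<in>J. (beta l)\<^sup>2)"
        using J sparse by (simp add: J_def[symmetric] l1_square_le)
      also have "\<dots> \<le> s * l2sq p beta"
        unfolding l2sq_def using J s1 by (intro mult_left_mono sum_mono2) auto
      also have "l2sq p beta = l2sq p (acol k) / theta\<^sup>2"
        by (simp add: l2sq_def beta_def power_divide sum_divide_distrib)
      also have "\<dots> \<le> C3 * theta / theta\<^sup>2"
        using V_lower[of "acol k"] V_acol[OF k, of "acol k"] by (intro divide_right_mono) (auto simp: theta_def)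
      also have "\<dots> \<le> C2 * C3"
        using theta C2 C3 by (simp add: power2_eq_square field_simps)
      finally have "(l1 p beta)\<^sup>2 \<le> s * (C2 * C3)" using s1 by simp
      then have "l1 p beta \<le> sqrt (s * (C2 * C3))" by (rule real_le_rsqrt)
      then show ?thesis by (simp add: real_sqrt_mult mult_ac)
    qed
    have "\<bar>1 / tau - theta\<bar> = \<bar>tau - 1 / theta\<bar> * (theta * (1 / tau))"
    proof -
      have "(tau - z) * (theta * y) = theta * (tau * y) - (theta * z) * y" for y z
        by (simp add: algebra_simps)
      from this[of "1 / theta" "1 / tau"] have "1 / tau - theta = - ((tau - 1 / theta) * (theta * (1 / tau)))"
        using tau0 theta by simp
      then show ?thesis using tau0 theta by (simp add: abs_mult)
    qed
    also have "\<dots> \<le> e * (C3 * (2 * C3))"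
      using tau_deviation t1 theta tau0 C3 c1_pos L_nonneg s1 unfolding e_def by (intro mult_mono) auto
    finally show "\<bar>1 / tau - theta\<bar> \<le> 2 * C3\<^sup>2 * e" by (simp add: power2_eq_square mult_ac)
  qed (use error_bounds t1 C2 C3 L_nonneg s1 l1_nonneg tau0 in auto)
  also have "\<dots> = c2 * L * s"
  proof -
    have ss: "sqrt s * sqrt s = s" using s1 by simp
    have eq: "(32 * C3 * L * s) * (2 * C3) + (q * r) * (2 * C3\<^sup>2 * (c1 * L * r)) =
        (64 * C3\<^sup>2) * L * s + q * (2 * C3\<^sup>2 * c1) * L * (r * r)" for q r
      by (simp add: power2_eq_square)
    show ?thesis by (simp only: c2_def e_def distrib_right eq ss)
  qed
  finally show "l1 p (\<lambda>l. b l / tau - A $$ (l,k)) \<le> c2 * L * s" .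
qed

end

section \<open>The de-sparsified estimator\<close>

definition coeff_vec :: "nat \<Rightarrow> (nat \<Rightarrow> real) \<Rightarrow> nat \<Rightarrow> real" where
  "coeff_vec k \<gamma> l = (if l = k then 1 else - \<gamma> l)"

lemma resid_sq_cov:
  assumes "k < p"
  shows "resid_sq n p k X \<gamma> = cov n p X (coeff_vec k \<gamma>) (coeff_vec k \<gamma>)"
proof -
  have "ip p (coeff_vec k \<gamma>) x = x k - (\<Sum>l\<in>{..<p} - {k}. x l * \<gamma> l)" for x
  proof -
    have "ip p (coeff_vec k \<gamma>) x = coeff_vec k \<gamma> k * x k + (\<Sum>l\<in>{..<p} - {k}. coeff_vec k \<gamma> l * x l)"
      unfolding ip_def using assms by (simp add: sum.remove)
    also have "(\<Sum>l\<in>{..<p} - {k}. coeff_vec k \<gamma> l * x l) = (\<Sum>l\<in>{..<p} - {k}. - (x l * \<gamma> l))"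
      by (intro sum.cong) (auto simp: coeff_vec_def)
    moreover have "coeff_vec k \<gamma> k = 1" by (simp add: coeff_vec_def)
    ultimately show ?thesis by (simp add: sum_negf)
  qed
  then show ?thesis by (simp add: resid_sq_def cov_def power2_eq_square)
qed

lemma l1_norm_off: "l1_norm p k \<gamma> = l1_off p k (coeff_vec k \<gamma>)"
  unfolding l1_norm_def l1_off_def by (intro sum.cong) (auto simp: coeff_vec_def)

lemma nodewise_lasso_lasso:
  assumes "nodewise_lasso n p k lam \<gamma>hat" "k < p" "0 \<le> lam" "X \<in> space (data_space n p)"
  shows "lasso n p X k lam (coeff_vec k (\<gamma>hat X))"
proof
  fix b' :: "nat \<Rightarrow> real" assume b': "b' k = 1"
  \<comment> \<open>Elements of \<open>coeff_space\<close> are extensional functions, so the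
    competitor is restricted first; residuals and penalty see only the coordinates kept.\<close>
  define \<gamma>' where "\<gamma>' = restrict (\<lambda>l. - b' l) ({..<p} - {k})"
  have "\<gamma>' \<in> space (coeff_space p k)" by (simp add: \<gamma>'_def coeff_space_def space_PiM)
  then have le: "resid_sq n p k X (\<gamma>hat X) + 2 * lam * l1_norm p k (\<gamma>hat X) \<le> resid_sq n p k X \<gamma>' + 2 * lam * l1_norm p k \<gamma>'"
    using assms(1,4) by (auto simp: nodewise_lasso_def is_arg_min_def not_less)
  have c: "coeff_vec k \<gamma>' l = b' l" if "l < p" for l
    using that b' by (simp add: coeff_vec_def \<gamma>'_def)
  then have "l1_norm p k \<gamma>' = l1_off p k b'"
    unfolding l1_norm_off l1_off_def by (intro sum.cong) auto
  moreover have "ip p (coeff_vec k \<gamma>') x = ip p b' x" for x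
    unfolding ip_def by (intro sum.cong) (auto simp: c)
  then have "resid_sq n p k X \<gamma>' = cov n p X b' b'"
    using assms(2) by (simp add: resid_sq_cov cov_def)
  ultimately show "cov n p X (coeff_vec k (\<gamma>hat X)) (coeff_vec k (\<gamma>hat X)) + 2 * lam * l1_off p k (coeff_vec k (\<gamma>hat X))
      \<le> cov n p X b' b' + 2 * lam * l1_off p k b'"
    using le assms(2) by (simp add: resid_sq_cov l1_norm_off)
qed (use assms in \<open>simp_all add: coeff_vec_def\<close>)

lemma tau_sq_cov:
  "lasso n p X k lam (coeff_vec k \<gamma>) \<Longrightarrow> tau_sq n p k lam X \<gamma> = lasso.tau n p X k lam (coeff_vec k \<gamma>)"
  by (simp add: tau_sq_def lasso.tau_def lasso.k resid_sq_cov l1_norm_off)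

lemma sample_cov_form:
  "vec p a \<bullet> (sample_cov n p X *\<^sub>v vec p b) = cov n p X a b"
proof -
  have "vec p a \<bullet> (sample_cov n p X *\<^sub>v vec p b) =
     (\<Sum>l<p. a l * (\<Sum>m<p. (\<Sum>r<n. X r l * X r m) / real n * b m))"
    by (simp add: sample_cov_def Let_def scalar_prod_def atLeast0LessThan)
  also have "\<dots> = (\<Sum>l<p. \<Sum>m<p. \<Sum>r<n. (a l * X r l) * (b m * X r m) / real n)"
    by (simp add: sum_distrib_left sum_distrib_right sum_divide_distrib mult_ac)
  also have "\<dots> = (\<Sum>r<n. \<Sum>l<p. \<Sum>m<p. (a l * X r l) * (b m * X r m) / real n)"
    by (subst sum.swap[of _ "{..<n}"], subst sum.swap[of _ "{..<n}" "{..<p}"]) (rule refl)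
  also have "\<dots> = cov n p X a b"
    by (simp add: cov_def ip_def sum_product sum_divide_distrib)
  finally show ?thesis .
qed

definition despars :: "nat \<Rightarrow> nat \<Rightarrow> (nat \<Rightarrow> nat \<Rightarrow> real) \<Rightarrow> nat \<Rightarrow> nat \<Rightarrow> (nat \<Rightarrow> real) \<Rightarrow> (nat \<Rightarrow> real) \<Rightarrow> real \<Rightarrow> real \<Rightarrow> real" where
  "despars n p X i j a b ta tb = b i / tb + a j / ta - cov n p X a b / (ta * tb)"

lemma desparsified_despars:
  assumes "i < p" "j < p"
  shows "desparsified n p i j lam \<gamma>hat X =
    despars n p X i j (coeff_vec i (\<gamma>hat i X)) (coeff_vec j (\<gamma>hat j X))
      (tau_sq n p i (lam i) X (\<gamma>hat i X)) (tau_sq n p j (lam j) X (\<gamma>hat j X))"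
proof -
  let ?ti = "tau_sq n p i (lam i) X (\<gamma>hat i X)" and ?tj = "tau_sq n p j (lam j) X (\<gamma>hat j X)"
  have th: "theta_hat_col n p k (lam k) X (\<gamma>hat k X) = vec p (\<lambda>l. (1 / tau_sq n p k (lam k) X (\<gamma>hat k X)) * coeff_vec k (\<gamma>hat k X) l)" for k
    by (simp add: theta_hat_col_def coeff_vec_def)
  show ?thesis
    unfolding desparsified_def Let_def th sample_cov_form cov_scale_left cov_scale_right despars_def
    using assms by simp
qed

text \<open>No concentration enters: the entries come from \<open>inverse_tau_le\<close>, and the
  quadratic term is at most (ta + tb) / (2 ta tb), because both residual forms are bounded by their
  normalisations.\<close>

lemma despars_crude:
  assumes i: "lasso n p X i li a" and j: "lasso n p X j lj b"
    and li: "li = 0 \<Longrightarrow> p = 1" and lj: "lj = 0 \<Longrightarrow> p = 1"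
    and Qi: "cov n p X (unit i) (unit i) > 0" and Qj: "cov n p X (unit j) (unit j) > 0"
  defines "ta \<equiv> lasso.tau n p X i li a" and "tb \<equiv> lasso.tau n p X j lj b"
  shows "\<bar>despars n p X i j a b ta tb\<bar> \<le> 1 / li + 1 / lj + 2 / ta + 2 / tb"
proof -
  interpret I: lasso n p X i li a by fact
  interpret J: lasso n p X j lj b by fact
  note I = I.inverse_tau_le[OF li Qi, folded ta_def]
  note J = J.inverse_tau_le[OF lj Qj, folded tb_def]
  have t: "0 < ta" "0 < tb" using I(1) J(1) by blast+
  have 1: "\<bar>b i / tb\<bar> \<le> 1 / lj + 1 / tb" using J(3)[of i] I.k t by simp
  have 2: "\<bar>a j / ta\<bar> \<le> 1 / li + 1 / ta" using I(3)[of j] J.k t by simp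
  have "\<bar>cov n p X a b\<bar> \<le> (ta + tb) / 2"
    unfolding ta_def tb_def
    by (rule order_trans[OF cov_abs_le]) (use I.S_le_tau J.S_le_tau in simp)
  then have "\<bar>cov n p X a b / (ta * tb)\<bar> \<le> ((ta + tb) / 2) / (ta * tb)"
  proof -
    have "\<bar>ta * tb\<bar> = ta * tb" "0 \<le> ta * tb" using t by simp_all
    then show ?thesis unfolding abs_divide
      using \<open>\<bar>cov n p X a b\<bar> \<le> (ta + tb) / 2\<close> by (simp only: divide_right_mono)
  qed
  also have "\<dots> = (1 / ta + 1 / tb) / 2" using t by (simp add: field_simps)
  also have "\<dots> \<le> 1 / ta + 1 / tb" proof -
    have "(u + v) / 2 \<le> u + v" if "0 \<le> u" "0 \<le> v" for u v :: real using that by simp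
    then show ?thesis using t by (simp only: zero_le_divide_1_iff less_imp_le)
  qed
  finally have 3: "\<bar>cov n p X a b / (ta * tb)\<bar> \<le> 1 / ta + 1 / tb" .
  show ?thesis unfolding despars_def using 1 2 3 by linarith
qed

text \<open>With da and db the errors of the two estimated columns, the remainder is exactly minus
  the sum of S(da, b) / tb - da_j and S(\<theta>_i, db) - db_i, where \<theta>_i is column i of A.
  The optimality conditions of problem j bound the first and the noise bounds the second, each by an
  entrywise error of order L times an l1 error of order L s. So the first-order effects of both
  estimation errors cancel.\<close>

lemma despars_remainder:
  assumes I: "lasso_error n p X i li a A C2 C3 W D L s" and J: "lasso_error n p X j lj b A C2 C3 W D L s"
    and small: "2 * C3 * ((2 + 8 * C2 * C3) * L * sqrt s) \<le> 1"
  defines "ta \<equiv> lasso.tau n p X i li a" and "tb \<equiv> lasso.tau n p X j lj b"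
  shows "\<bar>despars n p X i j a b ta tb - (2 * A $$ (i,j) - cov n p X (\<lambda>l. A $$ (l,i)) (\<lambda>l. A $$ (l,j)))\<bar>
    \<le> (64 * C3\<^sup>2 + sqrt (C2 * C3) * (2 * C3\<^sup>2 * (2 + 8 * C2 * C3))) * (2 * C3 + 1) * s * L\<^sup>2"
proof -
  interpret I: lasso_error n p X i li a A C2 C3 W D L s by fact
  interpret J: lasso_error n p X j lj b A C2 C3 W D L s by fact
  define c2 where "c2 = 64 * C3\<^sup>2 + sqrt (C2 * C3) * (2 * C3\<^sup>2 * (2 + 8 * C2 * C3))"
  have c2: "J.c2 = c2" "I.c2 = c2" by (simp_all add: J.c2_def I.c2_def J.c1_def I.c1_def c2_def)
  note nI = I.normalized_error[unfolded I.c1_def, OF small, folded ta_def, unfolded c2]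
  note nJ = J.normalized_error[unfolded J.c1_def, OF small, folded tb_def, unfolded c2]
  have t: "0 < ta" "0 < tb" using nI nJ by blast+
  let ?al = "\<lambda>l. A $$ (l,i)" and ?be = "\<lambda>l. A $$ (l,j)"
  define da where "da l = a l / ta - A $$ (l,i)" for l
  define db where "db l = b l / tb - A $$ (l,j)" for l
  have l1: "l1 p da \<le> c2 * L * s" "l1 p db \<le> c2 * L * s"
    using nI(3) nJ(3) by (simp_all add: da_def[abs_def] db_def[abs_def])
  have sc: "cov n p X da b / tb + cov n p X ?al db = cov n p X a b / (ta * tb) - cov n p X ?al ?be"
  proof -
    have "cov n p X da b = cov n p X a b / ta - cov n p X ?al b"
      using cov_diff_left[of n p X "\<lambda>l. (1 / ta) * a l" ?al b]
      by (simp add: da_def[abs_def] cov_scale_left[of n p X "1 / ta", simplified])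
    moreover have "cov n p X ?al db = cov n p X ?al b / tb - cov n p X ?al ?be"
      using cov_diff_right[of n p X ?al "\<lambda>l. (1 / tb) * b l" ?be]
      by (simp add: db_def[abs_def] cov_scale_right[of n p X _ "1 / tb", simplified])
    ultimately show ?thesis by (simp add: diff_divide_distrib)
  qed
  have "A $$ (j,i) = A $$ (i,j)" using I.sym[OF J.k I.k] by simp
  then have eq: "despars n p X i j a b ta tb - (2 * A $$ (i,j) - cov n p X ?al ?be)
     = - (cov n p X da b / tb - da j) - (cov n p X ?al db - db i)"
    using sc by (simp add: despars_def da_def db_def)
  have r1: "\<bar>cov n p X da b / tb - da j\<bar> \<le> c2 * (2 * C3) * s * L\<^sup>2"
  proof -
    have "cov n p X da b / tb - da j = (cov n p X da b - da j * tb) * (1 / tb)"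
      using t by (simp add: field_simps)
    also have "\<bar>\<dots>\<bar> = \<bar>cov n p X da b - da j * tb\<bar> * (1 / tb)" using t by (simp add: abs_mult)
    also have "\<dots> \<le> (lj * l1 p da) * (2 * C3)"
      using J.S_b_deviation[of da] nJ(1) t unfolding tb_def[symmetric] by (intro mult_mono) auto
    also have "\<dots> \<le> (L * (c2 * L * s)) * (2 * C3)"
      using J.lamL J.lam l1 l1_nonneg I.C3 J.L_nonneg by (intro mult_right_mono mult_mono) auto
    finally show ?thesis by (simp add: power2_eq_square mult_ac)
  qed
  have r2: "\<bar>cov n p X ?al db - db i\<bar> \<le> c2 * s * L\<^sup>2"
  proof -
    have "db i = (\<Sum>l<p. db l * (if l = i then 1 else 0))"
      using I.k by (simp add: if_distrib[of "\<lambda>c. _ * c"] cong: if_cong)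
    moreover have "cov n p X ?al db = (\<Sum>l<p. db l * cov n p X (unit l) ?al)"
      by (subst cov_sym, subst cov_expand) (rule refl)
    ultimately have "cov n p X ?al db - db i = (\<Sum>l<p. db l * (cov n p X (unit l) ?al - (if l = i then 1 else 0)))"
      by (simp only: right_diff_distrib sum_subtractf)
    also have "\<bar>\<dots>\<bar> \<le> (\<Sum>l<p. \<bar>db l\<bar> * W)"
    proof (intro order_trans[OF sum_abs] sum_mono)
      fix l assume "l \<in> {..<p}"
      then show "\<bar>db l * (cov n p X (unit l) ?al - (if l = i then 1 else 0))\<bar> \<le> \<bar>db l\<bar> * W"
        using I.noise[of l] unfolding abs_mult by (intro mult_left_mono) auto
    qed
    also have "\<dots> = l1 p db * W" by (simp add: l1_def sum_distrib_right)
    also have "\<dots> \<le> (c2 * L * s) * L"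
      using l1 l1_nonneg I.W_nonneg I.WL J.L_nonneg order_trans[OF l1_nonneg l1(2)] by (intro mult_mono) auto
    finally show ?thesis by (simp add: power2_eq_square mult_ac)
  qed
  have "c2 * (2 * C3) * s * L\<^sup>2 + c2 * s * L\<^sup>2 = c2 * (2 * C3 + 1) * s * L\<^sup>2"
    by (simp add: distrib_left distrib_right)
  then show ?thesis unfolding eq c2_def[symmetric] using r1 r2 by linarith
qed

section \<open>Moments of the de-sparsified estimator\<close>

text \<open>Measurability and nonnegativity travel with the bound on the expectation, so that bounds
  can be added, scaled and compared without a separate integrability argument each time.\<close>

definition mean_le :: "'a measure \<Rightarrow> ('a \<Rightarrow> real) \<Rightarrow> real \<Rightarrow> bool" where
  "mean_le M g c \<longleftrightarrow> g \<in> borel_measurable M \<and> (\<forall>x. 0 \<le> g x) \<and> 0 \<le> c \<and> (\<integral>\<^sup>+x. ennreal (g x) \<partial>M) \<le> ennreal c"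

lemma mean_le_add: "mean_le M f a \<Longrightarrow> mean_le M g b \<Longrightarrow> mean_le M (\<lambda>x. f x + g x) (a + b)"
  unfolding mean_le_def
  by (auto simp: ennreal_plus nn_integral_add intro!: add_mono simp del: ennreal_plus[symmetric])

lemma mean_le_scale:
  assumes "mean_le M f a" "0 \<le> k"
  shows "mean_le M (\<lambda>x. k * f x) (k * a)"
proof -
  have [measurable]: "f \<in> borel_measurable M" and f: "\<And>x. 0 \<le> f x" "0 \<le> a" "(\<integral>\<^sup>+x. ennreal (f x) \<partial>M) \<le> ennreal a"
    using assms by (auto simp: mean_le_def)
  have "(\<integral>\<^sup>+x. ennreal (k * f x) \<partial>M) = ennreal k * (\<integral>\<^sup>+x. ennreal (f x) \<partial>M)"
    using assms(2) f by (simp add: ennreal_mult nn_integral_cmult)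
  also have "\<dots> \<le> ennreal k * ennreal a" using f by (intro mult_left_mono) auto
  finally show ?thesis using assms f by (simp add: mean_le_def ennreal_mult)
qed

lemma mean_le_const: "prob_space M \<Longrightarrow> 0 \<le> k \<Longrightarrow> mean_le M (\<lambda>_. k) k"
  by (simp add: mean_le_def prob_space.emeasure_space_1)

lemma mean_le_sum:
  assumes "\<And>l. l < p \<Longrightarrow> mean_le M (f l) (c l)"
  shows "mean_le M (\<lambda>x. \<Sum>l<(p::nat). f l x) (\<Sum>l<p. c l)"
  using assms
proof (induction p)
  case 0 then show ?case by (simp add: mean_le_def)
next
  case (Suc p) then show ?case by (auto intro: mean_le_add)
qed

lemma mean_le_mono: "mean_le M f a \<Longrightarrow> a \<le> b \<Longrightarrow> mean_le M f b"
  unfolding mean_le_def using ennreal_leI by (auto intro: order_trans)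

lemma mean_le_AE:
  assumes "mean_le M f a" "AE x in M. g x \<le> f x" "g \<in> borel_measurable M" "\<And>x. 0 \<le> g x"
  shows "mean_le M g a"
proof -
  have "(\<integral>\<^sup>+x. ennreal (g x) \<partial>M) \<le> (\<integral>\<^sup>+x. ennreal (f x) \<partial>M)"
    using assms(2) by (intro nn_integral_mono_AE) (auto elim!: eventually_mono intro: ennreal_leI)
  then show ?thesis using assms unfolding mean_le_def by (auto intro: order_trans)
qed

lemma mean_le_integral:
  assumes "mean_le M g c"
  shows "integrable M g" "integral\<^sup>L M g \<le> c" "0 \<le> integral\<^sup>L M g"
proof -
  have g: "g \<in> borel_measurable M" "\<And>x. 0 \<le> g x" "0 \<le> c" "(\<integral>\<^sup>+x. ennreal (g x) \<partial>M) \<le> ennreal c"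
    using assms by (auto simp: mean_le_def)
  then show i: "integrable M g"
    by (intro integrableI_nonneg) (auto simp: order_le_less_trans)
  have "ennreal (integral\<^sup>L M g) = (\<integral>\<^sup>+x. ennreal (g x) \<partial>M)"
    using i g by (intro nn_integral_eq_integral[symmetric]) auto
  then have "ennreal (integral\<^sup>L M g) \<le> ennreal c" using g(4) by simp
  then show "integral\<^sup>L M g \<le> c" by (simp only: ennreal_le_iff[OF g(3)])
  show "0 \<le> integral\<^sup>L M g" using g by (intro integral_nonneg_AE) auto
qed

lemma power4_eq_square: "(x::real) ^ 4 = (x\<^sup>2)\<^sup>2"
  by (simp flip: power_mult)

lemma power4_add_le: "(x + y + z :: real) ^ 4 \<le> 27 * (x ^ 4 + y ^ 4 + z ^ 4)"
proof -
  have sq: "(x + y + z)\<^sup>2 \<le> 3 * (x\<^sup>2 + y\<^sup>2 + z\<^sup>2)" for x y z :: real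
    using zero_le_power2[of "x - y"] zero_le_power2[of "y - z"] zero_le_power2[of "x - z"]
    by (simp add: power2_eq_square algebra_simps)
  have "((x + y + z)\<^sup>2)\<^sup>2 \<le> (3 * (x\<^sup>2 + y\<^sup>2 + z\<^sup>2))\<^sup>2"
    by (rule power_mono[OF sq]) simp
  also have "\<dots> = 9 * (x\<^sup>2 + y\<^sup>2 + z\<^sup>2)\<^sup>2" by (simp only: power_mult_distrib) simp
  finally show ?thesis unfolding power4_eq_square using sq[of "x\<^sup>2" "y\<^sup>2" "z\<^sup>2"] by linarith
qed

text \<open>\<open>R\<close> bounds the contribution of the remainder \<open>T - (2 \<mu> - Y)\<close> in mean square.\<close>

lemma remainder_moments:
  fixes T Y :: "'a \<Rightarrow> real" and mu v R :: real
  assumes "prob_space M" and T[measurable]: "T \<in> borel_measurable M" and Y: "Y \<in> borel_measurable M"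
    "integrable M Y" "integral\<^sup>L M Y = mu"
    "integrable M (\<lambda>x. (Y x - mu)\<^sup>2)" "(\<integral>x. (Y x - mu)\<^sup>2 \<partial>M) = v"
    and R: "mean_le M (\<lambda>x. (T x - (2 * mu - Y x))\<^sup>2) R"
  shows "integrable M (\<lambda>x. (T x)\<^sup>2)" and "integrable M T"
    and "(integral\<^sup>L M T - mu)\<^sup>2 \<le> R"
    and "0 < \<eta> \<Longrightarrow> \<bar>(\<integral>x. (T x - integral\<^sup>L M T)\<^sup>2 \<partial>M) - v\<bar> \<le> \<eta> * v + (1 + 1 / \<eta>) * R"
proof -
  interpret M: prob_space M by fact
  note [measurable] = Y(1)
  define r where "r x = T x - (2 * mu - Y x)" for x
  have [measurable]: "r \<in> borel_measurable M" unfolding r_def[abs_def] by measurable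
  have r2: "integrable M (\<lambda>x. (r x)\<^sup>2)" "(\<integral>x. (r x)\<^sup>2 \<partial>M) \<le> R"
    using mean_le_integral[OF R] by (simp_all add: r_def)
  have r: "integrable M r" by (rule M.square_integrable_imp_integrable) (use r2 in auto)
  have Teq: "T = (\<lambda>x. r x + (2 * mu - Y x))" by (auto simp: r_def)
  show Ti: "integrable M T" using r Y by (subst Teq) auto
  have ET: "integral\<^sup>L M T = mu + integral\<^sup>L M r"
    using r Y by (subst Teq) (simp add: M.prob_space)
  have Er: "(integral\<^sup>L M r)\<^sup>2 \<le> (\<integral>x. (r x)\<^sup>2 \<partial>M)"
    using M.variance_eq[OF r r2(1)] M.variance_positive[of r] by simp
  then show "(integral\<^sup>L M T - mu)\<^sup>2 \<le> R" using ET r2 by simp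
  define y where "y x = mu - Y x" for x
  define d where "d x = r x - integral\<^sup>L M r" for x
  have y2: "integrable M (\<lambda>x. (y x)\<^sup>2)" "(\<integral>x. (y x)\<^sup>2 \<partial>M) = v"
    using Y(4,5) by (simp_all add: y_def power2_commute)
  have [measurable]: "y \<in> borel_measurable M" "d \<in> borel_measurable M"
    unfolding y_def[abs_def] d_def[abs_def] by measurable
  have d2: "integrable M (\<lambda>x. (d x)\<^sup>2)"
    using r r2 by (simp add: d_def power2_diff)
  have Ed2: "(\<integral>x. (d x)\<^sup>2 \<partial>M) \<le> R" and Ed2': "0 \<le> (\<integral>x. (d x)\<^sup>2 \<partial>M)"
    using M.variance_eq[OF r r2(1)] r2(2) M.variance_positive[of r] by (simp_all add: d_def) (smt (verit) zero_le_power2)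
  have yd: "integrable M (\<lambda>x. y x * d x)"
  proof (rule Bochner_Integration.integrable_bound)
    show "integrable M (\<lambda>x. (y x)\<^sup>2 + (d x)\<^sup>2)" using y2 d2 by simp
    show "AE x in M. norm (y x * d x) \<le> norm ((y x)\<^sup>2 + (d x)\<^sup>2)"
    proof (intro AE_I2)
      fix x
      have "2 * \<bar>y x * d x\<bar> \<le> (y x)\<^sup>2 + (d x)\<^sup>2"
        using sum_squares_bound[of "\<bar>y x\<bar>" "\<bar>d x\<bar>"] by (simp add: abs_mult)
      then show "norm (y x * d x) \<le> norm ((y x)\<^sup>2 + (d x)\<^sup>2)" by simp
    qed
  qed simp
  have sq: "(T x - integral\<^sup>L M T)\<^sup>2 = (y x)\<^sup>2 + 2 * (y x * d x) + (d x)\<^sup>2" for x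
  proof -
    have "T x - integral\<^sup>L M T = y x + d x" unfolding ET by (simp add: y_def d_def r_def)
    then show ?thesis by (simp add: power2_sum)
  qed
  have "(\<integral>x. (T x - integral\<^sup>L M T)\<^sup>2 \<partial>M) = v + 2 * (\<integral>x. y x * d x \<partial>M) + (\<integral>x. (d x)\<^sup>2 \<partial>M)"
    unfolding sq using y2 d2 yd by simp
  note var = this
  \<comment> \<open>Weighted arithmetic-geometric inequality. The weight \<eta> stays free: it is
    fixed small later, before n grows, so that the cross term is negligible against v although v
    itself is of order 1 / n.\<close>
  have yd_le: "\<bar>2 * (\<integral>x. y x * d x \<partial>M)\<bar> \<le> \<eta> * v + R / \<eta>" if "0 < \<eta>"
  proof -
    have "\<bar>2 * (\<integral>x. y x * d x \<partial>M)\<bar> = \<bar>\<integral>x. 2 * (y x * d x) \<partial>M\<bar>" by simp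
    also have "\<dots> \<le> (\<integral>x. \<bar>2 * (y x * d x)\<bar> \<partial>M)" by (rule integral_abs_bound)
    also have "\<dots> \<le> (\<integral>x. \<eta> * (y x)\<^sup>2 + (d x)\<^sup>2 / \<eta> \<partial>M)"
    proof (rule integral_mono)
      fix x
      have "2 * (\<bar>sqrt \<eta> * y x\<bar> * \<bar>d x / sqrt \<eta>\<bar>) \<le> \<bar>sqrt \<eta> * y x\<bar>\<^sup>2 + \<bar>d x / sqrt \<eta>\<bar>\<^sup>2"
        using sum_squares_bound[of "\<bar>sqrt \<eta> * y x\<bar>" "\<bar>d x / sqrt \<eta>\<bar>"] by simp
      then show "\<bar>2 * (y x * d x)\<bar> \<le> \<eta> * (y x)\<^sup>2 + (d x)\<^sup>2 / \<eta>"
        using that by (simp add: abs_mult power_mult_distrib power_divide)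
    qed (use yd y2 d2 in auto)
    also have "\<dots> = \<eta> * v + (\<integral>x. (d x)\<^sup>2 \<partial>M) / \<eta>" using y2 d2 by simp
    also have "\<dots> \<le> \<eta> * v + R / \<eta>" using Ed2 that by (intro add_left_mono divide_right_mono) auto
    finally show ?thesis .
  qed
  show "\<bar>(\<integral>x. (T x - integral\<^sup>L M T)\<^sup>2 \<partial>M) - v\<bar> \<le> \<eta> * v + (1 + 1 / \<eta>) * R" if "0 < \<eta>"
  proof -
    have "\<bar>(v + a + b) - v\<bar> \<le> \<eta> * v + (1 + 1 / \<eta>) * R"
      if "\<bar>a\<bar> \<le> \<eta> * v + R / \<eta>" "0 \<le> b" "b \<le> R" for a b
      using that by (simp add: abs_le_iff distrib_right)
    from this[OF yd_le[OF that] Ed2' Ed2] show ?thesis unfolding var .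
  qed
  have "(T x)\<^sup>2 = (y x)\<^sup>2 + 2 * (y x * d x) + (d x)\<^sup>2 + 2 * T x * integral\<^sup>L M T - (integral\<^sup>L M T)\<^sup>2" for x
    using sq[of x] unfolding power2_diff by linarith
  then show "integrable M (\<lambda>x. (T x)\<^sup>2)"
    using y2 d2 yd Ti by simp
qed

text \<open>On the complement \<open>B\<close> of the good event, \<open>2 \<xi>\<^sup>2 \<le> \<delta> \<xi>\<^sup>4 + 1 / \<delta>\<close> trades the fourth moment against the probability.\<close>

lemma mean_le_split:
  assumes "prob_space M" and [measurable]: "\<xi> \<in> borel_measurable M" "B \<in> sets M"
    and fourth: "mean_le M (\<lambda>x. (\<xi> x) ^ 4) F" and B: "emeasure M B \<le> ennreal \<beta>" "0 \<le> \<beta>"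
    and good: "\<And>x. x \<in> space M \<Longrightarrow> x \<notin> B \<Longrightarrow> \<bar>\<xi> x\<bar> \<le> g" and "0 < \<delta>"
  shows "mean_le M (\<lambda>x. (\<xi> x)\<^sup>2) (g\<^sup>2 + (\<delta> * F + 1 / \<delta> * \<beta>))"
proof -
  have "mean_le M (indicator B) \<beta>"
    using B by (simp add: mean_le_def ennreal_indicator)
  then have "mean_le M (\<lambda>x. g\<^sup>2 + (\<delta> * (\<xi> x) ^ 4 + 1 / \<delta> * indicator B x)) (g\<^sup>2 + (\<delta> * F + 1 / \<delta> * \<beta>))"
    using assms by (intro mean_le_add mean_le_scale mean_le_const) auto
  then show ?thesis
  proof (rule mean_le_AE)
    show "AE x in M. (\<xi> x)\<^sup>2 \<le> g\<^sup>2 + (\<delta> * (\<xi> x) ^ 4 + 1 / \<delta> * indicator B x)"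
    proof (rule AE_I2)
      fix x assume x: "x \<in> space M"
      have d: "0 \<le> \<delta> * (\<xi> x) ^ 4" "0 \<le> 1 / \<delta>" using \<open>0 < \<delta>\<close> by auto
      show "(\<xi> x)\<^sup>2 \<le> g\<^sup>2 + (\<delta> * (\<xi> x) ^ 4 + 1 / \<delta> * indicator B x)"
      proof (cases "x \<in> B")
        case False
        then have "(\<xi> x)\<^sup>2 \<le> g\<^sup>2" using power_mono[OF good[OF x False] abs_ge_zero, of 2] by simp
        then show ?thesis using d False by (simp add: add_increasing2)
      next
        case True
        have "z * \<delta> \<le> (\<delta> * z\<^sup>2 + 1 / \<delta>) * \<delta>" if "0 \<le> z" for z
        proof -
          have "(\<delta> * z\<^sup>2 + 1 / \<delta>) * \<delta> = (z * \<delta>)\<^sup>2 + 1"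
            using \<open>0 < \<delta>\<close> by (simp add: power2_eq_square distrib_right)
          moreover have "2 * (z * \<delta>) * 1 \<le> (z * \<delta>)\<^sup>2 + 1\<^sup>2" by (rule sum_squares_bound)
          moreover have "0 \<le> z * \<delta>" using that \<open>0 < \<delta>\<close> by simp
          ultimately show ?thesis by simp
        qed
        from this[OF zero_le_power2[of "\<xi> x"]]
        have "(\<xi> x)\<^sup>2 \<le> \<delta> * (\<xi> x) ^ 4 + 1 / \<delta>"
          unfolding power4_eq_square by (rule mult_right_le_imp_le) (rule \<open>0 < \<delta>\<close>)
        then show ?thesis using True by (simp add: add_increasing)
      qed
    qed
  qed auto
qed

lemma desparsified_measurable:
  assumes l: "nodewise_lasso n p i (lam i) (\<gamma>hat i)" "nodewise_lasso n p j (lam j) (\<gamma>hat j)" and ij: "i < p" "j < p"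
  shows "desparsified n p i j lam \<gamma>hat \<in> borel_measurable (data_space n p)"
proof -
  have X: "(\<lambda>X. X r m) \<in> borel_measurable (data_space n p)" if "r < n" "m < p" for r m
    using that unfolding data_space_def
    by (intro measurable_compose[OF measurable_component_singleton[of r "{..<n}" "\<lambda>_. Pi\<^sub>M {..<p} (\<lambda>_. borel)"]
      measurable_component_singleton[of m "{..<p}" "\<lambda>_. borel"]]) auto
  have c: "(\<lambda>X. coeff_vec k (\<gamma>hat k X) m) \<in> borel_measurable (data_space n p)"
    if "nodewise_lasso n p k (lam k) (\<gamma>hat k)" "m < p" for k m
  proof (cases "m = k")
    case False
    have g: "\<gamma>hat k \<in> measurable (data_space n p) (Pi\<^sub>M ({..<p} - {k}) (\<lambda>_. borel))"
      using that by (simp add: nodewise_lasso_def coeff_space_def)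
    have "(\<lambda>X. \<gamma>hat k X m) \<in> borel_measurable (data_space n p)"
      using measurable_compose[OF g measurable_component_singleton[of m "{..<p} - {k}" "\<lambda>_. borel"]] that False by simp
    then show ?thesis using False by (simp add: coeff_vec_def)
  qed (simp add: coeff_vec_def)
  have ip: "(\<lambda>X. ip p (coeff_vec k (\<gamma>hat k X)) (X r)) \<in> borel_measurable (data_space n p)"
    if k: "nodewise_lasso n p k (lam k) (\<gamma>hat k)" and "r < n" for k r
    unfolding ip_def using X c[OF k] that(2) by (intro borel_measurable_sum borel_measurable_times) auto
  have cv: "(\<lambda>X. cov n p X (coeff_vec k (\<gamma>hat k X)) (coeff_vec k' (\<gamma>hat k' X))) \<in> borel_measurable (data_space n p)"
    if "nodewise_lasso n p k (lam k) (\<gamma>hat k)" "nodewise_lasso n p k' (lam k') (\<gamma>hat k')" for k k'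
    unfolding cov_def using ip[OF that(1)] ip[OF that(2)]
    by (intro borel_measurable_divide borel_measurable_sum borel_measurable_times) auto
  have t: "(\<lambda>X. tau_sq n p k (lam k) X (\<gamma>hat k X)) \<in> borel_measurable (data_space n p)"
    if k: "nodewise_lasso n p k (lam k) (\<gamma>hat k)" "k < p" for k
  proof -
    have "(\<lambda>X. l1_off p k (coeff_vec k (\<gamma>hat k X))) \<in> borel_measurable (data_space n p)"
      unfolding l1_off_def using c[OF k(1)] by (intro borel_measurable_sum borel_measurable_abs) auto
    then show ?thesis
      unfolding tau_sq_def resid_sq_cov[OF k(2)] l1_norm_off using cv[OF k(1) k(1)] by measurable
  qed
  show ?thesis
    unfolding desparsified_despars[OF ij, abs_def] despars_def
    using t[OF l(1) ij(1)] t[OF l(2) ij(2)] cv[OF l] c[OF l(1) ij(2)] c[OF l(2) ij(1)] by measurable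
qed

section \<open>Remainder of the de-sparsified estimator under the normal law\<close>

context prec_matrix
begin

text \<open>The projection of the first row is almost surely non-zero. Positivity is what
  \<open>inverse_tau_le\<close> requires.\<close>

lemma AE_cov_pos:
  assumes "n > 0" "0 < V a a"
  shows "AE X in P n. 0 < cov n p X a a"
proof -
  have B: "{x \<in> space N. ip p a x = 0} \<in> sets N"
    using measurable_sets[OF measurable_ip[of a], of "{0}"] by (simp add: vimage_def Int_def conj_commute)
  have "emeasure N {x \<in> space N. ip p a x = 0} = (\<integral>\<^sup>+x. indicator {0} (ip p a x) \<partial>N)"
    unfolding nn_integral_indicator[OF B, symmetric] by (intro nn_integral_cong) (auto simp: indicator_def)
  also have "\<dots> = (\<integral>\<^sup>+z. indicator {0} (sqrt (V a a) * z) \<partial>stdn)"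
    by (rule nn_integral_normal_vec_ip) measurable
  also have "\<dots> = (\<integral>\<^sup>+z. indicator {0} (sqrt (V a a) * z) * ennreal (std_normal_density z) \<partial>lborel)"
    by (rule nn_integral_stdn) measurable
  also have "\<dots> = (\<integral>\<^sup>+z. 0 \<partial>(lborel :: real measure))"
  proof (rule nn_integral_cong_AE)
    have "AE z in lborel. z \<noteq> (0::real)" by (rule AE_lborel_singleton)
    then show "AE z in lborel. indicator {0} (sqrt (V a a) * z) * ennreal (std_normal_density z) = 0"
      by eventually_elim (use assms in simp)
  qed
  finally have "emeasure N {x \<in> space N. ip p a x = 0} = 0" by simp
  then have "AE x in N. ip p a x \<noteq> 0"
    using B by (intro AE_I[of _ _ "{x \<in> space N. ip p a x = 0}"]) auto
  then have "AE X in P n. ip p a (X 0) \<noteq> 0"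
    using assms by (intro AE_PiM_component) (auto intro: N.prob_space_axioms)
  then show ?thesis
  proof eventually_elim
    fix X :: "nat \<Rightarrow> nat \<Rightarrow> real" assume "ip p a (X 0) \<noteq> 0"
    then have "0 < (ip p a (X 0))\<^sup>2" by simp
    also have "\<dots> \<le> (\<Sum>r<n. (ip p a (X r))\<^sup>2)" using assms by (intro member_le_sum) auto
    finally show "0 < cov n p X a a" using assms by (simp add: cov_def power2_eq_square)
  qed
qed

lemma V_unit_pos: "k < p \<Longrightarrow> 1 / C3 \<le> V (unit k) (unit k)" "k < p \<Longrightarrow> V (unit k) (unit k) \<le> C2"
  using V_lower[of "unit k"] V_upper[of "unit k"] C3 by (simp_all add: l2sq_unit field_simps)

lemma mean_le_inverse_cov:
  assumes "n \<ge> 16" "k < p"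
  shows "mean_le (P n) (\<lambda>X. 1 / (cov n p X (unit k) (unit k)) ^ 4) (real n ^ 4 * (inv_sqrt_mean ^ 16 * C3 ^ 4))"
proof -
  have V: "0 < V (unit k) (unit k)" using V_unit_pos[OF assms(2)] C3 by (simp add: order_less_le_trans[of 0 "1 / C3"])
  have "1 / V (unit k) (unit k) \<le> C3" using V_unit_pos(1)[OF assms(2)] V C3 by (simp add: field_simps)
  then have "(1 / V (unit k) (unit k)) ^ 4 \<le> C3 ^ 4" using V by (intro power_mono) auto
  then have "real n ^ 4 * inv_sqrt_mean ^ 16 * (1 / V (unit k) (unit k)) ^ 4 \<le> real n ^ 4 * inv_sqrt_mean ^ 16 * C3 ^ 4"
    by (intro mult_left_mono) (simp_all add: inv_sqrt_mean_nonneg)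
  then have "ennreal (real n ^ 4 * inv_sqrt_mean ^ 16 / V (unit k) (unit k) ^ 4) \<le> ennreal (real n ^ 4 * (inv_sqrt_mean ^ 16 * C3 ^ 4))"
    by (intro ennreal_leI) (simp add: power_divide mult.assoc)
  then show ?thesis
    using nn_inverse_cov_power4[OF assms(1) V] C3
    by (auto simp: mean_le_def inv_sqrt_mean_nonneg intro: order_trans)
qed

lemma mean_le_cov:
  assumes "n > 0" "V a a \<le> K"
  shows "mean_le (P n) (\<lambda>X. (cov n p X a a) ^ 4) (105 * K ^ 4)"
proof -
  have "ennreal (105 * V a a ^ 4) \<le> ennreal (105 * K ^ 4)"
    using assms bf_minv_nonneg by (intro ennreal_leI mult_left_mono power_mono) auto
  then show ?thesis using nn_cov_power4[OF assms(1), of a] assms(2) bf_minv_nonneg[of a]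
    by (auto simp: mean_le_def intro: order_trans)
qed

lemma offdiag_bound: "i < p \<Longrightarrow> j < p \<Longrightarrow> \<bar>A $$ (i,j)\<bar> \<le> C3"
proof -
  assume ij: "i < p" "j < p"
  have "(A $$ (i,j))\<^sup>2 = (V (acol i) (acol j))\<^sup>2" using V_acol[OF ij(1), of "acol j"] by simp
  also have "\<dots> \<le> V (acol i) (acol i) * V (acol j) (acol j)" by (rule V_cauchy)
  also have "\<dots> \<le> C3 * C3"
    using diag_bounds[OF ij(1)] diag_bounds[OF ij(2)] ij C3 by (intro mult_mono) (auto simp: V_acol)
  finally show ?thesis using C3 by (simp only: power2_eq_square[of C3, symmetric] abs_le_square_iff[symmetric])
qed

text \<open>Origin of the numbers: 27 from splitting a fourth power of three terms, used twice; 432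
  = 27 * 16; 512 and 16 h^4 from the bound on 1 / tau^4; 210 = 2 * 105 and 226 = 16 + 210 from
  eighth moments.\<close>

definition c4 :: "real \<Rightarrow> real" where
  "c4 h = 27 * (432 * (h ^ 4 + (512 + 16 * h ^ 4) * (2 * (inv_sqrt_mean ^ 16 * C3 ^ 4) + 210 * C2 ^ 4)) + 226 * C3 ^ 4)"

definition c3 :: real where
  "c3 = (64 * C3\<^sup>2 + sqrt (C2 * C3) * (2 * C3\<^sup>2 * (2 + 8 * C2 * C3))) * (2 * C3 + 1)"

text \<open>Only polynomial growth matters, because the exceptional event will have probability at
  most (n p)^-12. The crude bounds reduce everything to fourth moments of sample variances and of
  their inverses. The assumption on 1 / lam expresses that the penalty is not smaller than a
  multiple of 1 / n.\<close>

lemma remainder_fourth: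
  assumes n: "n \<ge> 16" and ij: "i < p" "j < p" and h: "0 \<le> h"
    and lasso: "\<And>k. k = i \<or> k = j \<Longrightarrow> nodewise_lasso n p k (lam k) (\<gamma>hat k)"
    and lam: "\<And>k. k = i \<or> k = j \<Longrightarrow> 0 \<le> lam k" "\<And>k. k = i \<or> k = j \<Longrightarrow> lam k = 0 \<Longrightarrow> p = 1"
      "\<And>k. k = i \<or> k = j \<Longrightarrow> 1 / lam k \<le> h * real n"
  shows "mean_le (P n) (\<lambda>X. (desparsified n p i j lam \<gamma>hat X - (2 * A $$ (i,j) - cov n p X (acol i) (acol j))) ^ 4)
    (c4 h * (real n * real p) ^ 8)"
proof -
  define T where "T = desparsified n p i j lam \<gamma>hat"
  define Y where "Y X = cov n p X (acol i) (acol j)" for X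
  define Q where "Q k X = cov n p X (unit k) (unit k)" for k X
  define G where "G = 512 + 16 * h ^ 4"
  define g where "g = inv_sqrt_mean ^ 16 * C3 ^ 4"
  have n1: "1 \<le> real n ^ 4" using n by (simp add: one_le_power)
  have p1: "1 \<le> real p" using ij by simp
  have G0: "0 \<le> G" by (simp add: G_def)
  have g0: "0 \<le> g" by (simp add: g_def)
  have Tm: "T \<in> borel_measurable (P n)"
  proof -
    have "T \<in> borel_measurable (data_space n p)"
      unfolding T_def by (rule desparsified_measurable) (use lasso ij in auto)
    then show ?thesis by (simp add: measurable_cong_sets[OF sets_P refl])
  qed
  define M4 where "M4 X = real p ^ 3 * (\<Sum>l<p. Q l X ^ 4)" for X
  define F where "F X = 27 * (432 * h ^ 4 * real n ^ 4 + 16 * C3 ^ 4)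
     + (27 * 432 * G * real n ^ 4 * (1 / Q i X ^ 4 + 1 / Q j X ^ 4 + 2 * M4 X)
     + 27 * (cov n p X (acol i) (acol i) ^ 4 + cov n p X (acol j) (acol j) ^ 4))" for X
  define FB where "FB = 27 * (432 * h ^ 4 * real n ^ 4 + 16 * C3 ^ 4)
     + (27 * 432 * G * real n ^ 4 * (real n ^ 4 * g + real n ^ 4 * g + 2 * (real p ^ 3 * (\<Sum>l<p. 105 * C2 ^ 4)))
     + 27 * (105 * C3 ^ 4 + 105 * C3 ^ 4))"
  have n0: "n > 0" using n by simp
  have Vc: "V (acol k) (acol k) \<le> C3" if "k < p" for k using V_acol[OF that] diag_bounds[OF that] by simp
  have "mean_le (P n) F FB"
    unfolding F_def FB_def M4_def Q_def g_def
    using ij n n0 V_unit_pos(2) Vc C3 G0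
    by (intro mean_le_add mean_le_scale mean_le_const mean_le_sum mean_le_cov mean_le_inverse_cov prob_space_P)
       (auto intro!: mult_nonneg_nonneg add_nonneg_nonneg)
  moreover have "FB \<le> c4 h * (real n * real p) ^ 8"
  proof -
    let ?N = "(real n * real p) ^ 8"
    have np: "1 \<le> ?N" "real n ^ 4 \<le> ?N" "real n ^ 4 * real n ^ 4 \<le> ?N" "real n ^ 4 * real p ^ 4 \<le> ?N"
    proof -
      have a: "1 \<le> real n ^ k" "1 \<le> real p ^ k" for k using n p1 by (simp_all add: one_le_power)
      have N: "?N = real n ^ 4 * real n ^ 4 * (real p ^ 4 * real p ^ 4)"
        by (simp add: power_mult_distrib flip: power_add)
      have b: "1 \<le> real n ^ 4 * real n ^ 4" "1 \<le> real p ^ 4 * real p ^ 4"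
        using a[of 4] mult_mono[of 1 "real n ^ 4" 1 "real n ^ 4"] mult_mono[of 1 "real p ^ 4" 1 "real p ^ 4"] by simp_all
      show "real n ^ 4 * real n ^ 4 \<le> ?N" unfolding N using mult_left_mono[OF b(2), of "real n ^ 4 * real n ^ 4"] by simp
      then show "1 \<le> ?N" using b(1) by linarith
      have "real n ^ 4 \<le> real n ^ 4 * real n ^ 4" using mult_left_mono[OF a(1)[of 4], of "real n ^ 4"] by simp
      then show "real n ^ 4 \<le> ?N" using \<open>real n ^ 4 * real n ^ 4 \<le> ?N\<close> by linarith
      have "real p ^ 4 \<le> real p ^ 4 * real p ^ 4" using mult_left_mono[OF a(2)[of 4], of "real p ^ 4"] by simp
      then have "real n ^ 4 * real p ^ 4 \<le> (real n ^ 4 * real n ^ 4) * (real p ^ 4 * real p ^ 4)"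
        using \<open>real n ^ 4 \<le> real n ^ 4 * real n ^ 4\<close> by (intro mult_mono) auto
      then show "real n ^ 4 * real p ^ 4 \<le> ?N" unfolding N .
    qed
    have S: "real p ^ 3 * (\<Sum>l<p. 105 * C2 ^ 4) = real p ^ 4 * (105 * C2 ^ 4)"
      by (simp add: eval_nat_numeral)
    have "FB = (27 * 432 * h ^ 4) * real n ^ 4 + (27 * 226 * C3 ^ 4) * 1
       + (27 * 432 * G * 2 * g) * (real n ^ 4 * real n ^ 4) + (27 * 432 * G * 210 * C2 ^ 4) * (real n ^ 4 * real p ^ 4)"
      unfolding FB_def S by (simp add: algebra_simps)
    also have "\<dots> \<le> (27 * 432 * h ^ 4) * ?N + (27 * 226 * C3 ^ 4) * ?N + (27 * 432 * G * 2 * g) * ?N + (27 * 432 * G * 210 * C2 ^ 4) * ?N"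
      using np G0 g0 C2 C3 h by (intro add_mono mult_left_mono mult_nonneg_nonneg) auto
    also have "\<dots> = (27 * 432 * h ^ 4 + 27 * 226 * C3 ^ 4 + 27 * 432 * G * 2 * g + 27 * 432 * G * 210 * C2 ^ 4) * ?N"
      by (simp only: distrib_right)
    also have "27 * 432 * h ^ 4 + 27 * 226 * C3 ^ 4 + 27 * 432 * G * 2 * g + 27 * 432 * G * 210 * C2 ^ 4 = c4 h"
      by (simp add: c4_def G_def[symmetric] g_def[symmetric] distrib_left)
    finally show ?thesis .
  qed
  ultimately have "mean_le (P n) F (c4 h * (real n * real p) ^ 8)" by (rule mean_le_mono)
  then have "mean_le (P n) (\<lambda>X. (T X - (2 * A $$ (i,j) - Y X)) ^ 4) (c4 h * (real n * real p) ^ 8)"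
  proof (rule mean_le_AE)
    have V0: "0 < V (unit k) (unit k)" if "k < p" for k
      using V_unit_pos(1)[OF that] C3 less_le_trans[of 0 "1 / C3"] by simp
    have "AE X in P n. 0 < Q i X" "AE X in P n. 0 < Q j X"
      unfolding Q_def using n0 V0 ij by (auto intro: AE_cov_pos)
    moreover have "AE X in P n. X \<in> space (P n)" by (rule AE_space)
    ultimately show "AE X in P n. (T X - (2 * A $$ (i,j) - Y X)) ^ 4 \<le> F X"
    proof eventually_elim
      fix X assume Qi: "0 < Q i X" and Qj: "0 < Q j X" and X: "X \<in> space (P n)"
      have Xd: "X \<in> space (data_space n p)" using X sets_eq_imp_space_eq[OF sets_P[of n]] by simp
      define bi where "bi = coeff_vec i (\<gamma>hat i X)"
      define bj where "bj = coeff_vec j (\<gamma>hat j X)"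
      have li: "lasso n p X i (lam i) bi" and lj: "lasso n p X j (lam j) bj"
        unfolding bi_def bj_def using lasso lam ij Xd by (auto intro!: nodewise_lasso_lasso)
      define ti where "ti = lasso.tau n p X i (lam i) bi"
      define tj where "tj = lasso.tau n p X j (lam j) bj"
      have TX: "T X = despars n p X i j bi bj ti tj"
        unfolding T_def desparsified_despars[OF ij] ti_def tj_def
        using tau_sq_cov[OF li[unfolded bi_def]] tau_sq_cov[OF lj[unfolded bj_def]] by (simp add: bi_def bj_def)
      have M0: "0 \<le> M4 X" by (simp add: M4_def sum_nonneg)
      \<comment> \<open>The square of the mixed term M / q is split by a^2 b^2 <= (a^4 + b^4) / 2,
        so that the trace and the inverse variance are needed only in separate fourth
        moments.\<close>
      have tau4: "(1 / t) ^ 4 \<le> G * real n ^ 4 * (1 / q ^ 4 + M4 X)"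
        if t: "1 / t\<^sup>2 \<le> 16 / q\<^sup>2 + 4 * (\<Sum>l<p. Q l X) / (l\<^sup>2 * q)" and q: "0 < q" and l: "0 \<le> l" "1 / l \<le> h * real n" for t q l
      proof -
        define M where "M = (\<Sum>l<p. Q l X)"
        have M: "M ^ 4 \<le> M4 X" unfolding M_def M4_def by (rule power4_sum_le)
        have M00: "0 \<le> M" unfolding M_def Q_def by (simp add: sum_nonneg cov_nonneg)
        have "(1 / t) ^ 4 = (1 / t\<^sup>2)\<^sup>2" by (simp add: power_divide)
        also have "\<dots> \<le> (16 / q\<^sup>2 + 4 * M / (l\<^sup>2 * q))\<^sup>2" using t by (intro power_mono) (auto simp: M_def)
        also have "\<dots> \<le> 2 * (16 / q\<^sup>2)\<^sup>2 + 2 * (4 * M / (l\<^sup>2 * q))\<^sup>2"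
          using sum_squares_bound[of "16 / q\<^sup>2" "4 * M / (l\<^sup>2 * q)"] by (simp add: power2_sum)
        also have "2 * (16 / q\<^sup>2)\<^sup>2 = 512 * (1 / q ^ 4)" by (simp add: power_divide)
        also have "2 * (4 * M / (l\<^sup>2 * q))\<^sup>2 = 32 * (1 / l) ^ 4 * (M * (1 / q))\<^sup>2"
          by (simp add: power_divide power_mult_distrib)
        also have "\<dots> \<le> 32 * (h * real n) ^ 4 * ((M ^ 4 + (1 / q) ^ 4) / 2)"
        proof (intro mult_mono power_mono)
          have "(M * (1 / q))\<^sup>2 = M\<^sup>2 * (1 / q)\<^sup>2" by (simp only: power_mult_distrib)
          also have "\<dots> \<le> ((M\<^sup>2)\<^sup>2 + ((1 / q)\<^sup>2)\<^sup>2) / 2"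
          proof -
            have "a * b \<le> (a\<^sup>2 + b\<^sup>2) / 2" for a b :: real using sum_squares_bound[of a b] by simp
            then show ?thesis .
          qed
          finally show "(M * (1 / q))\<^sup>2 \<le> (M ^ 4 + (1 / q) ^ 4) / 2" by (simp only: power4_eq_square)
        qed (use l h in auto)
        also have "\<dots> = 16 * h ^ 4 * real n ^ 4 * (1 / q ^ 4 + M ^ 4)"
          by (simp add: power_mult_distrib power_divide)
        also have "\<dots> \<le> 16 * h ^ 4 * real n ^ 4 * (1 / q ^ 4 + M4 X)"
          using M h by (intro mult_left_mono) auto
        also have "512 * (1 / q ^ 4) \<le> 512 * real n ^ 4 * (1 / q ^ 4 + M4 X)"
        proof -
          have "1 * (1 / q ^ 4) \<le> real n ^ 4 * (1 / q ^ 4 + M4 X)" using n1 M0 q by (intro mult_mono) auto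
          then show ?thesis by simp
        qed
        finally show ?thesis unfolding G_def by (simp only: distrib_right)
      qed
      have ti4: "(1 / ti) ^ 4 \<le> G * real n ^ 4 * (1 / Q i X ^ 4 + M4 X)"
        using lasso.inverse_tau_le(2)[OF li] lam ij Qi unfolding ti_def Q_def by (intro tau4[unfolded Q_def, of _ _ "lam i"]) auto
      have tj4: "(1 / tj) ^ 4 \<le> G * real n ^ 4 * (1 / Q j X ^ 4 + M4 X)"
        using lasso.inverse_tau_le(2)[OF lj] lam ij Qj unfolding tj_def Q_def by (intro tau4[unfolded Q_def, of _ _ "lam j"]) auto
      have "\<bar>T X\<bar> \<le> 1 / lam i + 1 / lam j + 2 / ti + 2 / tj"
        unfolding TX ti_def tj_def using lam Qi Qj by (intro despars_crude[OF li lj]) (auto simp: Q_def)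
      also have "\<dots> \<le> 2 * h * real n + 2 * (1 / ti) + 2 * (1 / tj)" using lam(3)[of i] lam(3)[of j] by simp
      finally have "\<bar>T X\<bar> ^ 4 \<le> (2 * h * real n + 2 * (1 / ti) + 2 * (1 / tj)) ^ 4" by (intro power_mono) auto
      also have "\<dots> \<le> 27 * ((2 * h * real n) ^ 4 + (2 * (1 / ti)) ^ 4 + (2 * (1 / tj)) ^ 4)" by (rule power4_add_le)
      also have "\<dots> = 432 * (h ^ 4 * real n ^ 4 + (1 / ti) ^ 4 + (1 / tj) ^ 4)" by (simp add: power_mult_distrib power_divide)
      finally have T4: "T X ^ 4 \<le> 432 * (h ^ 4 * real n ^ 4 + (1 / ti) ^ 4 + (1 / tj) ^ 4)" by simp
      have Y4: "Y X ^ 4 \<le> cov n p X (acol i) (acol i) ^ 4 + cov n p X (acol j) (acol j) ^ 4"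
      proof -
        define u where "u = cov n p X (acol i) (acol i)"
        define v where "v = cov n p X (acol j) (acol j)"
        have uv: "0 \<le> u" "0 \<le> v" by (simp_all add: u_def v_def cov_nonneg)
        have "\<bar>Y X\<bar> \<le> (u + v) / 2" unfolding Y_def u_def v_def by (rule cov_abs_le)
        also have "\<dots> \<le> max u v" by simp
        finally have "\<bar>Y X\<bar> ^ 4 \<le> max u v ^ 4" by (intro power_mono) auto
        also have "\<dots> \<le> u ^ 4 + v ^ 4" using uv by (cases "u \<le> v") (simp_all add: max_def)
        finally show ?thesis by (simp add: u_def v_def)
      qed
      have A4: "(- 2 * A $$ (i,j)) ^ 4 \<le> 16 * C3 ^ 4"
        using power_mono[OF offdiag_bound[OF ij] abs_ge_zero, of 4] by (simp add: power_mult_distrib)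
      have "(T X - (2 * A $$ (i,j) - Y X)) ^ 4 = (T X + (- 2 * A $$ (i,j)) + Y X) ^ 4" by (simp add: algebra_simps)
      also have "\<dots> \<le> 27 * (T X ^ 4 + (- 2 * A $$ (i,j)) ^ 4 + Y X ^ 4)" by (rule power4_add_le)
      also have "\<dots> \<le> 27 * (432 * (h ^ 4 * real n ^ 4 + G * real n ^ 4 * (1 / Q i X ^ 4 + M4 X) + G * real n ^ 4 * (1 / Q j X ^ 4 + M4 X))
          + 16 * C3 ^ 4 + (cov n p X (acol i) (acol i) ^ 4 + cov n p X (acol j) (acol j) ^ 4))"
        using T4 A4 Y4 ti4 tj4 by (intro mult_left_mono add_mono) auto
      also have "\<dots> = F X" unfolding F_def by (simp add: distrib_left)
      finally show "(T X - (2 * A $$ (i,j) - Y X)) ^ 4 \<le> F X" .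
    qed
    show "(\<lambda>X. (T X - (2 * A $$ (i,j) - Y X)) ^ 4) \<in> borel_measurable (P n)"
      using Tm measurable_cov[of n "acol i" "acol j"] unfolding Y_def by measurable
  qed auto
  then show ?thesis by (simp add: T_def Y_def)
qed

text \<open>The good event asks that all S(unit l, unit m), S(unit l, col i) and S(unit l, col j)
  deviate by at most 2 K u. Since the covariance maps columns of A to unit vectors, it controls both
  the noise and the deviation in \<open>lasso_error\<close>. It excludes p (p + 2) <= 3 p^2 events
  of probability 4 exp(- n u^2 / 16) each, which gives the factor 12.\<close>

lemma remainder_square:
  assumes n: "n \<ge> 16" and ij: "i < p" "j < p" and h: "0 \<le> h"
    and lasso: "\<And>k. k = i \<or> k = j \<Longrightarrow> nodewise_lasso n p k (lam k) (\<gamma>hat k)"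
    and lam: "\<And>k. k = i \<or> k = j \<Longrightarrow> 0 \<le> lam k" "\<And>k. k = i \<or> k = j \<Longrightarrow> lam k = 0 \<Longrightarrow> p = 1"
      "\<And>k. k = i \<or> k = j \<Longrightarrow> 1 / lam k \<le> h * real n"
    and K: "C2 \<le> K" "C3 \<le> K" and u: "0 < u" "u \<le> 1" and s: "1 \<le> s"
    and sparse: "\<And>k. k = i \<or> k = j \<Longrightarrow> real (card {l. l < p \<and> A $$ (l,k) \<noteq> 0}) \<le> s"
    and L: "2 * K * u \<le> L" "C2 * (2 * K * u) \<le> L" "\<And>k. k = i \<or> k = j \<Longrightarrow> lam k \<le> L"
    and regime: "\<And>k. k = i \<or> k = j \<Longrightarrow> real p \<le> s \<or> (0 < lam k \<and> 2 * C2 * (2 * K * u) \<le> lam k)"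
    and small: "32 * C3 * (2 * K * u) * s \<le> 1" "2 * C3 * ((2 + 8 * C2 * C3) * L * sqrt s) \<le> 1"
    and prob: "12 * (real p)\<^sup>2 * exp (- (real n * u\<^sup>2 / 16)) \<le> 1 / (real n * real p) ^ 12"
  shows "mean_le (P n) (\<lambda>X. (desparsified n p i j lam \<gamma>hat X - (2 * A $$ (i,j) - cov n p X (acol i) (acol j)))\<^sup>2)
    ((c3 * s * L\<^sup>2)\<^sup>2 + (c4 h + 1) / (real n * real p)\<^sup>2)"
proof -
  have n0: "n > 0" using n by simp
  have p1: "1 \<le> real p" using ij by simp
  define W where "W = 2 * K * u"
  \<comment> \<open>The indices p and p + 1 stand for the two columns of the precision matrix, so
    that one finite index set covers all deviations.\<close>
  define f where "f m = (if m < p then unit m else if m = p then acol i else acol j)" for m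
  define J where "J = {..<p} \<times> {..<p + 2}"
  define S where "S lm = {X \<in> space (P n). \<bar>cov n p X (unit (fst lm)) (f (snd lm)) - V (unit (fst lm)) (f (snd lm))\<bar> > W}" for lm
  define B where "B = (\<Union>lm\<in>J. S lm)"
  have Sm: "S lm \<in> sets (P n)" for lm unfolding S_def by measurable
  have Bm: "B \<in> sets (P n)" unfolding B_def J_def using Sm by (intro sets.finite_UN) auto
  have Vf: "V (f m) (f m) \<le> K" if "m < p + 2" for m
    using V_unit_pos(2)[of m] K V_acol[OF ij(1), of "acol i"] V_acol[OF ij(2), of "acol j"] diag_bounds(2)[OF ij(1)] diag_bounds(2)[OF ij(2)]
    by (auto simp: f_def)
  have "emeasure (P n) B \<le> (\<Sum>lm\<in>J. emeasure (P n) (S lm))"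
    unfolding B_def using Sm by (intro emeasure_subadditive_finite) (auto simp: J_def)
  also have "\<dots> \<le> (\<Sum>lm\<in>J. ennreal (4 * exp (- (real n * u\<^sup>2 / 16))))"
  proof (intro sum_mono)
    fix lm assume lm: "lm \<in> J"
    show "emeasure (P n) (S lm) \<le> ennreal (4 * exp (- (real n * u\<^sup>2 / 16)))"
      unfolding S_def W_def
    proof (rule cov_tail[OF n0 _ _ _ u])
      show "V (unit (fst lm)) (unit (fst lm)) \<le> K" using lm V_unit_pos(2)[of "fst lm"] K by (auto simp: J_def)
      show "V (f (snd lm)) (f (snd lm)) \<le> K" using lm by (intro Vf) (auto simp: J_def)
      show "0 < K" using K C2 by linarith
    qed
  qed
  also have "\<dots> = ennreal (real (card J) * (4 * exp (- (real n * u\<^sup>2 / 16))))"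
    by (simp add: ennreal_mult ennreal_of_nat_eq_real_of_nat)
  also have "\<dots> \<le> ennreal (1 / (real n * real p) ^ 12)"
  proof (rule ennreal_leI)
    have "real (card J) = real p * (real p + 2)" by (simp add: J_def algebra_simps)
    also have "\<dots> \<le> real p * (3 * real p)" using p1 by (intro mult_left_mono) auto
    finally have "real (card J) * (4 * exp (- (real n * u\<^sup>2 / 16))) \<le> real p * (3 * real p) * (4 * exp (- (real n * u\<^sup>2 / 16)))"
      by (intro mult_right_mono) auto
    also have "\<dots> = 12 * (real p)\<^sup>2 * exp (- (real n * u\<^sup>2 / 16))" by (simp add: power2_eq_square)
    finally show "real (card J) * (4 * exp (- (real n * u\<^sup>2 / 16))) \<le> 1 / (real n * real p) ^ 12" using prob by linarith
  qed
  finally have PB: "emeasure (P n) B \<le> ennreal (1 / (real n * real p) ^ 12)" .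
  let ?xi = "\<lambda>X. desparsified n p i j lam \<gamma>hat X - (2 * A $$ (i,j) - cov n p X (acol i) (acol j))"
  have good: "\<bar>?xi X\<bar> \<le> c3 * s * L\<^sup>2" if X: "X \<in> space (P n)" and XB: "X \<notin> B" for X
  proof -
    have Xd: "X \<in> space (data_space n p)" using X sets_eq_imp_space_eq[OF sets_P[of n]] by simp
    have d: "\<bar>cov n p X (unit l) (f m) - V (unit l) (f m)\<bar> \<le> W" if "l < p" "m < p + 2" for l m
      using that XB X unfolding B_def J_def S_def by (auto simp: not_less)
    have d1: "\<bar>cov n p X (unit l) (unit m) - V (unit l) (unit m)\<bar> \<le> W" if "l < p" "m < p" for l m
      using d[of l m] that by (simp add: f_def)
    have d2: "\<bar>cov n p X (unit l) (acol k) - (if l = k then 1 else 0)\<bar> \<le> W" if "l < p" "k = i \<or> k = j" for l k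
    proof -
      have kp: "k < p" using that ij by auto
      have "V (unit l) (acol k) = unit l k" using V_acol[OF kp, of "unit l"] bf_minv_sym[of "unit l"] by simp
      moreover have "\<bar>cov n p X (unit l) (acol k) - V (unit l) (acol k)\<bar> \<le> W"
      proof (cases "k = i")
        case True
        have "f p = acol k" using True by (simp add: f_def)
        then show ?thesis using d[OF that(1), of p] by simp
      next
        case False
        then have "f (p + 1) = acol k" using that(2) by (simp add: f_def)
        then show ?thesis using d[OF that(1), of "p + 1"] by simp
      qed
      ultimately show ?thesis by (simp add: unit_def eq_commute split: if_splits)
    qed
    define b where "b k = coeff_vec k (\<gamma>hat k X)" for k
    have l: "lasso n p X k (lam k) (b k)" if "k = i \<or> k = j" for k
      unfolding b_def using lasso[OF that] lam(1)[OF that] that ij Xd by (intro nodewise_lasso_lasso) auto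
    have le: "lasso_error n p X k (lam k) (b k) A C2 C3 W W L s" if k: "k = i \<or> k = j" for k
    proof -
      interpret l: lasso n p X k "lam k" "b k" by (rule l[OF k])
      show ?thesis
        by unfold_locales
          (use d1 d2[OF _ k] L L(3)[OF k] s sparse[OF k] regime[OF k] small(1) in \<open>auto simp: W_def\<close>)
    qed
    have i: "i = i \<or> i = j" and j: "j = i \<or> j = j" by auto
    have "desparsified n p i j lam \<gamma>hat X = despars n p X i j (b i) (b j) (lasso.tau n p X i (lam i) (b i)) (lasso.tau n p X j (lam j) (b j))"
      unfolding desparsified_despars[OF ij] b_def
      using tau_sq_cov[OF l[OF i, unfolded b_def]] tau_sq_cov[OF l[OF j, unfolded b_def]] by simp
    then show ?thesis
      using despars_remainder[OF le[OF i] le[OF j] small(2)] by (simp add: c3_def)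
  qed
  have m: "?xi \<in> borel_measurable (P n)"
  proof -
    have "desparsified n p i j lam \<gamma>hat \<in> borel_measurable (data_space n p)"
      by (rule desparsified_measurable) (use lasso ij in auto)
    then have [measurable]: "desparsified n p i j lam \<gamma>hat \<in> borel_measurable (P n)" by (simp add: measurable_cong_sets[OF sets_P refl])
    show ?thesis using measurable_cov[of n "acol i" "acol j"] by measurable
  qed
  define N where "N = real n * real p"
  have N: "0 < N" using n p1 by (simp add: N_def)
  \<comment> \<open>The weight N^-10 balances the fourth moment of order N^8 against the probability
    N^-12: both contributions become N^-2.\<close>
  have "mean_le (P n) (\<lambda>X. (?xi X)\<^sup>2) ((c3 * s * L\<^sup>2)\<^sup>2 + (1 / N ^ 10 * (c4 h * N ^ 8) + 1 / (1 / N ^ 10) * (1 / N ^ 12)))"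
  proof (rule mean_le_split[OF prob_space_P m Bm])
    show "mean_le (P n) (\<lambda>X. (?xi X) ^ 4) (c4 h * N ^ 8)"
      unfolding N_def by (rule remainder_fourth[OF n ij h]) (use lasso lam in auto)
    show "emeasure (P n) B \<le> ennreal (1 / N ^ 12)" using PB by (simp add: N_def)
    show "0 \<le> 1 / N ^ 12" "0 < 1 / N ^ 10" using N by simp_all
  qed (fact good)
  moreover have "1 / N ^ 10 * (c4 h * N ^ 8) + 1 / (1 / N ^ 10) * (1 / N ^ 12) = (c4 h + 1) / N\<^sup>2"
  proof -
    have "N ^ 10 = N\<^sup>2 * N ^ 8" "N ^ 12 = N\<^sup>2 * N ^ 10" by (simp_all flip: power_add)
    then show ?thesis using N by (simp add: field_simps)
  qed
  ultimately show ?thesis by (simp add: N_def)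
qed

end

section \<open>From the parameter class to the moments of the estimator\<close>

lemma prec_class_prec_matrix:
  assumes "\<Theta> \<in> prec_class C1 C2 C3 p T d" "0 < p" "0 < C2" "0 < C3"
  shows "prec_matrix p \<Theta> C2 C3"
proof -
  have c: "\<Theta> \<in> carrier_mat p p" "transpose_mat \<Theta> = \<Theta>" and e: "0 < eig_min \<Theta>" "1 / eig_min \<Theta> \<le> C2" "eig_max \<Theta> \<le> C3"
    using assms by (auto simp: prec_class_def)
  have sym: "\<Theta> $$ (k,l) = \<Theta> $$ (l,k)" if "k < p" "l < p" for k l
  proof -
    have "transpose_mat \<Theta> $$ (k,l) = \<Theta> $$ (l,k)" using c(1) that by simp
    then show ?thesis unfolding c(2) .
  qed
  have low: "eig_min \<Theta> * l2sq p a \<le> bf p \<Theta> a a" and up: "bf p \<Theta> a a \<le> eig_max \<Theta> * l2sq p a" for a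
    using eig_bounds[OF c assms(2), of a] by (simp_all only: qf_bf l2sq_def)
  have "l2sq p a \<le> C2 * bf p \<Theta> a a" for a
  proof -
    have b: "0 \<le> bf p \<Theta> a a" using low[of a] e(1) l2sq_nonneg[of p a] mult_nonneg_nonneg[of "eig_min \<Theta>" "l2sq p a"] by linarith
    have "l2sq p a \<le> (1 / eig_min \<Theta>) * bf p \<Theta> a a" using low[of a] e(1) by (simp add: field_simps)
    also have "\<dots> \<le> C2 * bf p \<Theta> a a" using e b by (intro mult_right_mono)
    finally show ?thesis .
  qed
  moreover have "bf p \<Theta> a a \<le> C3 * l2sq p a" for a
    using up[of a] mult_right_mono[OF e(3) l2sq_nonneg[of p a]] by linarith
  moreover have "0 < bf p \<Theta> x x" if "\<exists>k<p. x k \<noteq> 0" for x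
  proof -
    from that have "0 < l2sq p x" unfolding l2sq_def by (auto intro: sum_pos2)
    then have "0 < eig_min \<Theta> * l2sq p x" using e(1) by simp
    then show ?thesis using low[of x] by linarith
  qed
  ultimately show ?thesis using c sym assms by unfold_locales
qed

lemma prec_class_sparse:
  assumes "\<Theta> \<in> prec_class C1 C2 C3 p T d" "k < p"
  shows "real (card {l. l < p \<and> \<Theta> $$ (l,k) \<noteq> 0}) \<le> C1 * d k"
proof -
  have "\<Theta> \<in> carrier_mat p p" using assms by (simp add: prec_class_def)
  then have "nnz (col \<Theta> k) = card {l. l < p \<and> \<Theta> $$ (l,k) \<noteq> 0}"
    unfolding nnz_def using assms(2) by (intro arg_cong[where f=card]) auto
  then show ?thesis using assms by (auto simp: prec_class_def)
qed

lemma (in prec_matrix) sigma_sq_V: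
  assumes "i < p" "j < p"
  shows "sigma_sq A i j = V (acol i) (acol i) * V (acol j) (acol j) + (V (acol i) (acol j))\<^sup>2"
  using V_acol[OF assms(1), of "acol i"] V_acol[OF assms(2), of "acol j"] V_acol[OF assms(1), of "acol j"]
  by (simp add: sigma_sq_def)

lemma (in prec_matrix) sigma_sq_bounds:
  assumes "i < p" "j < p"
  shows "1 / C2\<^sup>2 \<le> sigma_sq A i j" "sigma_sq A i j \<le> 2 * C3\<^sup>2"
proof -
  have "1 / C2 * (1 / C2) \<le> A $$ (i,i) * A $$ (j,j)"
    using diag_bounds[OF assms(1)] diag_bounds[OF assms(2)] C2 by (intro mult_mono) auto
  then have "1 / C2\<^sup>2 \<le> A $$ (i,i) * A $$ (j,j)" by (simp add: power2_eq_square)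
  then show "1 / C2\<^sup>2 \<le> sigma_sq A i j" unfolding sigma_sq_def
    by (rule order_trans) simp
  have "A $$ (i,i) * A $$ (j,j) \<le> C3 * C3"
    using diag_bounds[OF assms(1)] diag_bounds[OF assms(2)] C3 by (intro mult_mono) auto
  moreover have "\<bar>A $$ (i,j)\<bar>\<^sup>2 \<le> C3\<^sup>2" using offdiag_bound[OF assms] by (intro power_mono) auto
  ultimately show "sigma_sq A i j \<le> 2 * C3\<^sup>2" unfolding sigma_sq_def by (simp add: power2_eq_square)
qed

lemma (in prec_matrix) desparsified_moments:
  assumes n: "n > 0" and ij: "i < p" "j < p"
    and T: "desparsified n p i j lam \<gamma>hat \<in> borel_measurable (data_space n p)"
    and R: "mean_le (P n) (\<lambda>X. (desparsified n p i j lam \<gamma>hat X - (2 * A $$ (i,j) - cov n p X (acol i) (acol j)))\<^sup>2) R"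
  defines "T \<equiv> desparsified n p i j lam \<gamma>hat"
  shows "integrable (sample_law n p A) (\<lambda>X. (T X)\<^sup>2)" "integrable (sample_law n p A) T"
    "(prob_space.expectation (sample_law n p A) T - A $$ (i,j))\<^sup>2 \<le> R"
    "0 < \<eta> \<Longrightarrow> \<bar>prob_space.variance (sample_law n p A) T - sigma_sq A i j / real n\<bar> \<le> \<eta> * (sigma_sq A i j / real n) + (1 + 1 / \<eta>) * R"
proof -
  have Vij: "V (acol i) (acol j) = A $$ (i,j)" using V_acol[OF ij(1)] by simp
  have Tm: "T \<in> borel_measurable (P n)" using T by (simp add: T_def measurable_cong_sets[OF sets_P refl])
  note m = remainder_moments[OF prob_space_P Tm measurable_cov cov_mean[OF n] cov_variance[OF n] R[folded Vij, folded T_def]]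
  show "integrable (sample_law n p A) (\<lambda>X. (T X)\<^sup>2)" "integrable (sample_law n p A) T"
    "(prob_space.expectation (sample_law n p A) T - A $$ (i,j))\<^sup>2 \<le> R"
    using m(1-3) by (simp_all add: sample_law_P Vij)
  show "0 < \<eta> \<Longrightarrow> \<bar>prob_space.variance (sample_law n p A) T - sigma_sq A i j / real n\<bar> \<le> \<eta> * (sigma_sq A i j / real n) + (1 + 1 / \<eta>) * R"
    using m(4) by (simp add: sample_law_P sigma_sq_V[OF ij])
qed

section \<open>The Chapman--Robbins bound\<close>

lemma integral_cauchy_schwarz:
  fixes u v :: "'a \<Rightarrow> real"
  assumes uv: "integrable M (\<lambda>x. u x * v x)" and u: "integrable M (\<lambda>x. (u x)\<^sup>2)" and v: "integrable M (\<lambda>x. (v x)\<^sup>2)"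
  shows "(\<integral>x. u x * v x \<partial>M)\<^sup>2 \<le> (\<integral>x. (u x)\<^sup>2 \<partial>M) * (\<integral>x. (v x)\<^sup>2 \<partial>M)"
proof -
  define a where "a = (\<integral>x. (u x)\<^sup>2 \<partial>M)"
  define b where "b = (\<integral>x. u x * v x \<partial>M)"
  define c where "c = (\<integral>x. (v x)\<^sup>2 \<partial>M)"
  have q: "0 \<le> a + 2 * t * b + t\<^sup>2 * c" for t
  proof -
    have "0 \<le> (\<integral>x. (u x + t * v x)\<^sup>2 \<partial>M)" by (intro integral_nonneg_AE) auto
    also have "(\<lambda>x. (u x + t * v x)\<^sup>2) = (\<lambda>x. (u x)\<^sup>2 + (2 * t) * (u x * v x) + t\<^sup>2 * (v x)\<^sup>2)"
      by (auto simp: power2_eq_square algebra_simps)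
    also have "(\<integral>x. (u x)\<^sup>2 + (2 * t) * (u x * v x) + t\<^sup>2 * (v x)\<^sup>2 \<partial>M) = a + 2 * t * b + t\<^sup>2 * c"
      using assms by (simp add: a_def b_def c_def)
    finally show ?thesis .
  qed
  have c0: "0 \<le> c" unfolding c_def by (intro integral_nonneg_AE) auto
  have "b\<^sup>2 \<le> a * c"
  proof (cases "c = 0")
    case True
    have "b = 0"
    proof (rule ccontr)
      assume "b \<noteq> 0"
      then have "2 * (- (a + 1) / (2 * b)) * b = - (a + 1)" by (simp add: field_simps)
      then show False using q[of "- (a + 1) / (2 * b)"] True by simp
    qed
    then show ?thesis using True by simp
  next
    case False
    then have "0 < c" using c0 by simp
    then show ?thesis using q[of "- b / c"] by (simp add: power2_eq_square field_simps)
  qed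
  then show ?thesis by (simp add: a_def b_def c_def)
qed

text \<open>The shift of the expectation equals the integral of (T - E T) (\<Lambda> - 1), to which
  Cauchy-Schwarz applies; the second factor is the chi-square divergence.\<close>

lemma chapman_robbins:
  fixes T \<Lambda> :: "'a \<Rightarrow> real"
  assumes "prob_space M" and [measurable]: "T \<in> borel_measurable M" "\<Lambda> \<in> borel_measurable M"
    and \<Lambda>0: "\<And>x. 0 \<le> \<Lambda> x" and T2: "integrable M (\<lambda>x. (T x)\<^sup>2)" and T': "integrable (density M \<Lambda>) T"
    and \<Lambda>2: "integrable M (\<lambda>x. (\<Lambda> x)\<^sup>2)" and \<Lambda>1: "integral\<^sup>L M \<Lambda> = 1"
  shows "(integral\<^sup>L (density M \<Lambda>) T - integral\<^sup>L M T)\<^sup>2 \<le> (\<integral>x. (T x - integral\<^sup>L M T)\<^sup>2 \<partial>M) * ((\<integral>x. (\<Lambda> x)\<^sup>2 \<partial>M) - 1)"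
proof -
  interpret prob_space M by fact
  have T: "integrable M T" by (rule square_integrable_imp_integrable) (use T2 in auto)
  have \<Lambda>: "integrable M \<Lambda>" by (rule square_integrable_imp_integrable) (use \<Lambda>2 in auto)
  have \<Lambda>T: "integrable M (\<lambda>x. \<Lambda> x * T x)" using T' \<Lambda>0 by (simp add: integrable_density)
  have E': "integral\<^sup>L (density M \<Lambda>) T = (\<integral>x. \<Lambda> x * T x \<partial>M)" using \<Lambda>0 by (simp add: integral_density)
  define m where "m = integral\<^sup>L M T"
  have eq: "(T x - m) * (\<Lambda> x - 1) = \<Lambda> x * T x - T x - m * \<Lambda> x + m" for x by (simp add: algebra_simps)
  have i: "integrable M (\<lambda>x. (T x - m) * (\<Lambda> x - 1))" unfolding eq using T \<Lambda> \<Lambda>T by simp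
  have "(\<integral>x. (T x - m) * (\<Lambda> x - 1) \<partial>M) = integral\<^sup>L (density M \<Lambda>) T - m"
    unfolding eq E' using T \<Lambda> \<Lambda>T \<Lambda>1 by (simp add: prob_space m_def)
  moreover have "(\<integral>x. (\<Lambda> x - 1)\<^sup>2 \<partial>M) = (\<integral>x. (\<Lambda> x)\<^sup>2 \<partial>M) - 1"
    using \<Lambda> \<Lambda>2 \<Lambda>1 by (simp add: power2_diff prob_space)
  moreover have "integrable M (\<lambda>x. (T x - m)\<^sup>2)" "integrable M (\<lambda>x. (\<Lambda> x - 1)\<^sup>2)"
    using T T2 \<Lambda> \<Lambda>2 by (simp_all add: power2_diff)
  ultimately show ?thesis
    using integral_cauchy_schwarz[OF i] by (simp add: m_def)
qed

lemma PiM_density_iid: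
  fixes n :: nat and L :: "'a \<Rightarrow> real"
  assumes "prob_space N" "prob_space (density N L)" and [measurable]: "L \<in> borel_measurable N" and L0: "\<And>x. 0 \<le> L x"
  shows "Pi\<^sub>M {..<n} (\<lambda>_. density N L) = density (Pi\<^sub>M {..<n} (\<lambda>_. N)) (\<lambda>X. ennreal (\<Prod>r<n. L (X r)))"
proof -
  interpret N: prob_space N by fact
  interpret L: prob_space "density N L" by fact
  interpret PL: product_sigma_finite "\<lambda>_::nat. density N L" ..
  have [measurable]: "(\<lambda>X. \<Prod>r<n. L (X r)) \<in> borel_measurable (Pi\<^sub>M {..<n} (\<lambda>_. N))"
    by (intro borel_measurable_prod) auto
  show ?thesis
  proof (rule PL.PiM_eqI[symmetric])
    show "sets (density (Pi\<^sub>M {..<n} (\<lambda>_. N)) (\<lambda>X. ennreal (\<Prod>r<n. L (X r)))) = sets (Pi\<^sub>M {..<n} (\<lambda>_. density N L))"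
      by (simp cong: sets_PiM_cong)
    fix B assume "\<And>r. r \<in> {..<n} \<Longrightarrow> B r \<in> sets (density N L)"
    then have B: "B r \<in> sets N" if "r < n" for r using that by simp
    \<comment> \<open>The sets are given only at indices below n; the padding makes the family
      measurable at every index, as the product formula requires.\<close>
    define B' where "B' r = (if r < n then B r else {})" for r
    have [measurable]: "B' r \<in> sets N" for r using B by (simp add: B'_def)
    have BB: "Pi\<^sub>E {..<n} B = Pi\<^sub>E {..<n} B'" by (intro PiE_cong) (simp add: B'_def)
    have [measurable]: "Pi\<^sub>E {..<n} B' \<in> sets (Pi\<^sub>M {..<n} (\<lambda>_. N))" by (intro sets_PiM_I_finite) auto
    have "emeasure (density (Pi\<^sub>M {..<n} (\<lambda>_. N)) (\<lambda>X. ennreal (\<Prod>r<n. L (X r)))) (Pi\<^sub>E {..<n} B')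
      = (\<integral>\<^sup>+X. ennreal (\<Prod>r<n. L (X r)) * indicator (Pi\<^sub>E {..<n} B') X \<partial>Pi\<^sub>M {..<n} (\<lambda>_. N))"
      by (rule emeasure_density) measurable
    also have "\<dots> = (\<integral>\<^sup>+X. (\<Prod>r<n. ennreal (L (X r)) * indicator (B' r) (X r)) \<partial>Pi\<^sub>M {..<n} (\<lambda>_. N))"
    proof (rule nn_integral_cong)
      fix X assume X: "X \<in> space (Pi\<^sub>M {..<n} (\<lambda>_. N))"
      have "indicator (Pi\<^sub>E {..<n} B') X = (\<Prod>r<n. indicator (B' r) (X r) :: ennreal)"
      proof (cases "\<forall>r<n. X r \<in> B' r")
        case True
        then have "X \<in> Pi\<^sub>E {..<n} B'" using X by (auto simp: space_PiM PiE_iff)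
        then show ?thesis using True by simp
      next
        case False
        then have "X \<notin> Pi\<^sub>E {..<n} B'" by auto
        moreover have "(\<Prod>r<n. indicator (B' r) (X r) :: ennreal) = 0"
          using False by (intro prod_zero) (auto simp: indicator_def)
        ultimately show ?thesis by simp
      qed
      then show "ennreal (\<Prod>r<n. L (X r)) * indicator (Pi\<^sub>E {..<n} B') X = (\<Prod>r<n. ennreal (L (X r)) * indicator (B' r) (X r))"
        by (simp add: prod.distrib prod_ennreal L0)
    qed
    also have "\<dots> = (\<Prod>r<n. \<integral>\<^sup>+x. ennreal (L x) * indicator (B' r) x \<partial>N)"
      by (rule iid_nn_product[OF N.prob_space_axioms]) measurable
    also have "\<dots> = (\<Prod>r<n. emeasure (density N L) (B r))"
      by (intro prod.cong refl) (use B in \<open>simp add: emeasure_density B'_def\<close>)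
    finally show "emeasure (density (Pi\<^sub>M {..<n} (\<lambda>_. N)) (\<lambda>X. ennreal (\<Prod>r<n. L (X r)))) (Pi\<^sub>E {..<n} B) = (\<Prod>r\<in>{..<n}. emeasure (density N L) (B r))"
      by (simp add: BB)
  qed simp
qed

text \<open>The second moment of the likelihood ratio is multiplicative over independent
  observations, which turns 1 + q into its n-th power.\<close>

lemma chapman_robbins_iid:
  fixes n :: nat and L :: "'a \<Rightarrow> real"
  assumes N: "prob_space N" and NL: "prob_space (density N L)" and L[measurable]: "L \<in> borel_measurable N" and L0: "\<And>x. 0 \<le> L x"
    and L2: "integrable N (\<lambda>x. (L x)\<^sup>2)" and chi: "(\<integral>x. (L x)\<^sup>2 \<partial>N) \<le> 1 + q"
    and T: "T \<in> borel_measurable (Pi\<^sub>M {..<n} (\<lambda>_. N))" "integrable (Pi\<^sub>M {..<n} (\<lambda>_. N)) (\<lambda>X. (T X)\<^sup>2)"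
      "integrable (Pi\<^sub>M {..<n} (\<lambda>_. density N L)) T"
  shows "(integral\<^sup>L (Pi\<^sub>M {..<n} (\<lambda>_. density N L)) T - integral\<^sup>L (Pi\<^sub>M {..<n} (\<lambda>_. N)) T)\<^sup>2
    \<le> (\<integral>X. (T X - integral\<^sup>L (Pi\<^sub>M {..<n} (\<lambda>_. N)) T)\<^sup>2 \<partial>Pi\<^sub>M {..<n} (\<lambda>_. N)) * ((1 + q) ^ n - 1)"
proof -
  interpret N: prob_space N by fact
  interpret L: prob_space "density N L" by fact
  interpret PN: product_sigma_finite "\<lambda>_::nat. N" ..
  note [measurable] = T(1)
  have Li: "integrable N L" by (rule N.square_integrable_imp_integrable) (use L2 in auto)
  have "ennreal (integral\<^sup>L N L) = (\<integral>\<^sup>+x. ennreal (L x) \<partial>N)"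
    using Li L0 by (intro nn_integral_eq_integral[symmetric]) auto
  also have "\<dots> = emeasure (density N L) (space N)" by (subst emeasure_density) (auto intro!: nn_integral_cong)
  also have "\<dots> = 1" using L.emeasure_space_1 by simp
  finally have L1: "integral\<^sup>L N L = 1" by simp
  define \<Lambda> where "\<Lambda> X = (\<Prod>r<n. L (X r))" for X
  have [measurable]: "\<Lambda> \<in> borel_measurable (Pi\<^sub>M {..<n} (\<lambda>_. N))"
    unfolding \<Lambda>_def by (intro borel_measurable_prod) auto
  have \<Lambda>0: "0 \<le> \<Lambda> X" for X unfolding \<Lambda>_def by (intro prod_nonneg) (auto simp: L0)
  have D: "Pi\<^sub>M {..<n} (\<lambda>_. density N L) = density (Pi\<^sub>M {..<n} (\<lambda>_. N)) (\<lambda>X. ennreal (\<Lambda> X))"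
    unfolding \<Lambda>_def by (rule PiM_density_iid[OF N NL L L0])
  have sq: "(\<Lambda> X)\<^sup>2 = (\<Prod>r<n. (L (X r))\<^sup>2)" for X by (simp add: \<Lambda>_def prod_power_distrib)
  have i2: "integrable (Pi\<^sub>M {..<n} (\<lambda>_. N)) (\<lambda>X. (\<Lambda> X)\<^sup>2)"
    unfolding sq using L2 by (intro PN.product_integrable_prod) auto
  have "(\<integral>X. (\<Lambda> X)\<^sup>2 \<partial>Pi\<^sub>M {..<n} (\<lambda>_. N)) = (\<integral>x. (L x)\<^sup>2 \<partial>N) ^ n"
    unfolding sq using PN.product_integral_prod[of "{..<n}" "\<lambda>_ x. (L x)\<^sup>2"] L2 by simp
  also have "\<dots> \<le> (1 + q) ^ n" using chi by (intro power_mono) (auto intro: integral_nonneg_AE)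
  finally have e2: "(\<integral>X. (\<Lambda> X)\<^sup>2 \<partial>Pi\<^sub>M {..<n} (\<lambda>_. N)) - 1 \<le> (1 + q) ^ n - 1" by simp
  have e1: "integral\<^sup>L (Pi\<^sub>M {..<n} (\<lambda>_. N)) \<Lambda> = 1"
    unfolding \<Lambda>_def using PN.product_integral_prod[of "{..<n}" "\<lambda>_. L"] Li L1 by simp
  have PN: "prob_space (Pi\<^sub>M {..<n} (\<lambda>_. N))" by (intro prob_space_PiM) (rule N)
  have "(integral\<^sup>L (Pi\<^sub>M {..<n} (\<lambda>_. density N L)) T - integral\<^sup>L (Pi\<^sub>M {..<n} (\<lambda>_. N)) T)\<^sup>2
    \<le> (\<integral>X. (T X - integral\<^sup>L (Pi\<^sub>M {..<n} (\<lambda>_. N)) T)\<^sup>2 \<partial>Pi\<^sub>M {..<n} (\<lambda>_. N)) * ((\<integral>X. (\<Lambda> X)\<^sup>2 \<partial>Pi\<^sub>M {..<n} (\<lambda>_. N)) - 1)"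
    unfolding D using T(3)[unfolded D] by (intro chapman_robbins PN T \<Lambda>0 i2 e1) auto
  also have "\<dots> \<le> (\<integral>X. (T X - integral\<^sup>L (Pi\<^sub>M {..<n} (\<lambda>_. N)) T)\<^sup>2 \<partial>Pi\<^sub>M {..<n} (\<lambda>_. N)) * ((1 + q) ^ n - 1)"
    using e2 by (intro mult_left_mono) (auto intro: integral_nonneg_AE)
  finally show ?thesis .
qed

section \<open>Exponential tilts of the normal law\<close>

lemma exp_taylor2: "\<bar>exp x - 1 - x\<bar> \<le> x\<^sup>2 / 2 * exp \<bar>x\<bar>" for x :: real
proof -
  obtain t where t: "\<bar>t\<bar> \<le> \<bar>x\<bar>" "exp x = (\<Sum>m<2. x ^ m / fact m) + exp t / fact 2 * x ^ 2"
    using Maclaurin_exp_le by blast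
  have e: "exp x - 1 - x = x\<^sup>2 / 2 * exp t" using t(2) by (simp add: numeral_2_eq_2)
  have "\<bar>exp x - 1 - x\<bar> = x\<^sup>2 / 2 * exp t" unfolding e by (simp add: abs_mult)
  also have "\<dots> \<le> x\<^sup>2 / 2 * exp \<bar>x\<bar>" using t(1) by (intro mult_left_mono) auto
  finally show ?thesis .
qed

lemma power4_le_exp: "0 \<le> z \<Longrightarrow> z ^ 4 \<le> 24 * exp z" for z :: real
proof -
  assume z: "0 \<le> z"
  obtain t where t: "exp z = (\<Sum>m<5. z ^ m / fact m) + exp t / fact 5 * z ^ 5"
    using Maclaurin_exp_le by blast
  have "z ^ 4 / fact 4 \<le> (\<Sum>m<5. z ^ m / fact m)" using z by (intro member_le_sum) auto
  also have "\<dots> \<le> exp z" using t z by simp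
  finally show ?thesis by (simp add: fact_numeral)
qed

context prec_matrix
begin

definition prodY :: "nat \<Rightarrow> nat \<Rightarrow> (nat \<Rightarrow> real) \<Rightarrow> real" where
  "prodY i j x = ip p (acol i) x * ip p (acol j) x"

lemma prodY_moments:
  assumes "i < p" "j < p"
  shows "integrable N (prodY i j)" "integral\<^sup>L N (prodY i j) = A $$ (i,j)"
    "integrable N (\<lambda>x. (prodY i j x - A $$ (i,j))\<^sup>2)" "(\<integral>x. (prodY i j x - A $$ (i,j))\<^sup>2 \<partial>N) = sigma_sq A i j"
  using ip_product[of "acol i" "acol j"] ip_product_variance[of "acol i" "acol j"] V_acol[OF assms(1), of "acol j"]
  by (simp_all add: prodY_def[abs_def] sigma_sq_V[OF assms])

lemma prodY_measurable [measurable]: "prodY i j \<in> borel_measurable N"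
  unfolding prodY_def[abs_def] using measurable_ip[of "acol i"] measurable_ip[of "acol j"] by measurable

text \<open>Chosen so that 2 (2 s0) C3 = 1/2. The squared projection on a column has variance
  parameter at most C3, so exp(2 s0 times this square) has mean at most sqrt 2, bounded by
  2.\<close>

definition s0 :: real where "s0 = 1 / (8 * C3)"

lemma s0: "0 < s0" using C3 by (simp add: s0_def)

lemma prodY_exp:
  assumes "i < p" "j < p"
  shows "mean_le N (\<lambda>x. exp (2 * s0 * \<bar>prodY i j x\<bar>)) 2"
proof -
  have m: "mean_le N (\<lambda>x. exp (2 * s0 * (ip p (acol k) x)\<^sup>2)) 2" if "k < p" for k
  proof -
    have V: "V (acol k) (acol k) \<le> C3" using V_acol[OF that] diag_bounds[OF that] by simp
    then have 1: "2 * (2 * s0) * V (acol k) (acol k) \<le> 1 / 2" using C3 by (simp add: s0_def field_simps)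
    then have "(\<integral>\<^sup>+x. ennreal (exp (2 * s0 * (ip p (acol k) x)\<^sup>2 + 0)) \<partial>N) = ennreal (exp 0 / sqrt (1 - 2 * (2 * s0) * V (acol k) (acol k)))"
      by (intro nn_integral_exp_ip) simp
    also have "\<dots> \<le> ennreal 2"
    proof (rule ennreal_leI)
      have "1 / 2 \<le> sqrt (1 - 2 * (2 * s0) * V (acol k) (acol k))"
        using 1 by (intro real_le_rsqrt) (simp add: power2_eq_square)
      moreover have "exp 0 / r \<le> 2" if "1 / 2 \<le> r" for r :: real using that by (simp add: divide_le_eq)
      ultimately show "exp 0 / sqrt (1 - 2 * (2 * s0) * V (acol k) (acol k)) \<le> 2" by blast
    qed
    finally show ?thesis using measurable_ip[of "acol k"] by (simp add: mean_le_def)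
  qed
  have "mean_le N (\<lambda>x. 1/2 * exp (2 * s0 * (ip p (acol i) x)\<^sup>2) + 1/2 * exp (2 * s0 * (ip p (acol j) x)\<^sup>2)) (1/2 * 2 + 1/2 * 2)"
    by (intro mean_le_add mean_le_scale m assms) auto
  then have "mean_le N (\<lambda>x. 1/2 * exp (2 * s0 * (ip p (acol i) x)\<^sup>2) + 1/2 * exp (2 * s0 * (ip p (acol j) x)\<^sup>2)) 2" by simp
  then show ?thesis
  proof (rule mean_le_AE)
    show "AE x in N. exp (2 * s0 * \<bar>prodY i j x\<bar>) \<le> 1/2 * exp (2 * s0 * (ip p (acol i) x)\<^sup>2) + 1/2 * exp (2 * s0 * (ip p (acol j) x)\<^sup>2)"
    proof (rule AE_I2)
      fix x
      define a where "a = s0 * (ip p (acol i) x)\<^sup>2"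
      define b where "b = s0 * (ip p (acol j) x)\<^sup>2"
      have "2 * \<bar>prodY i j x\<bar> \<le> (ip p (acol i) x)\<^sup>2 + (ip p (acol j) x)\<^sup>2"
        using sum_squares_bound[of "\<bar>ip p (acol i) x\<bar>" "\<bar>ip p (acol j) x\<bar>"] by (simp add: prodY_def abs_mult)
      then have "s0 * (2 * \<bar>prodY i j x\<bar>) \<le> s0 * ((ip p (acol i) x)\<^sup>2 + (ip p (acol j) x)\<^sup>2)"
        using s0 by (intro mult_left_mono) auto
      then have "exp (2 * s0 * \<bar>prodY i j x\<bar>) \<le> exp (a + b)" by (simp add: a_def b_def algebra_simps)
      also have "\<dots> = exp a * exp b" by (rule exp_add)
      also have "\<dots> \<le> ((exp a)\<^sup>2 + (exp b)\<^sup>2) / 2" using sum_squares_bound[of "exp a" "exp b"] by simp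
      also have "\<dots> = 1/2 * exp (2 * a) + 1/2 * exp (2 * b)" by (simp add: exp_double)
      finally show "exp (2 * s0 * \<bar>prodY i j x\<bar>) \<le> 1/2 * exp (2 * s0 * (ip p (acol i) x)\<^sup>2) + 1/2 * exp (2 * s0 * (ip p (acol j) x)\<^sup>2)"
        by (simp add: a_def b_def mult.assoc)
    qed
  qed auto
qed

definition tilt :: "nat \<Rightarrow> nat \<Rightarrow> real \<Rightarrow> (nat \<Rightarrow> real) \<Rightarrow> real" where
  "tilt i j t x = exp (- t * prodY i j x)"

lemma tilt_measurable [measurable]: "tilt i j t \<in> borel_measurable N"
  unfolding tilt_def[abs_def] by measurable

text \<open>The condition 2 t <= s0 spends only half of the available exponential moment on the
  tilt; the other half absorbs the fourth power of Y in the squared Taylor remainder. The constant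
  is 24 / 4 times the moment bound 2.\<close>

lemma tilt_integrable:
  assumes "i < p" "j < p" "0 \<le> t" "2 * t \<le> s0"
  shows "integrable N (tilt i j t)" "integrable N (\<lambda>x. (tilt i j t x)\<^sup>2)"
    "mean_le N (\<lambda>x. (tilt i j t x - 1 + t * prodY i j x)\<^sup>2) (12 * t ^ 4 / s0 ^ 4)"
proof -
  let ?e = "\<lambda>x. exp (2 * s0 * \<bar>prodY i j x\<bar>)"
  have "mean_le N (\<lambda>x. (tilt i j t x)\<^sup>2) 2"
  proof (rule mean_le_AE[OF prodY_exp[OF assms(1,2)]])
    show "AE x in N. (tilt i j t x)\<^sup>2 \<le> ?e x"
    proof (rule AE_I2)
      fix x
      have "- (2 * t) * prodY i j x \<le> \<bar>- (2 * t) * prodY i j x\<bar>" by (rule abs_ge_self)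
      also have "\<dots> = (2 * t) * \<bar>prodY i j x\<bar>" using assms by (simp add: abs_mult)
      also have "\<dots> \<le> 2 * s0 * \<bar>prodY i j x\<bar>" using assms s0 by (intro mult_right_mono) auto
      finally have "exp (- (2 * t) * prodY i j x) \<le> ?e x" by simp
      moreover have "(exp (- t * w))\<^sup>2 = exp (- (2 * t) * w)" for w :: real
        unfolding power2_eq_square exp_add[symmetric] by simp
      ultimately show "(tilt i j t x)\<^sup>2 \<le> ?e x" unfolding tilt_def by (simp only:)
    qed
  qed auto
  from mean_le_integral(1)[OF this] show t2: "integrable N (\<lambda>x. (tilt i j t x)\<^sup>2)" .
  then show "integrable N (tilt i j t)" by (intro N.square_integrable_imp_integrable[OF tilt_measurable])
  have "mean_le N (\<lambda>x. (6 * t ^ 4 / s0 ^ 4) * ?e x) ((6 * t ^ 4 / s0 ^ 4) * 2)"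
    using s0 assms by (intro mean_le_scale prodY_exp) auto
  then have "mean_le N (\<lambda>x. (6 * t ^ 4 / s0 ^ 4) * ?e x) (12 * t ^ 4 / s0 ^ 4)" by simp
  then show "mean_le N (\<lambda>x. (tilt i j t x - 1 + t * prodY i j x)\<^sup>2) (12 * t ^ 4 / s0 ^ 4)"
  proof (rule mean_le_AE)
    show "AE x in N. (tilt i j t x - 1 + t * prodY i j x)\<^sup>2 \<le> (6 * t ^ 4 / s0 ^ 4) * ?e x"
    proof (rule AE_I2)
      fix x
      define y where "y = \<bar>prodY i j x\<bar>"
      have y: "0 \<le> y" by (simp add: y_def)
      have "\<bar>tilt i j t x - 1 + t * prodY i j x\<bar> \<le> (t * y)\<^sup>2 / 2 * exp (t * y)"
        using exp_taylor2[of "- t * prodY i j x"] assms by (simp add: tilt_def y_def abs_mult power_mult_distrib)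
      then have "\<bar>tilt i j t x - 1 + t * prodY i j x\<bar>\<^sup>2 \<le> ((t * y)\<^sup>2 / 2 * exp (t * y))\<^sup>2" by (intro power_mono) auto
      also have "\<dots> = t ^ 4 / 4 * y ^ 4 * exp (2 * t * y)"
      proof -
        have "(exp (t * y))\<^sup>2 = exp (2 * t * y)"
          unfolding power2_eq_square exp_add[symmetric] by simp
        moreover have "((t * y)\<^sup>2 / 2 * e)\<^sup>2 = t ^ 4 / 4 * y ^ 4 * e\<^sup>2" for e
          by (simp add: power_mult_distrib power_divide)
        ultimately show ?thesis by (simp only:)
      qed
      also have "\<dots> \<le> t ^ 4 / 4 * (24 * exp (s0 * y) / s0 ^ 4) * exp (s0 * y)"
      proof (intro mult_mono)
        have "(s0 * y) ^ 4 \<le> 24 * exp (s0 * y)" using s0 y by (intro power4_le_exp) auto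
        then show "y ^ 4 \<le> 24 * exp (s0 * y) / s0 ^ 4" using s0 by (simp add: power_mult_distrib field_simps)
        show "exp (2 * t * y) \<le> exp (s0 * y)"
          unfolding exp_le_cancel_iff by (intro mult_right_mono assms y)
      qed (use s0 in auto)
      also have "\<dots> = (6 * t ^ 4 / s0 ^ 4) * (exp (s0 * y) * exp (s0 * y))" by simp
      also have "exp (s0 * y) * exp (s0 * y) = ?e x" unfolding y_def exp_add[symmetric] by simp
      finally show "(tilt i j t x - 1 + t * prodY i j x)\<^sup>2 \<le> (6 * t ^ 4 / s0 ^ 4) * ?e x" by simp
    qed
  qed auto
qed

text \<open>The variance of the tilt is at most its second moment about c = 1 - t A_ij. Around c the
  tilt is minus the linear term t (Y - A_ij), of second moment t^2 \<sigma>^2, plus a Taylor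
  remainder of second moment O(t^4). Weighting the cross term by t yields the factor 1 + t and an
  error of order t^3. The bound on the normaliser is exp x >= 1 + x.\<close>

lemma tilt_chi_square:
  assumes "i < p" "j < p" "0 < t" "2 * t \<le> s0" "t \<le> 1"
  defines "\<phi> \<equiv> integral\<^sup>L N (tilt i j t)"
  shows "1 - t * C3 \<le> \<phi>"
    and "(\<integral>x. (tilt i j t x)\<^sup>2 \<partial>N) - \<phi>\<^sup>2 \<le> t\<^sup>2 * ((1 + t) * (sigma_sq A i j + 12 / s0 ^ 4 * t))"
proof -
  note ti = tilt_integrable[OF assms(1,2) less_imp_le[OF assms(3)] assms(4)]
  note pm = prodY_moments[OF assms(1,2)]
  have "1 - t * A $$ (i,j) = (\<integral>x. 1 - t * prodY i j x \<partial>N)"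
    using pm by (simp add: N.prob_space)
  also have "\<dots> \<le> \<phi>"
    unfolding \<phi>_def
  proof (rule integral_mono)
    fix x show "1 - t * prodY i j x \<le> tilt i j t x"
      unfolding tilt_def using exp_ge_add_one_self[of "- t * prodY i j x"] by simp
  qed (use pm ti in auto)
  finally have "1 - t * A $$ (i,j) \<le> \<phi>" .
  moreover have "t * A $$ (i,j) \<le> t * C3" using offdiag_bound[OF assms(1,2)] assms by (intro mult_left_mono) auto
  ultimately show "1 - t * C3 \<le> \<phi>" by linarith
  define \<xi> where "\<xi> x = tilt i j t x - 1 + t * prodY i j x" for x
  have R: "mean_le N (\<lambda>x. (\<xi> x)\<^sup>2) (12 * t ^ 4 / s0 ^ 4)" using ti(3) by (simp add: \<xi>_def)
  define z where "z x = t * (prodY i j x - A $$ (i,j))" for x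
  have z2: "integrable N (\<lambda>x. (z x)\<^sup>2)" "(\<integral>x. (z x)\<^sup>2 \<partial>N) = t\<^sup>2 * sigma_sq A i j"
    using pm by (simp_all add: z_def power_mult_distrib)
  define c where "c = 1 - t * A $$ (i,j)"
  have tc2: "integrable N (\<lambda>x. (tilt i j t x - c)\<^sup>2)" "(\<integral>x. (tilt i j t x - c)\<^sup>2 \<partial>N) = (\<integral>x. (tilt i j t x)\<^sup>2 \<partial>N) - 2 * c * \<phi> + c\<^sup>2"
    using ti by (simp_all add: power2_diff N.prob_space \<phi>_def)
  have "(\<integral>x. (tilt i j t x)\<^sup>2 \<partial>N) - \<phi>\<^sup>2 \<le> (\<integral>x. (tilt i j t x - c)\<^sup>2 \<partial>N)"
    unfolding tc2(2) using zero_le_power2[of "\<phi> - c"] by (simp add: power2_diff algebra_simps)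
  also have "\<dots> \<le> (\<integral>x. (1 + t) * (z x)\<^sup>2 + (1 + 1 / t) * (\<xi> x)\<^sup>2 \<partial>N)"
  proof (rule integral_mono)
    fix x
    have e: "tilt i j t x - c = \<xi> x - z x" by (simp add: \<xi>_def z_def c_def algebra_simps)
    have "2 * (sqrt t * \<bar>z x\<bar>) * (\<bar>\<xi> x\<bar> / sqrt t) \<le> (sqrt t * \<bar>z x\<bar>)\<^sup>2 + (\<bar>\<xi> x\<bar> / sqrt t)\<^sup>2" by (rule sum_squares_bound)
    then have "2 * \<bar>z x\<bar> * \<bar>\<xi> x\<bar> \<le> t * (z x)\<^sup>2 + (\<xi> x)\<^sup>2 / t" using assms by (simp add: power_mult_distrib power_divide)
    moreover have "- (2 * \<xi> x * z x) \<le> 2 * \<bar>z x\<bar> * \<bar>\<xi> x\<bar>"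
    proof -
      have "- (2 * \<xi> x * z x) \<le> \<bar>2 * \<xi> x * z x\<bar>" by (rule abs_ge_minus_self)
      then show ?thesis by (simp add: abs_mult mult.commute)
    qed
    ultimately have "- (2 * \<xi> x * z x) \<le> t * (z x)\<^sup>2 + (\<xi> x)\<^sup>2 / t" by (rule order_trans[rotated])
    then show "(tilt i j t x - c)\<^sup>2 \<le> (1 + t) * (z x)\<^sup>2 + (1 + 1 / t) * (\<xi> x)\<^sup>2"
      unfolding e by (simp add: power2_diff distrib_right)
  qed (use tc2 z2 mean_le_integral(1)[OF R] in auto)
  also have "\<dots> = (1 + t) * (t\<^sup>2 * sigma_sq A i j) + (1 + 1 / t) * (\<integral>x. (\<xi> x)\<^sup>2 \<partial>N)"
    using z2 mean_le_integral(1)[OF R] by simp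
  also have "\<dots> \<le> (1 + t) * (t\<^sup>2 * sigma_sq A i j) + (1 + 1 / t) * (12 * t ^ 4 / s0 ^ 4)"
    using mean_le_integral(2)[OF R] assms by (intro add_left_mono mult_left_mono) auto
  also have "(1 + 1 / t) * (12 * t ^ 4 / s0 ^ 4) = (1 + t) * (t\<^sup>2 * (12 / s0 ^ 4 * t))"
  proof -
    have "t ^ 4 = t\<^sup>2 * t * t" by (simp add: eval_nat_numeral)
    then show ?thesis using assms by (simp add: field_simps)
  qed
  finally show "(\<integral>x. (tilt i j t x)\<^sup>2 \<partial>N) - \<phi>\<^sup>2 \<le> t\<^sup>2 * ((1 + t) * (sigma_sq A i j + 12 / s0 ^ 4 * t))"
    by (simp add: algebra_simps)
qed

text \<open>The rank-two change of the precision matrix adds 2 t Y to the quadratic form, so the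
  density changes by a multiple of the tilt. The ratio of determinants is never computed: total mass
  1 fixes the multiple.\<close>

lemma perturbed_normal_vec:
  assumes ij: "i < p" "j < p" and t: "0 < t" "2 * t \<le> s0"
    and B: "pd_matrix p B" and Beq: "\<And>k l. k < p \<Longrightarrow> l < p \<Longrightarrow> B $$ (k,l) = A $$ (k,l) + t * (A $$ (k,i) * A $$ (l,j) + A $$ (k,j) * A $$ (l,i))"
  shows "normal_vec p (minv B) = density N (\<lambda>x. ennreal (tilt i j t x / integral\<^sup>L N (tilt i j t)))"
proof -
  interpret B: pd_matrix p B by fact
  define \<phi> where "\<phi> = integral\<^sup>L N (tilt i j t)"
  have q: "qf p (\<lambda>k l. B $$ (k,l)) x = qf p (\<lambda>k l. A $$ (k,l)) x + 2 * t * prodY i j x" for x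
  proof -
    have "qf p (\<lambda>k l. B $$ (k,l)) x = (\<Sum>k<p. \<Sum>l<p. x k * A $$ (k,l) * x l + (t * (A $$ (k,i) * x k * (A $$ (l,j) * x l)) + t * (A $$ (k,j) * x k * (A $$ (l,i) * x l))))"
      unfolding qf_def by (intro sum.cong refl) (simp add: Beq algebra_simps)
    also have "\<dots> = qf p (\<lambda>k l. A $$ (k,l)) x + (t * (ip p (acol i) x * ip p (acol j) x) + t * (ip p (acol j) x * ip p (acol i) x))"
      unfolding qf_def ip_def sum.distrib sum_product by (simp add: sum_distrib_left)
    finally show ?thesis by (simp add: prodY_def)
  qed
  define a where "a = sqrt ((2 * pi) ^ p / det A)"
  define b where "b = sqrt ((2 * pi) ^ p / det B)"
  have ab: "0 < a" "0 < b" using det_pos B.det_pos by (simp_all add: a_def b_def)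
  have dens: "normal_vec_density p (minv B) x = normal_vec_density p (minv A) x * (a / b * tilt i j t x)" for x
  proof -
    have "exp (- qf p (\<lambda>k l. B $$ (k,l)) x / 2) = exp (- qf p (\<lambda>k l. A $$ (k,l)) x / 2) * tilt i j t x"
      unfolding q tilt_def by (simp add: field_simps flip: exp_add)
    then show ?thesis
      unfolding normal_vec_density_minv B.normal_vec_density_minv a_def[symmetric] b_def[symmetric] using ab by simp
  qed
  have nn: "0 \<le> normal_vec_density p (minv A) x" for x
    unfolding normal_vec_density_minv a_def[symmetric] using ab by simp
  have tm: "(\<lambda>x. ennreal (a / b * tilt i j t x)) \<in> borel_measurable (Pi\<^sub>M {..<p} (\<lambda>_. lborel))"
    using tilt_measurable[of i j t] by (simp add: normal_vec_def measurable_density_eq1)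
  have D: "normal_vec p (minv B) = density N (\<lambda>x. ennreal (a / b * tilt i j t x))"
  proof -
    have "(\<lambda>x. ennreal (normal_vec_density p (minv B) x)) =
        (\<lambda>x. ennreal (normal_vec_density p (minv A) x) * ennreal (a / b * tilt i j t x))"
      unfolding dens by (intro ext ennreal_mult' nn)
    then show ?thesis
      unfolding normal_vec_def using measurable_normal_vec_density tm by (subst density_density_eq) auto
  qed
  have t0: "0 \<le> tilt i j t x" for x by (simp add: tilt_def)
  have "1 = emeasure (normal_vec p (minv B)) (space N)"
    using prob_space.emeasure_space_1[OF B.prob_space_normal_vec] unfolding D space_density by (rule HOL.sym)
  also have "\<dots> = (\<integral>\<^sup>+x. ennreal (a / b * tilt i j t x) \<partial>N)"
    unfolding D by (subst emeasure_density[OF _ sets.top]) (auto intro!: nn_integral_cong)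
  also have "\<dots> = ennreal (\<integral>x. a / b * tilt i j t x \<partial>N)"
    using tilt_integrable(1)[OF ij _ t(2)] t ab t0 by (intro nn_integral_eq_integral) auto
  finally have "(\<integral>x. a / b * tilt i j t x \<partial>N) = 1" by (metis ennreal_eq_1)
  then have "a / b * \<phi> = 1" unfolding \<phi>_def by (simp only: integral_mult_right_zero)
  moreover from this have "\<phi> \<noteq> 0" by auto
  ultimately have "a / b = 1 / \<phi>" by (simp only: eq_divide_eq) simp
  then show ?thesis unfolding D \<phi>_def[symmetric] by simp
qed

end

section \<open>The two regimes\<close>

text \<open>
  When \<open>p \<le> n\<^sup>1\<^sup>/\<^sup>8\<close>, exceptional events of probability polynomial in \<open>1 / p\<close> are not negligible; there
  all coordinates are treated as active, with a noise level of order \<open>n\<^sup>-\<^sup>3\<^sup>/\<^sup>8\<close>.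
  Otherwise the noise level is \<open>44 \<surd>(log p / n)\<close>, where \<open>44\<^sup>2 / 16 = 121\<close> leaves \<open>p\<^sup>-\<^sup>1\<^sup>2\<^sup>1\<close> as tail probability,
  enough to beat \<open>(n p)\<^sup>1\<^sup>2 \<le> p\<^sup>1\<^sup>0\<^sup>8\<close>.
\<close>

definition regime_error :: "nat \<Rightarrow> real \<Rightarrow> real \<Rightarrow> real" where
  "regime_error n P dm = real n powr (-1/8) + \<bar>dm * ln P / sqrt (real n)\<bar>"

lemma ln_ge_half: "2 \<le> x \<Longrightarrow> 1 / 2 \<le> ln x" for x :: real
proof -
  assume x: "2 \<le> x"
  have "1 - 1 / 2 \<le> ln (2::real)" using ln_le_minus_one[of "1/2 :: real"] by (simp add: ln_div)
  also have "ln 2 \<le> ln x" using x by simp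
  finally show ?thesis by simp
qed

lemma regime_choice:
  fixes n p :: nat and dm C1 :: real
  assumes n: "16 \<le> n" and p: "1 \<le> p" and C1: "0 < C1" and dm: "1 \<le> C1 * dm"
    and a1: "sqrt (ln (real n) / real n) \<le> real n powr (-3/8)"
    and a2: "12 * real n ^ 14 * exp (- (real n powr (1/4) / 16)) \<le> 1"
  defines "rate \<equiv> sqrt (ln (real p) / real n)"
  shows "\<exists>u s. 0 < u \<and> 1 \<le> s \<and> rate \<le> u \<and> (s = real p \<or> (s = C1 * dm \<and> 0 < rate \<and> u = 44 * rate))
    \<and> u * s \<le> (1 + 2000 * C1) * regime_error n (real p) dm
    \<and> sqrt (real n) * (s * u\<^sup>2) \<le> (1 + 2000 * C1) * regime_error n (real p) dm
    \<and> 12 * (real p)\<^sup>2 * exp (- (real n * u\<^sup>2 / 16)) \<le> 1 / (real n * real p) ^ 12"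
proof -
  define N where "N = real n"
  define P where "P = real p"
  have N: "16 \<le> N" and P: "1 \<le> P" using n p by (simp_all add: N_def P_def)
  define e1 where "e1 = N powr (-1/8)"
  define e2 where "e2 = dm * ln P / sqrt N"
  have re: "regime_error n P dm = e1 + \<bar>e2\<bar>" by (simp add: regime_error_def e1_def e2_def N_def P_def)
  have e10: "0 \<le> e1" by (simp add: e1_def)
  have "0 < C1 * dm" using dm by linarith
  then have dm0: "0 < dm" using C1 by (simp add: zero_less_mult_iff)
  have e20: "0 \<le> e2" using dm0 P N by (simp add: e2_def)
  show ?thesis
  proof (cases "P ^ 8 \<le> N")
    case True
    \<comment> \<open>With p at most N^(1/8) the exponent balances all demands: u p <= N^(-1/4),
      sqrt N p u^2 <= N^(-1/8), and N u^2 = N^(1/4), so the tail exp(- N^(1/4) / 16) beats every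
      power of N.\<close>
    define u where "u = N powr (-3/8)"
    have "(P ^ 8) powr (1/8) \<le> N powr (1/8)" using True P by (intro powr_mono2) auto
    moreover have "(P ^ 8) powr (1/8) = P"
    proof -
      have "P ^ 8 = P powr 8" using P by simp
      then have "(P ^ 8) powr (1/8) = P powr (8 * (1/8))" by (simp only: powr_powr)
      then show ?thesis using P by simp
    qed
    ultimately have PN: "P \<le> N powr (1/8)" by simp
    have PN1: "P \<le> N" using True P power_increasing[of 1 8 P] by simp
    have u0: "0 < u" using N by (simp add: u_def)
    have u2: "u\<^sup>2 = N powr (-3/4)" unfolding u_def power2_eq_square by (subst powr_add[symmetric]) simp
    have r: "rate \<le> u"
    proof -
      have "rate \<le> sqrt (ln N / N)" unfolding rate_def P_def[symmetric] N_def[symmetric]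
        using PN1 P N by (intro real_sqrt_le_mono divide_right_mono) auto
      then show ?thesis using a1 by (simp add: u_def N_def)
    qed
    have us: "u * P \<le> e1"
    proof -
      have "u * P \<le> N powr (-3/8) * N powr (1/8)" unfolding u_def using PN by (intro mult_left_mono) auto
      also have "\<dots> = N powr (-1/4)" by (subst powr_add[symmetric]) simp
      also have "\<dots> \<le> e1" unfolding e1_def using N by (intro powr_mono) auto
      finally show ?thesis .
    qed
    have us2: "sqrt N * (P * u\<^sup>2) \<le> e1"
    proof -
      have "sqrt N * (P * u\<^sup>2) \<le> N powr (1/2) * (N powr (1/8) * N powr (-3/4))"
        unfolding u2 using PN N P by (intro mult_mono mult_nonneg_nonneg) (auto simp: powr_half_sqrt)
      also have "\<dots> = e1" unfolding e1_def powr_add[symmetric] by simp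
      finally show ?thesis .
    qed
    have pr: "12 * P\<^sup>2 * exp (- (N * u\<^sup>2 / 16)) \<le> 1 / (N * P) ^ 12"
    proof -
      have nu: "N * u\<^sup>2 = N powr (1/4)"
      proof -
        have "N * u\<^sup>2 = N powr 1 * N powr (-3/4)" using N by (simp add: u2)
        also have "\<dots> = N powr (1/4)" unfolding powr_add[symmetric] by simp
        finally show ?thesis .
      qed
      have "P ^ 14 \<le> (N powr (1/8)) ^ 14" using PN P by (intro power_mono) auto
      also have "\<dots> = N powr (14/8)" using N by (simp add: powr_power)
      also have "\<dots> \<le> N powr 2" using N by (intro powr_mono) auto
      also have "\<dots> = N\<^sup>2" using N by simp
      finally have P14: "P ^ 14 \<le> N\<^sup>2" .
      have "12 * P\<^sup>2 * exp (- (N * u\<^sup>2 / 16)) * (N * P) ^ 12 = 12 * (P ^ 14 * N ^ 12) * exp (- (N powr (1/4) / 16))"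
      proof -
        have *: "12 * x * e * (z * y) = 12 * (x * y * z) * e" for x y e z :: real by simp
        have "P\<^sup>2 * P ^ 12 = P ^ 14" unfolding power_add[symmetric] by simp
        then show ?thesis unfolding nu power_mult_distrib * by simp
      qed
      also have "\<dots> \<le> 12 * (N\<^sup>2 * N ^ 12) * exp (- (N powr (1/4) / 16))"
        using P14 N by (intro mult_right_mono mult_left_mono) auto
      also have "N\<^sup>2 * N ^ 12 = N ^ 14" unfolding power_add[symmetric] by simp
      also have "12 * N ^ 14 * exp (- (N powr (1/4) / 16)) \<le> 1" using a2 by (simp add: N_def)
      finally show ?thesis using N P by (subst pos_le_divide_eq) auto
    qed
    have b: "x \<le> (1 + 2000 * C1) * (e1 + \<bar>e2\<bar>)" if "x \<le> e1" for x
    proof -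
      have "1 * (e1 + 0) \<le> (1 + 2000 * C1) * (e1 + \<bar>e2\<bar>)" using C1 e10 by (intro mult_mono add_mono) auto
      then show ?thesis using that by simp
    qed
    show ?thesis
      unfolding re P_def[symmetric] N_def[symmetric]
      using r P u0 b[OF us] b[OF us2] pr by - (rule exI[of _ u], rule exI[of _ P], simp)
  next
    case False
    then have PN: "N < P ^ 8" by simp
    have "2 \<le> p"
    proof (rule ccontr)
      assume "\<not> 2 \<le> p"
      then have "p = 1" using p by simp
      then show False using PN N by (simp add: P_def)
    qed
    then have P2: "2 \<le> P" by (simp add: P_def)
    then have lnP: "1 / 2 \<le> ln P" by (rule ln_ge_half)
    define u where "u = 44 * rate"
    define s where "s = C1 * dm"
    have r2: "rate\<^sup>2 = ln P / N" using lnP N by (simp add: rate_def P_def N_def)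
    have r0: "0 < rate" using lnP N by (simp add: rate_def P_def[symmetric] N_def[symmetric])
    have "rate = sqrt (ln P) / sqrt N" by (simp add: rate_def P_def N_def real_sqrt_divide)
    \<comment> \<open>The sparsity assumption controls d log p / sqrt n, so the square root of the
      logarithm is traded for the logarithm; P >= 2 keeps the logarithm away from 0.\<close>
    moreover have "sqrt (ln P) \<le> 2 * ln P"
    proof (rule real_le_lsqrt)
      have "ln P * 1 \<le> ln P * (4 * ln P)" using lnP by (intro mult_left_mono) auto
      then show "ln P \<le> (2 * ln P)\<^sup>2" by (simp add: power2_eq_square)
    qed (use lnP in auto)
    ultimately have rl: "rate \<le> 2 * ln P / sqrt N" using N by (simp add: divide_right_mono)
    \<comment> \<open>The constant 2000 covers 88 = 2 * 44 here and 1936 = 44^2 in the estimate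
      after it.\<close>
    have us: "u * s \<le> 2000 * C1 * e2"
    proof -
      have "u * s \<le> 44 * (2 * ln P / sqrt N) * s" unfolding u_def using rl dm s_def by (intro mult_right_mono mult_left_mono) auto
      also have "\<dots> = 88 * (C1 * e2)" by (simp add: s_def e2_def)
      also have "\<dots> \<le> 2000 * (C1 * e2)" using C1 e20 by (intro mult_right_mono) auto
      finally show ?thesis by simp
    qed
    have us2: "sqrt N * (s * u\<^sup>2) \<le> 2000 * C1 * e2"
    proof -
      have "sqrt N / N = 1 / sqrt N" using N by (simp add: real_div_sqrt field_simps)
      moreover have "sqrt N * (s * u\<^sup>2) = 1936 * (C1 * (dm * ln P)) * (sqrt N / N)"
        by (simp add: u_def s_def power_mult_distrib r2)
      ultimately have "sqrt N * (s * u\<^sup>2) = 1936 * (C1 * e2)" by (simp add: e2_def)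
      also have "\<dots> \<le> 2000 * (C1 * e2)" using C1 e20 by (intro mult_right_mono) auto
      finally show ?thesis by simp
    qed
    have pr: "12 * P\<^sup>2 * exp (- (N * u\<^sup>2 / 16)) \<le> 1 / (N * P) ^ 12"
    proof -
      have "N * u\<^sup>2 / 16 = 121 * ln P" using N by (simp add: u_def power_mult_distrib r2)
      then have ex: "exp (- (N * u\<^sup>2 / 16)) = 1 / P ^ 121"
        using P2 exp_of_nat_mult[of 121 "ln P"] by (simp add: exp_minus inverse_eq_divide)
      have "N ^ 12 \<le> (P ^ 8) ^ 12" using PN N by (intro power_mono) auto
      then have "12 * P\<^sup>2 * (N * P) ^ 12 \<le> 12 * P\<^sup>2 * ((P ^ 8) ^ 12 * P ^ 12)"
        unfolding power_mult_distrib using P by (intro mult_left_mono mult_right_mono) auto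
      also have "\<dots> = 12 * P ^ 110" unfolding mult.assoc power_mult[symmetric] power_add[symmetric] by simp
      also have "\<dots> \<le> P ^ 11 * P ^ 110"
      proof (intro mult_right_mono)
        have "(2::real) ^ 11 \<le> P ^ 11" using P2 by (intro power_mono) auto
        then show "12 \<le> P ^ 11" by simp
      qed simp
      also have "\<dots> = P ^ 121" unfolding power_add[symmetric] by simp
      finally have "12 * P\<^sup>2 * (N * P) ^ 12 / P ^ 121 \<le> 1" using P2 by simp
      moreover have "12 * P\<^sup>2 * (1 / P ^ 121) * (N * P) ^ 12 = 12 * P\<^sup>2 * (N * P) ^ 12 / P ^ 121" by simp
      ultimately have "12 * P\<^sup>2 * (1 / P ^ 121) * (N * P) ^ 12 \<le> 1" by argo
      then show ?thesis unfolding ex using N P2 by (subst pos_le_divide_eq) auto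
    qed
    have b: "x \<le> (1 + 2000 * C1) * (e1 + \<bar>e2\<bar>)" if "x \<le> 2000 * C1 * e2" for x
    proof -
      have "2000 * C1 * e2 \<le> (1 + 2000 * C1) * (e1 + \<bar>e2\<bar>)" using C1 e10 e20 by (intro mult_mono) auto
      then show ?thesis using that by linarith
    qed
    have "rate \<le> u" using r0 by (simp add: u_def)
    then show ?thesis
      unfolding re P_def[symmetric] N_def[symmetric]
      using r0 dm b[OF us] b[OF us2] pr by - (rule exI[of _ u], rule exI[of _ s], simp add: u_def s_def)
  qed
qed

section \<open>A remainder bound uniform over the parameter class\<close>

text \<open>The constant \<open>c3\<close> written outside the locale, times the square of the
  factor in L = Kc u and the constant of \<open>regime_choice\<close>. Like
  \<open>moment_const\<close>, which is \<open>c4\<close>, it is free of n, p and the precision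
  matrix.\<close>

definition remainder_const :: "real \<Rightarrow> real \<Rightarrow> real \<Rightarrow> real \<Rightarrow> real" where
  "remainder_const C1 C2 C3 cu = (64 * C3\<^sup>2 + sqrt (C2 * C3) * (2 * C3\<^sup>2 * (2 + 8 * C2 * C3))) * (2 * C3 + 1)
     * (2 * max C2 C3 + 2 * max C2 C3 * C2 + cu)\<^sup>2 * (1 + 2000 * C1)"

definition moment_const :: "real \<Rightarrow> real \<Rightarrow> real \<Rightarrow> real" where
  "moment_const C2 C3 h = 27 * (432 * (h ^ 4 + (512 + 16 * h ^ 4) * (2 * (inv_sqrt_mean ^ 16 * C3 ^ 4) + 210 * C2 ^ 4)) + 226 * C3 ^ 4)"

definition remainder_bound :: "real \<Rightarrow> real \<Rightarrow> real \<Rightarrow> real \<Rightarrow> nat \<Rightarrow> real \<Rightarrow> real \<Rightarrow> real" where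
  "remainder_bound C1 C2 C3 cu n P dm =
     (remainder_const C1 C2 C3 cu * regime_error n P dm)\<^sup>2 / real n
       + (moment_const C2 C3 (2 / (176 * C2 * max C2 C3)) + 1) / (real n)\<^sup>2"

text \<open>The bound depends on \<Theta> only through the class, so it holds for all members
  simultaneously. The smallness assumption collects every threshold of
  \<open>remainder_square\<close> into one condition on \<open>regime_error\<close>.\<close>

lemma remainder_uniform:
  fixes n p :: nat
  assumes C: "0 < C1" "0 < C2" "0 < C3" and cu: "0 \<le> cu"
    and n: "16 \<le> n" and ij: "i < p" "j < p" and \<Theta>: "\<Theta> \<in> prec_class C1 C2 C3 p \<T> d"
    and a1: "sqrt (ln (real n) / real n) \<le> real n powr (-3/8)"
    and a2: "12 * real n ^ 14 * exp (- (real n powr (1/4) / 16)) \<le> 1"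
    and lasso: "\<And>k. k = i \<or> k = j \<Longrightarrow> nodewise_lasso n p k (lam k) (\<gamma>hat k)"
    and lam: "\<And>k. k = i \<or> k = j \<Longrightarrow> 176 * C2 * max C2 C3 * sqrt (ln (real p) / real n) \<le> lam k"
      "\<And>k. k = i \<or> k = j \<Longrightarrow> lam k \<le> cu * sqrt (ln (real p) / real n)"
    and small: "(64 * C3 * max C2 C3 + 2 * C3 * ((2 + 8 * C2 * C3) * (2 * max C2 C3 + 2 * max C2 C3 * C2 + cu)) + 1)
       * ((1 + 2000 * C1) * regime_error n (real p) (max (d i) (d j))) \<le> 1"
  shows "mean_le (Pi\<^sub>M {..<n} (\<lambda>_. normal_vec p (minv \<Theta>)))
     (\<lambda>X. (desparsified n p i j lam \<gamma>hat X - (2 * \<Theta> $$ (i,j) - cov n p X (\<lambda>l. \<Theta> $$ (l,i)) (\<lambda>l. \<Theta> $$ (l,j))))\<^sup>2)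
     (remainder_bound C1 C2 C3 cu n (real p) (max (d i) (d j)))"
proof -
  interpret prec_matrix p \<Theta> C2 C3 using prec_class_prec_matrix[OF \<Theta> _ C(2,3)] ij by simp
  define K where "K = max C2 C3"
  define dm where "dm = max (d i) (d j)"
  define rate where "rate = sqrt (ln (real p) / real n)"
  define er where "er = regime_error n (real p) dm"
  have K: "C2 \<le> K" "C3 \<le> K" "0 < K" using C by (auto simp: K_def)
  have sp: "real (card {l. l < p \<and> \<Theta> $$ (l,k) \<noteq> 0}) \<le> C1 * dm" if "k = i \<or> k = j" for k
  proof -
    have "real (card {l. l < p \<and> \<Theta> $$ (l,k) \<noteq> 0}) \<le> C1 * d k" using prec_class_sparse[OF \<Theta>, of k] that ij by auto
    also have "\<dots> \<le> C1 * dm" using that C by (auto simp: dm_def intro: mult_left_mono)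
    finally show ?thesis .
  qed
  \<comment> \<open>A positive definite matrix has no zero on its diagonal, so column i has at least
    one non-zero entry; this gives s >= 1 in the sparse regime.\<close>
  have dm1: "1 \<le> C1 * dm"
  proof -
    have "i \<in> {l. l < p \<and> \<Theta> $$ (l,i) \<noteq> 0}" using diag_bounds(3)[OF ij(1)] ij by simp
    then have "0 < card {l. l < p \<and> \<Theta> $$ (l,i) \<noteq> 0}" by (subst card_gt_0_iff) auto
    then show ?thesis using sp[of i] by linarith
  qed
  obtain u s where us: "0 < u" "1 \<le> s" "rate \<le> u" "s = real p \<or> (s = C1 * dm \<and> 0 < rate \<and> u = 44 * rate)"
    "u * s \<le> (1 + 2000 * C1) * er" "sqrt (real n) * (s * u\<^sup>2) \<le> (1 + 2000 * C1) * er"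
    "12 * (real p)\<^sup>2 * exp (- (real n * u\<^sup>2 / 16)) \<le> 1 / (real n * real p) ^ 12"
    using regime_choice[OF n _ C(1) dm1 a1 a2, of p] ij unfolding rate_def er_def by auto
  \<comment> \<open>A sum of the three quantities that L must dominate, in units of u: the noise
    level 2 K, C2 times that level, and the upper constant of the penalty.\<close>
  define Kc where "Kc = 2 * K + 2 * K * C2 + cu"
  have Kc: "0 < Kc" using K C cu by (simp add: Kc_def add_pos_nonneg)
  define L where "L = Kc * u"
  have rate0: "0 \<le> rate" using ij by (simp add: rate_def)
  \<comment> \<open>Each summand is the coefficient of u s in one smallness requirement; the 1
    provides u <= 1.\<close>
  define c5 where "c5 = 64 * C3 * K + 2 * C3 * ((2 + 8 * C2 * C3) * Kc) + 1"
  have c50: "0 \<le> 64 * C3 * K" "0 \<le> 2 * C3 * ((2 + 8 * C2 * C3) * Kc)" using C K Kc by auto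
  have us1: "c5 * (u * s) \<le> 1"
  proof -
    have "c5 * (u * s) \<le> c5 * ((1 + 2000 * C1) * er)" using us(5) c50 by (intro mult_left_mono) (auto simp: c5_def)
    also have "\<dots> \<le> 1" using small by (simp add: c5_def Kc_def K_def er_def dm_def)
    finally show ?thesis .
  qed
  have part: "c * (u * s) \<le> 1" if "c \<le> c5" for c
  proof -
    have "c * (u * s) \<le> c5 * (u * s)" using that us(1,2) by (intro mult_right_mono) auto
    then show ?thesis using us1 by linarith
  qed
  define h where "h = 2 / (176 * C2 * K)"
  have lam0: "0 < lam k" if "k = i \<or> k = j" "0 < rate" for k
  proof -
    have "0 < 176 * C2 * K * rate" using C K that by simp
    then show ?thesis using lam(1)[OF that(1)] by (simp add: K_def rate_def)
  qed
  \<comment> \<open>For p >= 2 the logarithm is at least 1/2, which makes the rate at least 1 / (2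
    n); hence h = 2 / (176 C2 K).\<close>
  have rpos: "0 < rate \<and> 1 / rate \<le> 2 * real n" if "p \<noteq> 1"
  proof -
    have "2 \<le> real p" using that ij by linarith
    then have l: "1 / 2 \<le> ln (real p)" by (rule ln_ge_half)
    have n1: "1 \<le> real n" using n by simp
    have "(1 / (2 * real n))\<^sup>2 \<le> ln (real p) / real n"
    proof -
      have "(1 / (2 * real n))\<^sup>2 = (1 / (4 * real n)) / real n" by (simp add: power2_eq_square)
      also have "\<dots> \<le> ln (real p) / real n"
      proof (rule divide_right_mono)
        have "1 / (4 * real n) \<le> 1 / 4" using n1 by (simp add: field_simps)
        then show "1 / (4 * real n) \<le> ln (real p)" using l by linarith
      qed simp
      finally show ?thesis .
    qed
    then have r: "1 / (2 * real n) \<le> rate" unfolding rate_def by (rule real_le_rsqrt)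
    moreover have "0 < 1 / (2 * real n)" using n1 by simp
    ultimately have r0: "0 < rate" by linarith
    then show ?thesis using r n1 by (simp add: field_simps)
  qed
  have "mean_le (P n) (\<lambda>X. (desparsified n p i j lam \<gamma>hat X - (2 * \<Theta> $$ (i,j) - cov n p X (acol i) (acol j)))\<^sup>2)
    ((c3 * s * L\<^sup>2)\<^sup>2 + (c4 h + 1) / (real n * real p)\<^sup>2)"
  proof (rule remainder_square[where K = K and u = u])
    show "0 \<le> h" using C K by (simp add: h_def)
    fix k assume k: "k = i \<or> k = j"
    show "0 \<le> lam k"
    proof -
      have "0 \<le> 176 * C2 * K * rate" using C K rate0 by simp
      then show ?thesis using lam(1)[OF k] by (simp add: K_def rate_def)
    qed
    show "p = 1" if "lam k = 0"
    proof (rule ccontr)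
      assume "p \<noteq> 1"
      then show False using rpos lam0[OF k] that by simp
    qed
    show "1 / lam k \<le> h * real n"
    \<comment> \<open>For p = 1 the rate is 0, which forces a zero penalty, and the claim holds
      because 1 / 0 = 0.\<close>
    proof (cases "p = 1")
      case True
      then have "rate = 0" by (simp add: rate_def)
      then have "lam k = 0" using lam[OF k] by (simp add: rate_def[symmetric])
      then show ?thesis using C K by (simp add: h_def)
    next
      case False
      have r: "0 < rate" "1 / rate \<le> 2 * real n" using rpos[OF False] by auto
      have A0: "0 < 176 * C2 * K" using C K by simp
      have "0 < 176 * C2 * K * rate" using A0 r(1) by (rule mult_pos_pos)
      moreover have "176 * C2 * K * rate \<le> lam k" using lam(1)[OF k] by (simp add: K_def rate_def)
      ultimately have "1 / lam k \<le> 1 / (176 * C2 * K * rate)" by (intro divide_left_mono mult_pos_pos[of "lam k"]) auto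
      also have "\<dots> = 1 / (176 * C2 * K) * (1 / rate)" by simp
      also have "\<dots> \<le> 1 / (176 * C2 * K) * (2 * real n)" using r A0 by (intro mult_left_mono) auto
      finally show ?thesis by (simp add: h_def)
    qed
    show "real (card {l. l < p \<and> \<Theta> $$ (l,k) \<noteq> 0}) \<le> s"
    proof -
      have "card {l. l < p \<and> \<Theta> $$ (l,k) \<noteq> 0} \<le> card {..<p}" by (intro card_mono) auto
      then show ?thesis using sp[OF k] us(4) by auto
    qed
    show "lam k \<le> L"
    proof -
      have "lam k \<le> cu * rate" using lam(2)[OF k] by (simp add: rate_def)
      also have "\<dots> \<le> Kc * u" using us(3) rate0 cu K C by (intro mult_mono) (auto simp: Kc_def)
      finally show ?thesis by (simp add: L_def)
    qed
    show "real p \<le> s \<or> 0 < lam k \<and> 2 * C2 * (2 * K * u) \<le> lam k"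
    proof (cases "s = real p")
      case False
      then have r: "0 < rate" "u = 44 * rate" using us(4) by auto
      \<comment> \<open>Here the threshold arises: twice C2 times the noise level 2 K u, with u
        equal to 44 times the rate, is 176 C2 K times the rate.\<close>
      have "2 * C2 * (2 * K * u) = 176 * C2 * max C2 C3 * sqrt (ln (real p) / real n)"
        unfolding r(2) rate_def K_def by simp
      then show ?thesis using lam(1)[OF k] lam0[OF k r(1)] by presburger
    qed simp
  next
    have "1 * (u * s) \<le> 1" by (rule part) (use c50 in \<open>simp add: c5_def\<close>)
    moreover have "u * 1 \<le> u * s" using us(1,2) by (intro mult_left_mono) auto
    ultimately show "u \<le> 1" by simp
    show "2 * K * u \<le> L" unfolding L_def Kc_def using K C cu us(1) by (intro mult_right_mono) auto
    show "C2 * (2 * K * u) \<le> L"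
    proof -
      have "C2 * (2 * K * u) = (2 * K * C2) * u" by simp
      also have "\<dots> \<le> L" unfolding L_def Kc_def using K C cu us(1) by (intro mult_right_mono) auto
      finally show ?thesis .
    qed
    have "64 * C3 * K * (u * s) \<le> 1" by (rule part) (use c50 in \<open>simp add: c5_def\<close>)
    then show "32 * C3 * (2 * K * u) * s \<le> 1" by (simp add: mult_ac)
    have "sqrt s \<le> s"
    proof (rule real_le_lsqrt)
      show "s \<le> s\<^sup>2" using us(2) mult_left_mono[of 1 s s] by (simp add: power2_eq_square)
    qed (use us(2) in auto)
    then have "2 * C3 * ((2 + 8 * C2 * C3) * L * sqrt s) \<le> 2 * C3 * ((2 + 8 * C2 * C3) * L * s)"
      using C Kc us(1) by (intro mult_left_mono) (auto simp: L_def)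
    also have "\<dots> = (2 * C3 * ((2 + 8 * C2 * C3) * Kc)) * (u * s)" by (simp add: L_def)
    also have "\<dots> \<le> 1" by (rule part) (use c50 in \<open>simp add: c5_def\<close>)
    finally show "2 * C3 * ((2 + 8 * C2 * C3) * L * sqrt s) \<le> 1" .
  qed (use n ij lasso K us in auto)
  moreover have "(c3 * s * L\<^sup>2)\<^sup>2 + (c4 h + 1) / (real n * real p)\<^sup>2 \<le> remainder_bound C1 C2 C3 cu n (real p) dm"
  proof -
    have n0: "0 < real n" using n by simp
    have c30: "0 \<le> c3" using C by (simp add: c3_def)
    have "c3 * s * L\<^sup>2 * sqrt (real n) = (c3 * Kc\<^sup>2) * (sqrt (real n) * (s * u\<^sup>2))" by (simp add: L_def power_mult_distrib mult_ac)
    also have "\<dots> \<le> (c3 * Kc\<^sup>2) * ((1 + 2000 * C1) * er)" using us(6) c30 by (intro mult_left_mono) auto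
    also have "\<dots> = remainder_const C1 C2 C3 cu * er"
      by (simp add: remainder_const_def c3_def Kc_def K_def mult_ac)
    finally have "(c3 * s * L\<^sup>2 * sqrt (real n))\<^sup>2 \<le> (remainder_const C1 C2 C3 cu * er)\<^sup>2"
      using c30 us(2) by (intro power_mono) auto
    then have "(c3 * s * L\<^sup>2)\<^sup>2 * real n \<le> (remainder_const C1 C2 C3 cu * er)\<^sup>2" by (simp add: power_mult_distrib)
    then have 1: "(c3 * s * L\<^sup>2)\<^sup>2 \<le> (remainder_const C1 C2 C3 cu * er)\<^sup>2 / real n" using n0 by (simp add: pos_le_divide_eq)
    have c40: "0 \<le> c4 h" using C K by (simp add: c4_def h_def)
    have "(c4 h + 1) / (real n * real p)\<^sup>2 \<le> (c4 h + 1) / (real n)\<^sup>2"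
    proof (rule divide_left_mono)
      have "real n * 1 \<le> real n * real p" using ij by (intro mult_left_mono) auto
      then show "(real n)\<^sup>2 \<le> (real n * real p)\<^sup>2" by (intro power_mono) auto
    qed (use c40 n0 ij in auto)
    moreover have "c4 h = moment_const C2 C3 (2 / (176 * C2 * max C2 C3))"
      by (simp add: c4_def moment_const_def h_def K_def)
    ultimately show ?thesis using 1 by (simp add: remainder_bound_def er_def)
  qed
  ultimately show ?thesis unfolding dm_def by (rule mean_le_mono)
qed

section \<open>Asymptotics\<close>

text \<open>Used for factors such as \<sigma>^2 and its inverse, which vary with n and are only
  known to be bounded.\<close>

lemma tendsto_0_bounded_mult:
  fixes s x :: "nat \<Rightarrow> real"
  assumes "x \<longlonglongrightarrow> 0" "\<And>n. \<bar>s n\<bar> \<le> S"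
  shows "(\<lambda>n. s n * x n) \<longlonglongrightarrow> 0"
  by (rule tendsto_0_le[OF assms(1), of _ S], intro always_eventually allI)
    (simp add: abs_mult mult.commute[of _ S] mult_right_mono[OF assms(2)])

lemma smallo_one: "(f :: nat \<Rightarrow> real) \<in> o(\<lambda>_. 1) \<longleftrightarrow> f \<longlonglongrightarrow> 0"
  by (auto intro: smalloI_tendsto dest: smalloD_tendsto)

text \<open>Dividing the tilt by its mean, which is at least 1 - t C3 >= 15/16, turns the variance
  bound for the tilt into the chi-square bound \<open>q\<close> for one observation.\<close>

lemma (in prec_matrix) tilted_variance_bound:
  fixes n :: nat
  assumes ij: "i < p" "j < p" and t: "0 < t" "2 * t \<le> s0" "t \<le> 1"
    and B: "pd_matrix p B" and Beq: "\<And>k l. k < p \<Longrightarrow> l < p \<Longrightarrow> B $$ (k,l) = A $$ (k,l) + t * (A $$ (k,i) * A $$ (l,j) + A $$ (k,j) * A $$ (l,i))"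
    and T: "T \<in> borel_measurable (data_space n p)" "integrable (sample_law n p A) (\<lambda>X. (T X)\<^sup>2)" "integrable (sample_law n p B) T"
  defines "q \<equiv> t\<^sup>2 * ((1 + t) * (sigma_sq A i j + 12 / s0 ^ 4 * t)) / (1 - t * C3)\<^sup>2"
  shows "(integral\<^sup>L (sample_law n p B) T - integral\<^sup>L (sample_law n p A) T)\<^sup>2
    \<le> prob_space.variance (sample_law n p A) T * ((1 + q) ^ n - 1)"
proof -
  interpret B: pd_matrix p B by fact
  define \<phi> where "\<phi> = integral\<^sup>L N (tilt i j t)"
  define w where "w = t\<^sup>2 * ((1 + t) * (sigma_sq A i j + 12 / s0 ^ 4 * t))"
  note ti = tilt_integrable[OF ij less_imp_le[OF t(1)] t(2)]
  have w0: "0 \<le> w"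
  proof -
    have "0 \<le> sigma_sq A i j" using sigma_sq_bounds(1)[OF ij] C2 by (meson order_trans zero_le_divide_1_iff zero_le_power2)
    then show ?thesis using t s0 by (simp add: w_def)
  qed
  have tC: "0 < 1 - t * C3"
  proof -
    have "t * C3 \<le> s0 / 2 * C3" using t C3 by (intro mult_right_mono) auto
    also have "\<dots> = 1 / 16" using C3 by (simp add: s0_def)
    finally show ?thesis by simp
  qed
  have \<phi>: "1 - t * C3 \<le> \<phi>" "(\<integral>x. (tilt i j t x)\<^sup>2 \<partial>N) - \<phi>\<^sup>2 \<le> w"
    using tilt_chi_square[OF ij t] by (simp_all add: \<phi>_def w_def)
  have \<phi>0: "0 < \<phi>" using \<phi>(1) tC by linarith
  have d: "normal_vec p (minv B) = density N (\<lambda>x. ennreal (tilt i j t x / \<phi>))"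
    unfolding \<phi>_def by (rule perturbed_normal_vec[OF ij t(1,2) B Beq])
  have chi: "(\<integral>x. (tilt i j t x / \<phi>)\<^sup>2 \<partial>N) \<le> 1 + q"
  proof -
    have "(\<integral>x. (tilt i j t x / \<phi>)\<^sup>2 \<partial>N) = (\<integral>x. (tilt i j t x)\<^sup>2 \<partial>N) / \<phi>\<^sup>2" by (simp add: power_divide)
    also have "\<dots> \<le> (\<phi>\<^sup>2 + w) / \<phi>\<^sup>2" using \<phi>(2) by (intro divide_right_mono) auto
    also have "\<dots> = 1 + w / \<phi>\<^sup>2" using \<phi>0 by (simp add: add_divide_distrib)
    also have "w / \<phi>\<^sup>2 \<le> w / (1 - t * C3)\<^sup>2"
      using w0 tC \<phi>(1) \<phi>0 by (intro divide_left_mono power_mono mult_pos_pos zero_less_power) auto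
    finally show ?thesis by (simp add: q_def w_def)
  qed
  have law: "sample_law n p A = Pi\<^sub>M {..<n} (\<lambda>_. N)"
    "sample_law n p B = Pi\<^sub>M {..<n} (\<lambda>_. density N (\<lambda>x. ennreal (tilt i j t x / \<phi>)))"
    by (simp_all add: sample_law_def d)
  show ?thesis unfolding law
  proof (rule chapman_robbins_iid)
    show "prob_space N" by (rule N.prob_space_axioms)
    show "prob_space (density N (\<lambda>x. ennreal (tilt i j t x / \<phi>)))" unfolding d[symmetric] by (rule B.N.prob_space_axioms)
    show "(\<lambda>x. tilt i j t x / \<phi>) \<in> borel_measurable N" by measurable
    show "0 \<le> tilt i j t x / \<phi>" for x using \<phi>0 by (simp add: tilt_def)
    show "integrable N (\<lambda>x. (tilt i j t x / \<phi>)\<^sup>2)" using ti(2) by (simp add: power_divide)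
    show "T \<in> borel_measurable (P n)" using T(1) by (simp add: measurable_cong_sets[OF sets_P refl])
  qed (use chi T law in simp_all)
qed

lemma power_sub_one_le:
  fixes q :: real and n :: nat
  assumes "0 \<le> q" "real n * q \<le> 1"
  shows "(1 + q) ^ n - 1 \<le> real n * q * (1 + real n * q)"
proof -
  have "(1 + q) ^ n \<le> exp q ^ n" using assms exp_ge_add_one_self[of q] by (intro power_mono) auto
  also have "\<dots> = exp (real n * q)" by (rule exp_of_nat_mult[symmetric])
  also have "\<dots> \<le> 1 + real n * q + (real n * q)\<^sup>2" using assms by (intro exp_bound) auto
  finally show ?thesis by (simp add: power2_eq_square algebra_simps)
qed

text \<open>\<open>R\<close> bounds the squared bias on the whole class and also the error of the
  variance, so n R -> 0 yields both conclusions. The sequence m must grow faster than n while m R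
  still tends to 0.\<close>

lemma unbiased_of_remainder:
  fixes p :: "nat \<Rightarrow> nat" and R s :: "nat \<Rightarrow> real"
  assumes meas: "\<And>n. T n \<in> borel_measurable (data_space n (p n))"
    and R0: "\<And>n. 0 \<le> R n" and R: "(\<lambda>n. real n * R n) \<longlonglongrightarrow> 0"
    and \<Theta>0: "\<And>n. \<Theta>0 n \<in> G n" and s: "\<And>n. 0 \<le> s n" "\<And>n. s n \<le> S"
    and moments: "\<forall>\<^sub>F n in sequentially. \<forall>\<Theta>\<in>G n. integrable (sample_law n (p n) \<Theta>) (\<lambda>X. (T n X)\<^sup>2)
       \<and> integrable (sample_law n (p n) \<Theta>) (T n) \<and> (integral\<^sup>L (sample_law n (p n) \<Theta>) (T n) - g n \<Theta>)\<^sup>2 \<le> R n"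
    and var: "\<forall>\<^sub>F n in sequentially. \<forall>\<eta>>0. \<bar>prob_space.variance (sample_law n (p n) (\<Theta>0 n)) (T n) - s n / real n\<bar>
       \<le> \<eta> * (s n / real n) + (1 + 1 / \<eta>) * R n"
  shows "\<exists>e\<in>o(\<lambda>_. 1). \<forall>\<^sub>F n in sequentially. prob_space.variance (sample_law n (p n) (\<Theta>0 n)) (T n) = (s n + e n) / real n"
    and "strongly_asymp_unbiased p G c g \<Theta>0 T"
proof -
  define v where "v n = prob_space.variance (sample_law n (p n) (\<Theta>0 n)) (T n)" for n
  define e where "e n = real n * v n - s n" for n
  have S0: "0 \<le> S" using s[of 0] by linarith
  have e0: "e \<longlonglongrightarrow> 0"
  proof (rule LIMSEQ_I)
    fix r :: real assume r: "0 < r"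
    \<comment> \<open>With this \<eta> the term proportional to the variance stays below r / 2 for
      every n; the other half is left to n R.\<close>
    define \<eta> where "\<eta> = r / (2 * (S + 1))"
    have \<eta>: "0 < \<eta>" using r S0 by (simp add: \<eta>_def)
    have "(\<lambda>n. (1 + 1 / \<eta>) * (real n * R n)) \<longlonglongrightarrow> (1 + 1 / \<eta>) * 0" by (intro tendsto_intros R)
    then have "\<forall>\<^sub>F n in sequentially. (1 + 1 / \<eta>) * (real n * R n) < r / 2"
      by (rule order_tendstoD(2)) (use r in simp)
    with var eventually_gt_at_top[of 0] have "\<forall>\<^sub>F n in sequentially. \<bar>e n\<bar> < r"
    proof eventually_elim
      case (elim n)
      have n: "0 < real n" using elim by simp
      have "\<bar>v n - s n / real n\<bar> \<le> \<eta> * (s n / real n) + (1 + 1 / \<eta>) * R n" using elim \<eta> unfolding v_def by blast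
      then have "real n * \<bar>v n - s n / real n\<bar> \<le> real n * (\<eta> * (s n / real n) + (1 + 1 / \<eta>) * R n)"
        using n by (intro mult_left_mono) auto
      also have "\<dots> = \<eta> * s n + (1 + 1 / \<eta>) * (real n * R n)" using n by (simp add: distrib_left)
      also have "\<eta> * s n \<le> \<eta> * (S + 1)" using \<eta> s(2)[of n] by (intro mult_left_mono) auto
      also have "\<eta> * (S + 1) = r / 2"
      proof -
        have "r / (2 * y) * y = r / 2" if "y \<noteq> 0" for y :: real using that by simp
        from this[of "S + 1"] show ?thesis using S0 by (simp add: \<eta>_def)
      qed
      also have "real n * \<bar>v n - s n / real n\<bar> = \<bar>real n * (v n - s n / real n)\<bar>" using n by (simp add: abs_mult)
      also have "real n * (v n - s n / real n) = e n" using n by (simp add: e_def right_diff_distrib)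
      finally show ?case using elim by linarith
    qed
    then show "\<exists>no. \<forall>n\<ge>no. norm (e n - 0) < r" by (simp add: eventually_sequentially)
  qed
  have ve: "\<forall>\<^sub>F n in sequentially. v n = (s n + e n) / real n"
    using eventually_gt_at_top[of 0] by eventually_elim (simp add: e_def)
  show "\<exists>e\<in>o(\<lambda>_. 1). \<forall>\<^sub>F n in sequentially. prob_space.variance (sample_law n (p n) (\<Theta>0 n)) (T n) = (s n + e n) / real n"
    using e0 ve by (intro bexI[of _ e]) (simp_all add: smallo_one v_def)
  have vO: "v \<in> O(\<lambda>n. 1 / real n)"
  proof (rule bigoI[of _ "S + 1"])
    have "\<forall>\<^sub>F n in sequentially. \<bar>e n\<bar> < 1" using order_tendstoD[OF tendsto_rabs[OF e0]] by simp
    with ve show "\<forall>\<^sub>F n in sequentially. norm (v n) \<le> (S + 1) * norm (1 / real n)"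
    proof eventually_elim
      case (elim n)
      have "norm (v n) = \<bar>s n + e n\<bar> / real n" using elim(1) by simp
      also have "\<dots> \<le> (S + 1) / real n" using elim(2) s[of n] by (intro divide_right_mono) auto
      finally show ?case by simp
    qed
  qed
  txt \<open>\<open>m\<close> grows faster than \<open>n\<close> but \<open>m R \<le> \<surd>(n R)\<close> still vanishes; \<open>1 / n\<close> guards against \<open>R n = 0\<close>.\<close>
  define x where "x n = sqrt (real n * R n)" for n
  have x0: "0 \<le> x n" for n using R0[of n] by (simp add: x_def)
  have x: "x \<longlonglongrightarrow> 0" using tendsto_real_sqrt[OF R] by (simp add: x_def[abs_def])
  define m where "m n = (if n = 0 then 1 else real n / (x n + 1 / real n))" for n
  have m0: "0 < m n" for n using x0[of n] by (auto simp: m_def intro!: divide_pos_pos add_nonneg_pos)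
  have nm: "(\<lambda>n. real n) \<in> o(m)"
  proof (rule smalloI_tendsto)
    have "(\<lambda>n. x n + 1 / real n) \<longlonglongrightarrow> 0 + 0" by (intro tendsto_add x lim_1_over_n)
    moreover have "\<forall>\<^sub>F n in sequentially. x n + 1 / real n = real n / m n"
      using eventually_gt_at_top[of 0] by eventually_elim (simp add: m_def)
    ultimately show "(\<lambda>n. real n / m n) \<longlonglongrightarrow> 0" by (simp add: filterlim_cong)
    show "\<forall>\<^sub>F n in sequentially. m n \<noteq> 0" using m0 by (simp add: less_imp_neq[THEN not_sym])
  qed
  have bias: "(\<lambda>n. sqrt (m n) * (prob_space.expectation (sample_law n (p n) (\<Theta> n)) (T n) - g n (\<Theta> n))) \<longlonglongrightarrow> 0"
    if \<Theta>: "\<And>n. \<Theta> n \<in> G n" for \<Theta>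
  proof (rule tendsto_0_le[where K = 1])
    show "(\<lambda>n. sqrt (x n)) \<longlonglongrightarrow> 0" using tendsto_real_sqrt[OF x] by simp
    show "\<forall>\<^sub>F n in sequentially. norm (sqrt (m n) * (prob_space.expectation (sample_law n (p n) (\<Theta> n)) (T n) - g n (\<Theta> n))) \<le> norm (sqrt (x n)) * 1"
      using moments eventually_gt_at_top[of 0]
    proof eventually_elim
      case (elim n)
      define b where "b = prob_space.expectation (sample_law n (p n) (\<Theta> n)) (T n) - g n (\<Theta> n)"
      have b: "b\<^sup>2 \<le> R n" using elim(1) \<Theta>[of n] by (simp add: b_def)
      have n: "0 < real n" using elim by simp
      have y: "0 < x n + 1 / real n" using x0[of n] n by (intro add_nonneg_pos) auto
      have "m n * b\<^sup>2 \<le> m n * R n" using b m0[of n] by (intro mult_left_mono) auto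
      also have "\<dots> = (x n)\<^sup>2 / (x n + 1 / real n)" using n R0[of n] by (simp add: m_def x_def)
      also have "\<dots> \<le> x n"
      proof -
        have "x n * x n \<le> x n * (x n + 1 / real n)" using x0[of n] n by (intro mult_left_mono) auto
        then show ?thesis using y by (simp add: pos_divide_le_eq power2_eq_square)
      qed
      finally have "sqrt (m n * b\<^sup>2) \<le> sqrt (x n)" by (rule real_sqrt_le_mono)
      then show ?case unfolding b_def[symmetric] using m0[of n] x0[of n] by (simp add: real_sqrt_mult abs_mult)
    qed
  qed
  have "\<forall>\<^sub>F n in sequentially. integrable (sample_law n (p n) (\<Theta> n)) (T n)" if "\<And>n. \<Theta> n \<in> G n" for \<Theta>
    using moments by eventually_elim (use that in blast)
  moreover have "\<forall>\<^sub>F n in sequentially. integrable (sample_law n (p n) (\<Theta>0 n)) (\<lambda>X. (T n X)\<^sup>2)"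
    using moments by eventually_elim (use \<Theta>0 in blast)
  ultimately show "strongly_asymp_unbiased p G c g \<Theta>0 T"
    unfolding strongly_asymp_unbiased_def using meas m0 nm vO bias
    by (intro conjI exI[of _ m]) (auto simp: v_def[abs_def] prec_ball_def)
qed

section \<open>The lower bound along the least favourable direction\<close>

lemma worst_direction_perturbation:
  assumes "A \<in> carrier_mat p p" "i < p" "j < p" "k < p" "l < p"
  shows "(A + (1 / r) \<cdot>\<^sub>m worst_direction p A i j) $$ (k,l)
    = A $$ (k,l) + 1 / (sqrt (sigma_sq A i j) * r) * (A $$ (k,i) * A $$ (l,j) + A $$ (k,j) * A $$ (l,i))"
proof -
  have "dim_row A = p" "dim_col A = p" using assms(1) by auto
  then show ?thesis using assms(2-5) by (simp add: worst_direction_def)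
qed

text \<open>The perturbation is assumed admissible for every m >= n because its size is prescribed
  by the sequence m that belongs to \<open>T\<close>. Along it the target moves by t \<sigma>^2 =
  \<sigma> / sqrt m, while the divergence of n observations is (1 + o(1)) n / m; their quotient
  gives \<sigma>^2 / n.\<close>

lemma variance_lower_bound:
  fixes p i j :: "nat \<Rightarrow> nat"
  assumes C: "0 < C2" "0 < C3" and c: "0 < c" and ij: "\<And>n. i n < p n" "\<And>n. j n < p n"
    and \<Theta>0: "\<And>n. \<Theta>0 n \<in> G n" and G: "\<And>n. G n = prec_class C1 C2 C3 (p n) (\<T> n) (d n)"
    and pert: "\<forall>\<^sub>F n in sequentially. \<forall>m\<ge>real n.
      \<Theta>0 n + (1 / sqrt m) \<cdot>\<^sub>m worst_direction (p n) (\<Theta>0 n) (i n) (j n) \<in> prec_ball (G n) (\<Theta>0 n) (c / sqrt m)"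
    and T: "strongly_asymp_unbiased p G c (\<lambda>n \<Theta>. \<Theta> $$ (i n, j n)) \<Theta>0 T"
  shows "\<exists>e\<in>o(\<lambda>_. 1). \<forall>\<^sub>F n in sequentially.
    prob_space.variance (sample_law n (p n) (\<Theta>0 n)) (T n) \<ge> (sigma_sq (\<Theta>0 n) (i n) (j n) + e n) / real n"
proof -
  obtain m :: "nat \<Rightarrow> real" where m0: "\<And>n. 0 < m n" and nm: "(\<lambda>n. real n) \<in> o(m)"
    and T2: "\<forall>\<^sub>F n in sequentially. integrable (sample_law n (p n) (\<Theta>0 n)) (\<lambda>X. (T n X)\<^sup>2)"
    and U: "\<And>\<Theta>. (\<And>n. \<Theta> n \<in> prec_ball (G n) (\<Theta>0 n) (c / sqrt (m n))) \<Longrightarrow>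
        (\<forall>\<^sub>F n in sequentially. integrable (sample_law n (p n) (\<Theta> n)) (T n)) \<and>
        (\<lambda>n. sqrt (m n) * (integral\<^sup>L (sample_law n (p n) (\<Theta> n)) (T n) - \<Theta> n $$ (i n, j n))) \<longlonglongrightarrow> 0"
    using T unfolding strongly_asymp_unbiased_def by blast
  have Tm: "T n \<in> borel_measurable (data_space n (p n))" for n using T by (simp add: strongly_asymp_unbiased_def)
  have pm: "prec_matrix (p n) (\<Theta>0 n) C2 C3" for n
    using prec_class_prec_matrix[of "\<Theta>0 n" C1 C2 C3 "p n" "\<T> n" "d n"] \<Theta>0[of n] G[of n] C ij(1)[of n] by simp
  define s where "s n = sigma_sq (\<Theta>0 n) (i n) (j n)" for n
  define v where "v n = prob_space.variance (sample_law n (p n) (\<Theta>0 n)) (T n)" for n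
  have sl: "1 / C2\<^sup>2 \<le> s n" and su: "s n \<le> 2 * C3\<^sup>2" for n
    using prec_matrix.sigma_sq_bounds[OF pm ij, of n] by (simp_all add: s_def)
  have s0: "0 < s n" for n by (rule less_le_trans[OF _ sl]) (use C in simp)
  have si: "1 / s n \<le> C2\<^sup>2" for n
    using sl[of n] s0[of n] C by (simp add: divide_le_eq mult.commute)
  define t where "t n = 1 / (sqrt (s n) * sqrt (m n))" for n
  have t0: "0 < t n" for n using s0[of n] m0[of n] by (simp add: t_def)
  have nm0: "(\<lambda>n. real n / m n) \<longlonglongrightarrow> 0" using smalloD_tendsto[OF nm] .
  have im: "(\<lambda>n. 1 / m n) \<longlonglongrightarrow> 0"
  proof (rule tendsto_0_le[OF nm0, of _ 1])
    show "\<forall>\<^sub>F n in sequentially. norm (1 / m n) \<le> norm (real n / m n) * 1"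
      using eventually_gt_at_top[of 0]
    proof eventually_elim
      case (elim n)
      then show ?case using m0[of n] by (simp add: divide_right_mono)
    qed
  qed
  have t: "t \<longlonglongrightarrow> 0"
  proof -
    have "(\<lambda>n. 1 / s n * (1 / m n)) \<longlonglongrightarrow> 0"
      by (rule tendsto_0_bounded_mult[OF im, where S = "C2\<^sup>2"]) (use si s0 in \<open>simp add: less_imp_le abs_of_pos\<close>)
    from tendsto_real_sqrt[OF this] show ?thesis by (simp add: t_def[abs_def] real_sqrt_mult real_sqrt_divide)
  qed
  define sg where "sg = 1 / (8 * C3)"
  have sg: "0 < sg" using C by (simp add: sg_def)
  have sgl: "prec_matrix.s0 C3 = sg" using prec_matrix.s0_def[OF pm] by (simp add: sg_def)
  define \<kappa> where "\<kappa> = 12 / sg ^ 4"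
  \<comment> \<open>The divergence bound for one observation is t^2 w and for n observations n t^2 w
    = u -> 0. In total, m times the squared shift is at most n v b, with b -> 1.\<close>
  define w where "w n = (1 + t n) * (s n + \<kappa> * t n) / (1 - t n * C3)\<^sup>2" for n
  define u where "u n = real n / m n * (w n / s n)" for n
  define b where "b n = w n / s n * (1 + u n)" for n
  have ws: "(\<lambda>n. w n / s n) \<longlonglongrightarrow> 1"
  proof -
    have "(\<lambda>n. 1 / s n * t n) \<longlonglongrightarrow> 0"
      by (rule tendsto_0_bounded_mult[OF t, where S = "C2\<^sup>2"]) (use si s0 in \<open>simp add: less_imp_le abs_of_pos\<close>)
    then have "(\<lambda>n. (1 + t n) * (1 + \<kappa> * (1 / s n * t n)) / (1 - t n * C3)\<^sup>2) \<longlonglongrightarrow> (1 + 0) * (1 + \<kappa> * 0) / (1 - 0 * C3)\<^sup>2"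
      using t by (intro tendsto_intros) auto
    moreover have "(1 + t n) * (1 + \<kappa> * (1 / s n * t n)) / (1 - t n * C3)\<^sup>2 = w n / s n" for n
    proof -
      have "1 + \<kappa> * (1 / s n * t n) = (s n + \<kappa> * t n) / s n" using s0[of n] by (simp add: add_divide_distrib)
      then show ?thesis by (simp add: w_def)
    qed
    ultimately show ?thesis by simp
  qed
  have u: "u \<longlonglongrightarrow> 0" using tendsto_mult[OF nm0 ws] by (simp add: u_def[abs_def])
  have b: "b \<longlonglongrightarrow> 1" using tendsto_mult[OF ws tendsto_add[OF tendsto_const[of 1] u]] by (simp add: b_def[abs_def])
  define \<Theta>p where "\<Theta>p n = \<Theta>0 n + (1 / sqrt (m n)) \<cdot>\<^sub>m worst_direction (p n) (\<Theta>0 n) (i n) (j n)" for n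
  \<comment> \<open>Unbiasedness speaks of sequences that stay in the ball for every n, but the
    perturbed matrix is known to lie there only eventually; elsewhere \<Theta>0 itself is
    used.\<close>
  define \<Theta> where "\<Theta> n = (if \<Theta>p n \<in> prec_ball (G n) (\<Theta>0 n) (c / sqrt (m n)) then \<Theta>p n else \<Theta>0 n)" for n
  have \<Theta>0b: "\<Theta>0 n \<in> prec_ball (G n) (\<Theta>0 n) (c / sqrt (m n))" for n
    using \<Theta>0[of n] c m0[of n] by (simp add: prec_ball_def frob_norm_def less_imp_le)
  have \<Theta>b: "\<Theta> n \<in> prec_ball (G n) (\<Theta>0 n) (c / sqrt (m n))" for n using \<Theta>0b[of n] by (simp add: \<Theta>_def)
  \<comment> \<open>The difference of the scaled biases along two admissible sequences, the
    perturbed one and \<Theta>0. It measures how far the scaled shift of the expectation is from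
    \<sigma>.\<close>
  define \<delta> where "\<delta> n = sqrt (m n) * (integral\<^sup>L (sample_law n (p n) (\<Theta> n)) (T n) - \<Theta> n $$ (i n, j n))
    - sqrt (m n) * (integral\<^sup>L (sample_law n (p n) (\<Theta>0 n)) (T n) - \<Theta>0 n $$ (i n, j n))" for n
  have \<delta>: "\<delta> \<longlonglongrightarrow> 0" using tendsto_diff[OF U[OF \<Theta>b, THEN conjunct2] U[OF \<Theta>0b, THEN conjunct2]] by (simp add: \<delta>_def[abs_def])
  define e where "e n = (sqrt (s n) + \<delta> n)\<^sup>2 / b n - s n" for n
  have bpos: "\<forall>\<^sub>F n in sequentially. 0 < b n" using order_tendstoD(1)[OF b, of 0] by simp
  have e: "e \<longlonglongrightarrow> 0"
  proof -
    have 1: "(\<lambda>n. sqrt (s n) * \<delta> n) \<longlonglongrightarrow> 0"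
    proof (rule tendsto_0_bounded_mult[OF \<delta>])
      show "\<bar>sqrt (s n)\<bar> \<le> sqrt (2 * C3\<^sup>2)" for n using su[of n] s0[of n] by simp
    qed
    have 2: "(\<lambda>n. s n * (1 - b n)) \<longlonglongrightarrow> 0"
    proof (rule tendsto_0_bounded_mult)
      show "(\<lambda>n. 1 - b n) \<longlonglongrightarrow> 0" using tendsto_diff[OF tendsto_const[of 1] b] by simp
      show "\<bar>s n\<bar> \<le> 2 * C3\<^sup>2" for n using su[of n] s0[of n] by simp
    qed
    have "(\<lambda>n. (2 * (sqrt (s n) * \<delta> n) + (\<delta> n)\<^sup>2 + s n * (1 - b n)) / b n) \<longlonglongrightarrow> (2 * 0 + 0\<^sup>2 + 0) / 1"
      by (intro tendsto_intros 1 2 \<delta> b) simp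
    moreover have "\<forall>\<^sub>F n in sequentially. (2 * (sqrt (s n) * \<delta> n) + (\<delta> n)\<^sup>2 + s n * (1 - b n)) / b n = e n"
      using bpos
    proof eventually_elim
      case (elim n)
      have "(sqrt (s n) + \<delta> n)\<^sup>2 = s n + 2 * (sqrt (s n) * \<delta> n) + (\<delta> n)\<^sup>2" using s0[of n] by (simp add: power2_sum)
      then have "2 * (sqrt (s n) * \<delta> n) + (\<delta> n)\<^sup>2 + s n * (1 - b n) = (sqrt (s n) + \<delta> n)\<^sup>2 - s n * b n" by (simp add: right_diff_distrib)
      then show ?case using elim by (simp add: e_def diff_divide_distrib)
    qed
    ultimately show ?thesis by (simp add: filterlim_cong)
  qed
  have "\<forall>\<^sub>F n in sequentially. t n < 1" "\<forall>\<^sub>F n in sequentially. t n < sg / 2" "\<forall>\<^sub>F n in sequentially. u n < 1"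
    "\<forall>\<^sub>F n in sequentially. real n / m n < 1"
    using order_tendstoD(2)[OF t, of 1] order_tendstoD(2)[OF t, of "sg / 2"] order_tendstoD(2)[OF u, of 1]
      order_tendstoD(2)[OF nm0, of 1] sg by simp_all
  with bpos T2 U[OF \<Theta>b, THEN conjunct1] pert eventually_gt_at_top[of 0]
  have "\<forall>\<^sub>F n in sequentially. (s n + e n) / real n \<le> v n"
  proof eventually_elim
    case (elim n)
    have n: "0 < real n" using elim by simp
    have mn: "real n \<le> m n" using elim m0[of n] by (simp add: divide_less_eq)
    have \<Theta>eq: "\<Theta> n = \<Theta>p n" "\<Theta>p n \<in> G n" using elim(4) mn by (auto simp: \<Theta>_def \<Theta>p_def prec_ball_def)
    have carr: "\<Theta>0 n \<in> carrier_mat (p n) (p n)" using \<Theta>0[of n] by (simp add: G prec_class_def)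
    have B: "pd_matrix (p n) (\<Theta>p n)"
      using prec_class_prec_matrix[of "\<Theta>p n" C1 C2 C3 "p n" "\<T> n" "d n"] \<Theta>eq(2) G[of n] C ij(1)[of n]
      by (simp add: prec_matrix_def)
    have Beq: "\<Theta>p n $$ (k,l) = \<Theta>0 n $$ (k,l) + t n * (\<Theta>0 n $$ (k,i n) * \<Theta>0 n $$ (l,j n) + \<Theta>0 n $$ (k,j n) * \<Theta>0 n $$ (l,i n))"
      if "k < p n" "l < p n" for k l
      unfolding \<Theta>p_def t_def s_def by (rule worst_direction_perturbation[OF carr ij that])
    define q where "q = (t n)\<^sup>2 * ((1 + t n) * (s n + \<kappa> * t n)) / (1 - t n * C3)\<^sup>2"
    have qw: "q = (t n)\<^sup>2 * w n" by (simp add: q_def w_def)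
    have t2: "(t n)\<^sup>2 = 1 / (s n * m n)" using s0[of n] m0[of n] by (simp add: t_def power_divide power_mult_distrib)
    have nq: "real n * q = u n" by (simp add: qw t2 u_def)
    have \<kappa>: "0 \<le> \<kappa>" using sg by (simp add: \<kappa>_def)
    have q0: "0 \<le> q" using t0[of n] s0[of n] \<kappa> by (simp add: q_def less_imp_le)
    define \<Delta> where "\<Delta> = integral\<^sup>L (sample_law n (p n) (\<Theta> n)) (T n) - integral\<^sup>L (sample_law n (p n) (\<Theta>0 n)) (T n)"
    have "\<Delta>\<^sup>2 \<le> v n * ((1 + q) ^ n - 1)"
      using prec_matrix.tilted_variance_bound[OF pm ij t0 _ _ B Beq Tm elim(2)] elim
      unfolding \<Theta>eq(1) \<Delta>_def v_def q_def s_def \<kappa>_def sgl by simp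
    also have "\<dots> \<le> v n * (u n * (1 + u n))"
    proof (rule mult_left_mono)
      show "(1 + q) ^ n - 1 \<le> u n * (1 + u n)" unfolding nq[symmetric] by (rule power_sub_one_le[OF q0]) (use elim nq in simp)
      show "0 \<le> v n" unfolding v_def by (intro integral_nonneg_AE AE_I2) simp
    qed
    finally have "m n * \<Delta>\<^sup>2 \<le> m n * (v n * (u n * (1 + u n)))" using m0[of n] by (intro mult_left_mono) auto
    also have "\<dots> = real n * v n * b n" using m0[of n] by (simp add: b_def u_def)
    also have "m n * \<Delta>\<^sup>2 = (sqrt (m n) * \<Delta>)\<^sup>2" using m0[of n] by (simp add: power_mult_distrib)
    also have "sqrt (m n) * \<Delta> = sqrt (s n) + \<delta> n"
    proof -
      have "\<Theta> n $$ (i n, j n) - \<Theta>0 n $$ (i n, j n) = t n * s n"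
      proof -
        have "\<Theta>0 n $$ (j n, i n) = \<Theta>0 n $$ (i n, j n)" using pd_matrix.sym[OF prec_matrix.axioms(1)[OF pm] ij(2) ij(1)] .
        then show ?thesis unfolding \<Theta>eq(1) Beq[OF ij] by (simp add: s_def sigma_sq_def power2_eq_square)
      qed
      moreover have "sqrt (m n) * (t n * s n) = sqrt (s n)"
        using s0[of n] m0[of n] by (simp add: t_def real_div_sqrt)
      moreover have "\<delta> n = sqrt (m n) * \<Delta> - sqrt (m n) * (\<Theta> n $$ (i n, j n) - \<Theta>0 n $$ (i n, j n))"
        unfolding \<delta>_def \<Delta>_def by (simp add: algebra_simps)
      ultimately show ?thesis by simp
    qed
    finally have "(sqrt (s n) + \<delta> n)\<^sup>2 \<le> real n * v n * b n" .
    then have "(sqrt (s n) + \<delta> n)\<^sup>2 / b n \<le> real n * v n" using elim(1) by (simp add: pos_divide_le_eq)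
    then have "s n + e n \<le> v n * real n" unfolding e_def mult.commute[of "v n"] by simp
    then show ?case using n by (simp only: pos_divide_le_eq)
  qed
  then show ?thesis using e by (intro bexI[of _ e]) (simp_all add: smallo_one s_def v_def)
qed

section \<open>Efficiency of the de-sparsified estimator\<close>

lemma desparsified_efficient:
  fixes p i j :: "nat \<Rightarrow> nat"
  assumes C: "0 < C1" "0 < C2" "0 < C3" "0 < c"
    and ij: "\<forall>n. i n < p n \<and> j n < p n" and \<Theta>0': "\<forall>n. \<Theta>0 n \<in> prec_class C1 C2 C3 (p n) (\<T> n) (d n)"
    and sparse: "(\<lambda>n. max (d n (i n)) (d n (j n)) * ln (real (p n))) \<in> o(\<lambda>n. sqrt (real n))"
    and pert': "\<forall>\<^sub>F n in sequentially. \<forall>m\<ge>real n. \<Theta>0 n + (1 / sqrt m) \<cdot>\<^sub>m worst_direction (p n) (\<Theta>0 n) (i n) (j n)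
       \<in> prec_ball (prec_class C1 C2 C3 (p n) (\<T> n) (d n)) (\<Theta>0 n) (c / sqrt m)"
    and lami': "(\<lambda>n. lam n (i n)) \<in> \<Theta>(\<lambda>n. sqrt (ln (real (p n)) / real n))"
    and lamj': "(\<lambda>n. lam n (j n)) \<in> \<Theta>(\<lambda>n. sqrt (ln (real (p n)) / real n))"
    and lamA': "\<forall>\<^sub>F n in sequentially. 176 * C2 * max C2 C3 * sqrt (ln (real (p n)) / real n) \<le> lam n (i n)
       \<and> 176 * C2 * max C2 C3 * sqrt (ln (real (p n)) / real n) \<le> lam n (j n)"
    and lasso: "\<forall>n. \<forall>k\<in>{i n, j n}. nodewise_lasso n (p n) k (lam n k) (\<gamma>hat n k)"
  shows "strongly_asymp_unbiased p (\<lambda>n. prec_class C1 C2 C3 (p n) (\<T> n) (d n)) c (\<lambda>n \<Theta>. \<Theta> $$ (i n, j n)) \<Theta>0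
      (\<lambda>n. desparsified n (p n) (i n) (j n) (lam n) (\<gamma>hat n)) \<and>
    (\<forall>T. strongly_asymp_unbiased p (\<lambda>n. prec_class C1 C2 C3 (p n) (\<T> n) (d n)) c (\<lambda>n \<Theta>. \<Theta> $$ (i n, j n)) \<Theta>0 T \<longrightarrow>
       (\<exists>e\<in>o(\<lambda>_. 1). \<forall>\<^sub>F n in sequentially.
          prob_space.variance (sample_law n (p n) (\<Theta>0 n)) (T n) \<ge> (sigma_sq (\<Theta>0 n) (i n) (j n) + e n) / real n)) \<and>
    (\<exists>e\<in>o(\<lambda>_. 1). \<forall>\<^sub>F n in sequentially.
       prob_space.variance (sample_law n (p n) (\<Theta>0 n)) (desparsified n (p n) (i n) (j n) (lam n) (\<gamma>hat n))
         = (sigma_sq (\<Theta>0 n) (i n) (j n) + e n) / real n)"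
proof -
  define G where "G n = prec_class C1 C2 C3 (p n) (\<T> n) (d n)" for n
  define rate where "rate n = sqrt (ln (real (p n)) / real n)" for n
  define That where "That n = desparsified n (p n) (i n) (j n) (lam n) (\<gamma>hat n)" for n
  let ?K = "max C2 C3"
  note \<Theta>0 = \<Theta>0'[folded G_def] and pert = pert'[folded G_def]
    and lami = lami'[folded rate_def] and lamj = lamj'[folded rate_def] and lamA = lamA'[folded rate_def]
  have rate0: "0 \<le> rate n" for n
  proof -
    have "1 \<le> real (p n)" using ij[rule_format, of n] by linarith
    then show ?thesis by (simp add: rate_def)
  qed
  \<comment> \<open>These upper constants may depend on the sequences of penalties, unlike the lower
    factor 176 C2 K. They enter only fixed factors in front of \<open>re\<close>, which tends to
    0.\<close>
  obtain c1 c2 where c12: "0 < c1" "\<forall>\<^sub>F n in sequentially. norm (lam n (i n)) \<le> c1 * norm (rate n)"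
    "0 < c2" "\<forall>\<^sub>F n in sequentially. norm (lam n (j n)) \<le> c2 * norm (rate n)"
    using bigthetaD1[OF lami] bigthetaD1[OF lamj] by (auto elim!: landau_o.bigE)
  define cu where "cu = max c1 c2"
  have cu: "0 \<le> cu" using c12 by (simp add: cu_def)
  have lamU: "\<forall>\<^sub>F n in sequentially. lam n (i n) \<le> cu * rate n \<and> lam n (j n) \<le> cu * rate n"
    using c12(2,4)
  proof eventually_elim
    case (elim n)
    have "c1 * rate n \<le> cu * rate n" "c2 * rate n \<le> cu * rate n"
      using rate0[of n] by (simp_all add: cu_def mult_right_mono)
    then show ?case using elim rate0[of n] by (auto simp: abs_le_iff)
  qed
  define re where "re n = regime_error n (real (p n)) (max (d n (i n)) (d n (j n)))" for n
  have re: "re \<longlonglongrightarrow> 0"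
  proof -
    have "(\<lambda>n. real n powr (-1/8)) \<longlonglongrightarrow> 0" by real_asymp
    from tendsto_add[OF this tendsto_rabs[OF smalloD_tendsto[OF sparse]]]
    show ?thesis by (simp add: re_def[abs_def] regime_error_def)
  qed
  define R where "R n = remainder_bound C1 C2 C3 cu n (real (p n)) (max (d n (i n)) (d n (j n)))" for n
  define M where "M = moment_const C2 C3 (2 / (176 * C2 * ?K)) + 1"
  have M: "0 \<le> M" using C by (simp add: M_def moment_const_def)
  have R: "R n = (remainder_const C1 C2 C3 cu * re n)\<^sup>2 / real n + M / (real n)\<^sup>2" for n
    by (simp add: R_def remainder_bound_def re_def M_def)
  have R0: "0 \<le> R n" for n unfolding R using M by simp
  have nR: "(\<lambda>n. real n * R n) \<longlonglongrightarrow> 0"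
  proof -
    have "(\<lambda>n. (remainder_const C1 C2 C3 cu * re n)\<^sup>2 + M * (1 / real n)) \<longlonglongrightarrow> (remainder_const C1 C2 C3 cu * 0)\<^sup>2 + M * 0"
      by (intro tendsto_intros re lim_1_over_n)
    moreover have "\<forall>\<^sub>F n in sequentially. (remainder_const C1 C2 C3 cu * re n)\<^sup>2 + M * (1 / real n) = real n * R n"
      using eventually_gt_at_top[of 0] by eventually_elim (simp add: R distrib_left power2_eq_square)
    ultimately show ?thesis by (simp add: filterlim_cong)
  qed
  have meas: "That n \<in> borel_measurable (data_space n (p n))" for n
    unfolding That_def using lasso ij by (intro desparsified_measurable) auto
  have pm: "prec_matrix (p n) \<Theta> C2 C3" if "\<Theta> \<in> G n" for n \<Theta>
    using prec_class_prec_matrix that C ij[rule_format, of n] unfolding G_def by (metis gr_implies_not0 not_gr_zero)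
  define c0 where "c0 = (64 * C3 * ?K + 2 * C3 * ((2 + 8 * C2 * C3) * (2 * ?K + 2 * ?K * C2 + cu)) + 1) * (1 + 2000 * C1)"
  have small: "\<forall>\<^sub>F n in sequentially. c0 * re n < 1"
    using order_tendstoD(2)[OF tendsto_mult[OF tendsto_const[of c0] re], of 1] by simp
  have a1: "\<forall>\<^sub>F n in sequentially. sqrt (ln (real n) / real n) \<le> real n powr (-3/8)" by real_asymp
  have a2: "\<forall>\<^sub>F n in sequentially. 12 * real n ^ 14 * exp (- (real n powr (1/4) / 16)) \<le> 1" by real_asymp
  have rem: "\<forall>\<^sub>F n in sequentially. \<forall>\<Theta>\<in>G n. mean_le (Pi\<^sub>M {..<n} (\<lambda>_. normal_vec (p n) (minv \<Theta>)))
    (\<lambda>X. (That n X - (2 * \<Theta> $$ (i n,j n) - cov n (p n) X (\<lambda>l. \<Theta> $$ (l,i n)) (\<lambda>l. \<Theta> $$ (l,j n))))\<^sup>2) (R n)"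
    using small a1 a2 lamU lamA eventually_ge_at_top[of 16]
  proof eventually_elim
    case (elim n)
    show ?case unfolding That_def R_def
    proof (intro ballI remainder_uniform)
      fix \<Theta> assume "\<Theta> \<in> G n"
      then show "\<Theta> \<in> prec_class C1 C2 C3 (p n) (\<T> n) (d n)" by (simp add: G_def)
    qed (use elim C cu ij lasso in \<open>auto simp: rate_def re_def c0_def mult.assoc less_imp_le\<close>)
  qed
  have moments: "\<forall>\<^sub>F n in sequentially. \<forall>\<Theta>\<in>G n. integrable (sample_law n (p n) \<Theta>) (\<lambda>X. (That n X)\<^sup>2)
     \<and> integrable (sample_law n (p n) \<Theta>) (That n) \<and> (integral\<^sup>L (sample_law n (p n) \<Theta>) (That n) - \<Theta> $$ (i n, j n))\<^sup>2 \<le> R n"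
    using rem eventually_gt_at_top[of 0]
  proof eventually_elim
    case (elim n)
    then show ?case unfolding That_def
      using prec_matrix.desparsified_moments(1-3)[OF pm _ _ _ meas[unfolded That_def]] ij by blast
  qed
  have var: "\<forall>\<^sub>F n in sequentially. \<forall>\<eta>>0. \<bar>prob_space.variance (sample_law n (p n) (\<Theta>0 n)) (That n) - sigma_sq (\<Theta>0 n) (i n) (j n) / real n\<bar>
     \<le> \<eta> * (sigma_sq (\<Theta>0 n) (i n) (j n) / real n) + (1 + 1 / \<eta>) * R n"
    using rem eventually_gt_at_top[of 0]
  proof eventually_elim
    case (elim n)
    then show ?case unfolding That_def
      using prec_matrix.desparsified_moments(4)[OF pm _ _ _ meas[unfolded That_def]] ij \<Theta>0 by blast
  qed
  have s: "1 / C2\<^sup>2 \<le> sigma_sq (\<Theta>0 n) (i n) (j n)" "sigma_sq (\<Theta>0 n) (i n) (j n) \<le> 2 * C3\<^sup>2" for n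
    using prec_matrix.sigma_sq_bounds[OF pm] \<Theta>0 ij by blast+
  have s0: "0 \<le> sigma_sq (\<Theta>0 n) (i n) (j n)" for n by (rule order_trans[OF _ s(1)]) simp
  have "(\<exists>e\<in>o(\<lambda>_. 1). \<forall>\<^sub>F n in sequentially. prob_space.variance (sample_law n (p n) (\<Theta>0 n)) (That n)
      = (sigma_sq (\<Theta>0 n) (i n) (j n) + e n) / real n)"
    "strongly_asymp_unbiased p G c (\<lambda>n \<Theta>. \<Theta> $$ (i n, j n)) \<Theta>0 That"
    using unbiased_of_remainder[where g = "\<lambda>n \<Theta>. \<Theta> $$ (i n, j n)", OF meas R0 nR _ s0 s(2) moments var] \<Theta>0 by blast+
  moreover have "\<exists>e\<in>o(\<lambda>_. 1). \<forall>\<^sub>F n in sequentially.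
      prob_space.variance (sample_law n (p n) (\<Theta>0 n)) (T n) \<ge> (sigma_sq (\<Theta>0 n) (i n) (j n) + e n) / real n"
    if "strongly_asymp_unbiased p G c (\<lambda>n \<Theta>. \<Theta> $$ (i n, j n)) \<Theta>0 T" for T
    by (rule variance_lower_bound[OF C(2-4) _ _ _ G_def pert that]) (use ij \<Theta>0 in blast)+
  ultimately show ?thesis unfolding G_def[abs_def] That_def[abs_def] by blast
qed

text \<open>The order relation between penalty and rate leaves the constant open, whereas the cone
  condition of the Lasso needs a penalty above the noise. \<open>A\<close> makes this explicit; it
  is chosen before all sequences and depends on C2 and C3 only.\<close>

theorem theorem8:
  fixes C1 C2 C3 c :: real
  assumes "0 < C1" "0 < C2" "0 < C3" "0 < c"
  shows "\<exists>A>0. \<forall>(p :: nat \<Rightarrow> nat) (\<T> :: nat \<Rightarrow> real mat set) (d :: nat \<Rightarrow> nat \<Rightarrow> real)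
      (\<Sigma>0 :: nat \<Rightarrow> real mat) (\<Theta>0 :: nat \<Rightarrow> real mat) (i :: nat \<Rightarrow> nat) (j :: nat \<Rightarrow> nat)
      (lam :: nat \<Rightarrow> nat \<Rightarrow> real)
      (\<gamma>hat :: nat \<Rightarrow> nat \<Rightarrow> (nat \<Rightarrow> nat \<Rightarrow> real) \<Rightarrow> nat \<Rightarrow> real).
    let G = (\<lambda>n. prec_class C1 C2 C3 (p n) (\<T> n) (d n));
        H = (\<lambda>n. worst_direction (p n) (\<Theta>0 n) (i n) (j n));
        rate = (\<lambda>n. sqrt (ln (real (p n)) / real n));
        g = (\<lambda>n \<Theta>. \<Theta> $$ (i n, j n));
        That = (\<lambda>n. desparsified n (p n) (i n) (j n) (lam n) (\<gamma>hat n));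
        var0 = (\<lambda>n (T :: (nat \<Rightarrow> nat \<Rightarrow> real) \<Rightarrow> real).
                  prob_space.variance (sample_law n (p n) (\<Theta>0 n)) T)
    in
      (\<forall>n. i n < p n \<and> j n < p n) \<longrightarrow>
      (\<forall>n. \<Sigma>0 n \<in> carrier_mat (p n) (p n) \<and> invertible_mat (\<Sigma>0 n) \<and> \<Theta>0 n = minv (\<Sigma>0 n)) \<longrightarrow>
      (\<forall>n. \<Theta>0 n \<in> G n) \<longrightarrow>
      (\<lambda>n. max (d n (i n)) (d n (j n)) * ln (real (p n))) \<in> o(\<lambda>n. sqrt (real n)) \<longrightarrow>
      (\<forall>\<^sub>F n in sequentially. \<forall>m\<ge>real n.
         \<Theta>0 n + (1 / sqrt m) \<cdot>\<^sub>m H n \<in> prec_ball (G n) (\<Theta>0 n) (c / sqrt m)) \<longrightarrow>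
      (\<lambda>n. lam n (i n)) \<in> \<Theta>(rate) \<longrightarrow>
      (\<lambda>n. lam n (j n)) \<in> \<Theta>(rate) \<longrightarrow>
      (\<forall>\<^sub>F n in sequentially. A * rate n \<le> lam n (i n) \<and> A * rate n \<le> lam n (j n)) \<longrightarrow>
      (\<forall>n. \<forall>k\<in>{i n, j n}. nodewise_lasso n (p n) k (lam n k) (\<gamma>hat n k)) \<longrightarrow>
      strongly_asymp_unbiased p G c g \<Theta>0 That \<and>
      (\<forall>T. strongly_asymp_unbiased p G c g \<Theta>0 T \<longrightarrow>
         (\<exists>e \<in> o(\<lambda>_. 1). \<forall>\<^sub>F n in sequentially.
            var0 n (T n) \<ge> (sigma_sq (\<Theta>0 n) (i n) (j n) + e n) / real n)) \<and>
      (\<exists>e \<in> o(\<lambda>_. 1). \<forall>\<^sub>F n in sequentially.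
         var0 n (That n) = (sigma_sq (\<Theta>0 n) (i n) (j n) + e n) / real n)"
proof (intro exI[of _ "176 * C2 * max C2 C3"] conjI allI)
  show "0 < 176 * C2 * max C2 C3" using assms by simp
qed (unfold Let_def, intro impI, rule desparsified_efficient[OF assms], assumption+)

end
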